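(* Let $n\ge 3$, $N\ge 2$, and let $F:\mathbb{R}^n\times\mathbb{R}^{N\times n}\to\mathbb{R}^N$ be a Carathéodory map such that $F(x,0)=0$ for a.e. $x\in\mathbb{R}^n$ and which is strictly elliptic, i.e. there exists a linear map $A:\mathbb{R}^{N\times n}\to\mathbb{R}^N$ such that $$\operatorname*{ess\,sup}_{x\in\mathbb{R}^n}\ \sup_{P,Q\in\mathbb{R}^{N\times n},\,Q\neq0}\left|\frac{F(x,P+Q)-F(x,P)-A:Q}{|Q|}\right|\ <\ \min_{|\eta|=|a|=1}|A:\eta\otimes a|,$$ where the minimum is over $\eta\in\mathbb{R}^N$, $a\in\mathbb{R}^n$. Let $f\in L^2(\mathbb{R}^n)^N$. Then the problem $$F(\cdot,Du)=f\quad\text{a.e. on }\mathbb{R}^n$$ has a unique solution $u$ in the space $W^{1;2^*,2}(\mathbb{R}^n)^N$, and this solution satisfies $$\|u\|_{L^{2^*}(\mathbb{R}^n)}+\|Du\|_{L^2(\mathbb{R}^n)}\le C\,\|f\|_{L^2(\mathbb{R}^n)}$$ for some $C>0$ depending only on $F$.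
   Context: $F$ is Carathéodory if $x\mapsto F(x,P)$ is measurable for every $P\in\mathbb{R}^{N\times n}$ and $P\mapsto F(x,P)$ is continuous for a.e. $x\in\mathbb{R}^n$. $|\cdot|$ denotes the Euclidean norm on $\mathbb{R}^n$, $\mathbb{R}^N$ and $\mathbb{R}^{N\times n}$. $2^*=\frac{2n}{n-2}$ and $$W^{1;2^*,2}(\mathbb{R}^n)^N:=\{u\in L^{2^*}(\mathbb{R}^n)^N : Du\in L^2(\mathbb{R}^n)^{Nn}\},$$ where $Du=(D_iu_\alpha)\in\mathbb{R}^{N\times n}$ is the weak gradient matrix of $u:\mathbb{R}^n\to\mathbb{R}^N$. A linear map $A:\mathbb{R}^{N\times n}\to\mathbb{R}^N$ is identified with its components $A_{\alpha\beta j}$ via $(A:Q)_\alpha=\sum_{\beta,j}A_{\alpha\beta j}Q_{\beta j}$; $\eta\otimes a\in\mathbb{R}^{N\times n}$ has entries $\eta_\beta a_j$. *)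

theory Defs
  imports "HOL-Analysis.Analysis" "HOL-Probability.Essential_Supremum"
begin

section \<open>Lebesgue spaces\<close>

text \<open>
  Elements are functions, not equivalence classes; statements about elements of these spaces are
  therefore made up to equality almost everywhere.
\<close>

definition Lp_space :: "real \<Rightarrow> ('a::euclidean_space \<Rightarrow> 'b::euclidean_space) set" where
  "Lp_space p = {u \<in> borel_measurable lebesgue. integrable lebesgue (\<lambda>x. norm (u x) powr p)}"

definition Lp_norm :: "real \<Rightarrow> ('a::euclidean_space \<Rightarrow> 'b::euclidean_space) \<Rightarrow> real" where
  "Lp_norm p u = (LINT x|lebesgue. norm (u x) powr p) powr (1 / p)"


section \<open>Test functions and weak gradients\<close>

definition partial_deriv :: "'n::finite \<Rightarrow> (real^'n \<Rightarrow> real) \<Rightarrow> real^'n \<Rightarrow> real" where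
  "partial_deriv i \<phi> x = frechet_derivative \<phi> (at x) (axis i 1)"

primrec Ck :: "nat \<Rightarrow> (real^'n::finite \<Rightarrow> real) \<Rightarrow> bool" where
  "Ck 0 \<phi> \<longleftrightarrow> continuous_on UNIV \<phi>"
| "Ck (Suc k) \<phi> \<longleftrightarrow> \<phi> differentiable_on UNIV \<and> (\<forall>i. Ck k (partial_deriv i \<phi>))"

definition test_function :: "(real^'n::finite \<Rightarrow> real) \<Rightarrow> bool" where
  "test_function \<phi> \<longleftrightarrow> (\<forall>k. Ck k \<phi>) \<and> compact (closure {x. \<phi> x \<noteq> 0})"

definition locally_integrable :: "('a::euclidean_space \<Rightarrow> 'b::euclidean_space) \<Rightarrow> bool" where
  "locally_integrable u \<longleftrightarrow> (\<forall>K. compact K \<longrightarrow> u absolutely_integrable_on K)"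

text \<open>
  The weak gradient is determined only almost everywhere, hence a relation. The type
  \<open>real^'n^'m\<close> is the type of matrices with rows indexed by \<open>'m\<close> and columns by \<open>'n\<close>;
  its norm is the Euclidean (Frobenius) norm.
\<close>

definition has_weak_gradient ::
    "(real^'n::finite \<Rightarrow> real^'m::finite) \<Rightarrow> (real^'n \<Rightarrow> real^'n^'m) \<Rightarrow> bool" where
  "has_weak_gradient u Du \<longleftrightarrow>
     locally_integrable u \<and> locally_integrable Du \<and>
     (\<forall>\<phi>. test_function \<phi> \<longrightarrow>
        (\<forall>\<alpha> i. (LINT x|lebesgue. u x $ \<alpha> * partial_deriv i \<phi> x)
              = - (LINT x|lebesgue. Du x $ \<alpha> $ i * \<phi> x)))"


section \<open>The space of solutions\<close>

definition sobolev_exponent :: "nat \<Rightarrow> real" where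
  "sobolev_exponent n = 2 * real n / (real n - 2)"

definition W_space :: "(real^'n::finite \<Rightarrow> real^'m::finite) set" where
  "W_space = {u \<in> Lp_space (sobolev_exponent CARD('n)).
                \<exists>Du. has_weak_gradient u Du \<and> Du \<in> Lp_space 2}"

definition solves ::
    "(real^'n::finite \<Rightarrow> real^'n^'m::finite \<Rightarrow> real^'m) \<Rightarrow> (real^'n \<Rightarrow> real^'m) \<Rightarrow>
     (real^'n \<Rightarrow> real^'m) \<Rightarrow> (real^'n \<Rightarrow> real^'n^'m) \<Rightarrow> bool" where
  "solves F f u Du \<longleftrightarrow>
     u \<in> W_space \<and> has_weak_gradient u Du \<and> Du \<in> Lp_space 2 \<and>
     (AE x in lebesgue. F x (Du x) = f x)"


section \<open>Caratheodory maps and strict ellipticity\<close>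

definition caratheodory ::
    "(real^'n::finite \<Rightarrow> real^'n^'m::finite \<Rightarrow> real^'m) \<Rightarrow> bool" where
  "caratheodory F \<longleftrightarrow>
     (\<forall>P. (\<lambda>x. F x P) \<in> borel_measurable lebesgue) \<and>
     (AE x in lebesgue. continuous_on UNIV (F x))"

definition tensor :: "real^'m::finite \<Rightarrow> real^'n::finite \<Rightarrow> real^'n^'m" (infixl \<open>\<otimes>\<^sub>v\<close> 75) where
  "\<eta> \<otimes>\<^sub>v a = (\<chi> \<beta> j. \<eta> $ \<beta> * a $ j)"

text \<open>The infimum is a minimum; see \<open>ellipticity_constant_attained\<close> below.\<close>

definition ellipticity_constant :: "(real^'n::finite^'m::finite \<Rightarrow> real^'m) \<Rightarrow> real" where
  "ellipticity_constant A = (INF (\<eta>, a) \<in> {(\<eta>, a). norm \<eta> = 1 \<and> norm a = 1}. norm (A (\<eta> \<otimes>\<^sub>v a)))"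

definition deviation ::
    "(real^'n::finite \<Rightarrow> real^'n^'m::finite \<Rightarrow> real^'m) \<Rightarrow> (real^'n^'m \<Rightarrow> real^'m) \<Rightarrow>
     real^'n \<Rightarrow> ereal" where
  "deviation F A x =
     (SUP P. SUP Q \<in> {Q. Q \<noteq> 0}. ereal (norm ((F x (P + Q) - F x P - A Q) /\<^sub>R norm Q)))"

text \<open>
  \<open>esssup\<close> is \<open>\<infinity>\<close> by convention on non-measurable functions; for a Caratheodory map
  \<open>F\<close> this does not interfere, see \<open>deviation_measurable\<close> below.
\<close>

definition strictly_elliptic ::
    "(real^'n::finite \<Rightarrow> real^'n^'m::finite \<Rightarrow> real^'m) \<Rightarrow> bool" where
  "strictly_elliptic F \<longleftrightarrow>
     (\<exists>A. linear A \<and> esssup lebesgue (deviation F A) < ereal (ellipticity_constant A))"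

lemma ellipticity_constant_attained:
  fixes A :: "real^'n::finite^'m::finite \<Rightarrow> real^'m"
  assumes "linear A"
  obtains \<eta> a where "norm \<eta> = 1" "norm a = 1" "ellipticity_constant A = norm (A (\<eta> \<otimes>\<^sub>v a))"
    "\<And>\<eta>' a'. norm \<eta>' = 1 \<Longrightarrow> norm a' = 1 \<Longrightarrow> norm (A (\<eta> \<otimes>\<^sub>v a)) \<le> norm (A (\<eta>' \<otimes>\<^sub>v a'))"
proof -
  let ?S = "sphere 0 1 \<times> sphere 0 1 :: ((real^'m) \<times> (real^'n)) set"
  let ?g = "\<lambda>p::(real^'m) \<times> (real^'n). norm (A (fst p \<otimes>\<^sub>v snd p))"
  have S: "{(\<eta>, a). norm \<eta> = 1 \<and> norm a = 1} = ?S" by auto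
  have "continuous_on ?S (\<lambda>p. fst p \<otimes>\<^sub>v snd p)"
    unfolding tensor_def by (intro continuous_intros)
  then have "continuous_on ?S ?g"
    using linear_continuous_on_compose[OF _ assms] by (intro continuous_on_norm) blast
  moreover have "compact ?S" by (intro compact_Times compact_sphere)
  moreover have "(axis undefined 1, axis undefined 1) \<in> ?S" by simp
  then have "?S \<noteq> {}" by blast
  ultimately obtain p where p: "p \<in> ?S" "\<forall>q\<in>?S. ?g p \<le> ?g q"
    using continuous_attains_inf[of ?S ?g] by blast
  have "(INF q\<in>?S. ?g q) = ?g p"
    using p by (intro cInf_eq_minimum) auto
  then have "ellipticity_constant A = ?g p"
    unfolding ellipticity_constant_def S by (simp add: case_prod_beta)
  with p show thesis
    by (intro that[of "fst p" "snd p"]) force+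
qed

lemma deviation_measurable:
  fixes F :: "real^'n::finite \<Rightarrow> real^'n^'m::finite \<Rightarrow> real^'m"
  assumes F: "caratheodory F" and A: "linear A"
  shows "deviation F A \<in> borel_measurable lebesgue"
proof -
  obtain D :: "(real^'n^'m) set" where D: "countable D" "\<And>X. open X \<Longrightarrow> X \<noteq> {} \<Longrightarrow> \<exists>d\<in>D. d \<in> X"
    using countable_dense_setE by blast
  let ?h = "\<lambda>x P Q. ereal (norm ((F x (P + Q) - F x P - A Q) /\<^sub>R norm Q))"
  define g where "g x = (SUP P\<in>D. SUP Q\<in>D - {0}. ?h x P Q)" for x
  have [measurable]: "(\<lambda>x. F x P) \<in> borel_measurable lebesgue" for P
    using F by (simp add: caratheodory_def)
  have "g \<in> borel_measurable lebesgue"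
    unfolding g_def using D(1) by (intro borel_measurable_SUP) auto
  moreover have "AE x in lebesgue. g x = deviation F A x"
  proof -
    have "g x = deviation F A x" if c: "continuous_on UNIV (F x)" for x
    proof (rule antisym)
      show "g x \<le> deviation F A x"
        unfolding g_def deviation_def by (intro SUP_mono' SUP_subset_mono) auto
      have "?h x P Q \<le> g x" if "Q \<noteq> 0" for P Q
      proof (rule ccontr)
        assume less: "\<not> ?h x P Q \<le> g x"
        let ?k = "\<lambda>p. norm ((F x (fst p + snd p) - F x (fst p) - A (snd p)) /\<^sub>R norm (snd p))"
        let ?U = "UNIV \<times> - {0} :: ((real^'n^'m) \<times> (real^'n^'m)) set"
        have *: "continuous_on ?U (\<lambda>p. F x (h p))" if "continuous_on ?U h" for h
          using continuous_on_compose2[OF c that] by auto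
        have "continuous_on ?U (\<lambda>p. A (snd p))"
          by (intro linear_continuous_on_compose[OF _ A] continuous_intros)
        then have "continuous_on ?U (\<lambda>p. ereal (?k p))"
          by (intro continuous_intros *) auto
        moreover have "open ?U" by (intro open_Times) auto
        ultimately have "open (?U \<inter> (\<lambda>p. ereal (?k p)) -` {g x<..})" (is "open ?O")
          by (rule continuous_open_preimage) simp
        moreover have "(P, Q) \<in> ?O"
          using less \<open>Q \<noteq> 0\<close> by auto
        ultimately obtain U V where UV: "open U" "open V" "(P, Q) \<in> U \<times> V" "U \<times> V \<subseteq> ?O"
          by (rule open_prod_elim)
        obtain P' Q' where PQ': "P' \<in> D" "P' \<in> U" "Q' \<in> D" "Q' \<in> V"
          using D(2)[OF UV(1)] D(2)[OF UV(2)] UV(3) by blast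
        then have "(P', Q') \<in> ?O"
          using UV(4) by blast
        then have "g x < ?h x P' Q'" "Q' \<noteq> 0" by auto
        moreover have "?h x P' Q' \<le> g x"
          unfolding g_def using PQ' \<open>Q' \<noteq> 0\<close>
          by (intro SUP_upper2[OF PQ'(1)] SUP_upper) auto
        ultimately show False by simp
      qed
      then show "deviation F A x \<le> g x"
        unfolding deviation_def by (intro SUP_least) auto
    qed
    with F show ?thesis unfolding caratheodory_def by (auto elim: eventually_mono)
  qed
  ultimately have g: "g \<in> borel_measurable lebesgue" "AE x in lebesgue. g x = deviation F A x"
    by auto
  show ?thesis
  proof (rule measurableI)
    fix B :: "ereal set" assume B: "B \<in> sets borel"
    have "g -` B \<inter> space lebesgue \<in> sets lebesgue"
      using g(1) B by (rule measurable_sets)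
    moreover have "AE x in lebesgue.
        x \<in> g -` B \<inter> space lebesgue \<longleftrightarrow> x \<in> deviation F A -` B \<inter> space lebesgue"
      using g(2) by eventually_elim simp
    ultimately show "deviation F A -` B \<inter> space lebesgue \<in> sets lebesgue"
      using completion.in_sets_AE[where M = lborel] by blast
  qed simp
qed

end

theory Submission
  imports Defs "HOL-Probability.Characteristic_Functions" "HOL-Probability.Infinite_Product_Measure"
begin

text \<open>
  The map \<open>F\<close> is treated as a perturbation of the linear map \<open>A\<close> (Campanato's nearness). Let \<open>\<nu>\<close> be the
  minimum of \<open>\<bar>A (\<eta> \<otimes>\<^sub>v a)\<bar>\<close> over unit vectors and let \<open>\<kappa> < \<nu>\<close> be the essential supremum of the
  deviation of \<open>F\<close> from \<open>A\<close>. If the linear system \<open>A (Du) = f\<close> is solvable for every square integrable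
  \<open>f\<close>, and if \<open>\<nu> \<parallel>Du\<parallel> \<le> \<parallel>A (Du)\<parallel>\<close> holds in \<open>L\<^sup>2\<close> for all functions of the solution space, then the
  equation \<open>A (Du) = f - (F (x, Du) - A (Du))\<close> is solved by a contraction with factor \<open>\<kappa> / \<nu>\<close>
  (\<open>near_linear_system_solvable\<close>). The same two inequalities give uniqueness of the gradient and the
  estimate of \<open>\<parallel>Du\<parallel>\<close> by \<open>\<parallel>f\<parallel> / (\<nu> - \<kappa>)\<close>; the Sobolev inequality transfers both from \<open>Du\<close> to \<open>u\<close>.

  The bound with the sharp constant \<open>\<nu>\<close> (\<open>elliptic_gradient_bound\<close>) is usually read off from Plancherel's
  theorem, since the Fourier transform of a gradient field takes values in rank-one matrices. Here the
  Fourier transform is replaced by averages: for a standard normal vector \<open>X\<close>, the expectation of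
  \<open>cos (s X \<bullet> (x - y))\<close> is a Gaussian kernel, so that the integral of \<open>Dv x \<bullet> Dv y\<close> against this kernel is
  an average of squared norms of rank-one matrices. There the hypothesis on \<open>A\<close> applies, and the kernel
  concentrates on the diagonal as \<open>s\<close> tends to infinity.

  Solvability of the linear system (\<open>linear_system_solvable\<close>) is a least squares argument: the range of
  \<open>A\<close> on gradients is closed by the bound just described, and it is dense because a function \<open>r\<close>
  orthogonal to it solves the homogeneous transposed system weakly. Mollifying and cutting off \<open>r\<close>, and
  using ellipticity of the transposed map, shows that \<open>r\<close> is zero (\<open>orthogonal_to_range_eq_0\<close>).

  Both inequalities are first proved for continuously differentiable fields of compact support. The
  Sobolev inequality (\<open>Sobolev_inequality\<close>) follows the proof of Gagliardo and Nirenberg, with the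
  induction over the coordinates isolated in \<open>grid_lines_inequality\<close>. Mollification and cutoff show that
  such fields are dense in the solution space (\<open>weak_gradient_test_limit\<close>), so that all arguments can be
  carried out in their closure.
\<close>

section \<open>Lebesgue spaces\<close>

text \<open>All uses of the convexity of \<open>t powr p\<close> go through this tangent inequality: summed with weights
  it gives the inequality behind Minkowski's, and integrated against a probability density it gives
  Jensen's.\<close>

lemma powr_above_tangent:
  fixes a t p :: real
  assumes "1 \<le> p" "0 < a" "0 \<le> t"
  shows "a powr p + p * a powr (p - 1) * (t - a) \<le> t powr p"
proof (cases "t = 0")
  case True
  have "a powr (p - 1) * a = a powr p"
    using assms by (metis powr_mult_base mult.commute add_diff_cancel_left' diff_add_cancel less_imp_le)
  then have "a powr p + p * a powr (p - 1) * (t - a) = (1 - p) * a powr p"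
    using True by (simp add: algebra_simps)
  also have "\<dots> \<le> 0" using assms by (simp add: mult_nonpos_nonneg)
  finally show ?thesis using True by simp
next
  case False
  have "p * a powr (p - 1) * (t - a) \<le> t powr p - a powr p"
  proof (rule convex_on_imp_above_tangent[OF powr_convex[OF assms(1)]])
    show "connected {0::real<..}" by simp
    show "a \<in> interior {0<..}" using assms by (simp add: interior_open)
    show "((\<lambda>x. x powr p) has_real_derivative p * a powr (p - 1)) (at a within {0<..})"
      by (rule has_field_derivative_at_within[OF has_real_derivative_powr[OF assms(2)]])
  qed (use False assms in auto)
  then show ?thesis by simp
qed

lemma powr_convex_comb:
  fixes a b s t p :: real
  assumes "1 \<le> p" "0 \<le> a" "0 \<le> b" "0 \<le> s" "0 \<le> t" "s + t = 1"
  shows "(s * a + t * b) powr p \<le> s * a powr p + t * b powr p"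
proof (cases "s * a + t * b = 0")
  case True
  then show ?thesis using assms by simp
next
  case False
  define c where "c = s * a + t * b"
  have c: "c > 0" using False assms unfolding c_def by (smt (verit) mult_nonneg_nonneg)
  let ?d = "p * c powr (p - 1)"
  have "s * (c powr p + ?d * (a - c)) + t * (c powr p + ?d * (b - c)) \<le> s * a powr p + t * b powr p"
    using assms c by (intro add_mono mult_left_mono powr_above_tangent) auto
  moreover have "s * (c powr p + ?d * (a - c)) + t * (c powr p + ?d * (b - c))
      = (s + t) * c powr p + ?d * (s * a + t * b - (s + t) * c)"
    by (simp add: algebra_simps)
  moreover have "\<dots> = c powr p" using assms(6) by (simp only: c_def mult_1 diff_self mult_zero_right add_0_right)
  ultimately have "c powr p \<le> s * a powr p + t * b powr p" by (simp only:)
  then show ?thesis by (simp only: c_def)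
qed

lemma Lp_space_measurable: "f \<in> Lp_space p \<Longrightarrow> f \<in> borel_measurable lebesgue"
  by (simp add: Lp_space_def)

lemma Lp_space_integrable: "f \<in> Lp_space p \<Longrightarrow> integrable lebesgue (\<lambda>x. norm (f x) powr p)"
  by (simp add: Lp_space_def)

lemma Lp_norm_nonneg [simp]: "0 \<le> Lp_norm p f"
  by (simp add: Lp_norm_def)

lemma Lp_norm_powr: "0 < p \<Longrightarrow> Lp_norm p f powr p = (LINT x|lebesgue. norm (f x) powr p)"
  by (simp add: Lp_norm_def powr_powr)

lemma Lp_norm_leI:
  assumes "0 < p" "0 \<le> K" "(LINT x|lebesgue. norm (f x) powr p) \<le> K powr p"
  shows "Lp_norm p f \<le> K"
proof -
  have "Lp_norm p f \<le> (K powr p) powr (1 / p)"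
    unfolding Lp_norm_def using assms by (intro powr_mono2) auto
  then show ?thesis using assms by (simp add: powr_powr)
qed

lemma Lp_bound:
  fixes f :: "'a::euclidean_space \<Rightarrow> 'b::euclidean_space" and g :: "'a \<Rightarrow> 'c::euclidean_space"
  assumes p: "0 < p" and f: "f \<in> borel_measurable lebesgue" and g: "g \<in> Lp_space p"
    and c: "0 \<le> c" and le: "AE x in lebesgue. norm (f x) \<le> c * norm (g x)"
  shows "f \<in> Lp_space p" "Lp_norm p f \<le> c * Lp_norm p g"
proof -
  have le': "AE x in lebesgue. norm (f x) powr p \<le> c powr p * norm (g x) powr p"
    using le
  proof eventually_elim
    case (elim x)
    then have "norm (f x) powr p \<le> (c * norm (g x)) powr p"
      using p by (intro powr_mono2) auto
    then show ?case using c by (simp add: powr_mult)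
  qed
  have [measurable]: "f \<in> borel_measurable lebesgue" by fact
  have ig: "integrable lebesgue (\<lambda>x. c powr p * norm (g x) powr p)"
    using Lp_space_integrable[OF g] by simp
  have i: "integrable lebesgue (\<lambda>x. norm (f x) powr p)"
    by (rule Bochner_Integration.integrable_bound[OF ig]) (use le' in auto)
  then show "f \<in> Lp_space p" using f by (simp add: Lp_space_def)
  show "Lp_norm p f \<le> c * Lp_norm p g"
  proof (rule Lp_norm_leI[OF p])
    have "(LINT x|lebesgue. norm (f x) powr p) \<le> (LINT x|lebesgue. c powr p * norm (g x) powr p)"
      by (rule integral_mono_AE[OF i ig le'])
    also have "\<dots> = (c * Lp_norm p g) powr p"
      using c p by (simp add: powr_mult Lp_norm_powr)
    finally show "(LINT x|lebesgue. norm (f x) powr p) \<le> (c * Lp_norm p g) powr p" .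
  qed (use c in auto)
qed

lemma Lp_mono:
  fixes f :: "'a::euclidean_space \<Rightarrow> 'b::euclidean_space" and g :: "'a \<Rightarrow> 'c::euclidean_space"
  assumes "0 < p" "f \<in> borel_measurable lebesgue" "g \<in> Lp_space p"
    and "AE x in lebesgue. norm (f x) \<le> norm (g x)"
  shows "f \<in> Lp_space p" "Lp_norm p f \<le> Lp_norm p g"
  using Lp_bound[of p f g 1] assms by auto

lemma Lp_norm_cong_AE:
  assumes "f \<in> borel_measurable lebesgue" "g \<in> borel_measurable lebesgue"
    and "AE x in lebesgue. norm (f x) = norm (g x)"
  shows "Lp_norm p f = Lp_norm p g"
proof -
  have "(LINT x|lebesgue. norm (f x) powr p) = (LINT x|lebesgue. norm (g x) powr p)"
    using assms by (intro integral_cong_AE) auto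
  then show ?thesis by (simp add: Lp_norm_def)
qed

lemma Lp_zero [simp]: "(\<lambda>x. 0) \<in> Lp_space p" "Lp_norm p (\<lambda>x. 0) = 0"
  by (simp_all add: Lp_space_def Lp_norm_def)

lemma Lp_uminus:
  assumes "f \<in> Lp_space p"
  shows "(\<lambda>x. - f x) \<in> Lp_space p" "Lp_norm p (\<lambda>x. - f x) = Lp_norm p f"
  using assms by (auto simp: Lp_space_def Lp_norm_def)

lemma Lp_linear:
  fixes f :: "'a::euclidean_space \<Rightarrow> 'b::euclidean_space" and L :: "'b \<Rightarrow> 'c::euclidean_space"
  assumes "0 < p" "linear L" "f \<in> Lp_space p"
  shows "(\<lambda>x. L (f x)) \<in> Lp_space p" "Lp_norm p (\<lambda>x. L (f x)) \<le> onorm L * Lp_norm p f"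
proof -
  have L: "bounded_linear L" using assms by (simp add: linear_conv_bounded_linear)
  have "(\<lambda>x. L (f x)) \<in> borel_measurable lebesgue"
    using Lp_space_measurable[OF assms(3)]
    by (intro borel_measurable_continuous_on[OF linear_continuous_on[OF L]])
  moreover have "AE x in lebesgue. norm (L (f x)) \<le> onorm L * norm (f x)"
    by (simp add: onorm[OF L])
  ultimately show "(\<lambda>x. L (f x)) \<in> Lp_space p" "Lp_norm p (\<lambda>x. L (f x)) \<le> onorm L * Lp_norm p f"
    using Lp_bound[of p "\<lambda>x. L (f x)" f "onorm L"] assms onorm_pos_le[OF L] by auto
qed

lemma Lp_scaleR:
  assumes "f \<in> Lp_space p"
  shows "(\<lambda>x. c *\<^sub>R f x) \<in> Lp_space p"
  using assms by (auto simp: Lp_space_def powr_mult)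

lemma Lp_add:
  fixes f g :: "'a::euclidean_space \<Rightarrow> 'b::euclidean_space"
  assumes p: "1 \<le> p" and f: "f \<in> Lp_space p" and g: "g \<in> Lp_space p"
  shows "(\<lambda>x. f x + g x) \<in> Lp_space p"
    and Lp_triangle: "Lp_norm p (\<lambda>x. f x + g x) \<le> Lp_norm p f + Lp_norm p g"
proof -
  note [measurable] = Lp_space_measurable[OF f] Lp_space_measurable[OF g]
  note fi = Lp_space_integrable[OF f] and gi = Lp_space_integrable[OF g]
  (* Minkowski's inequality by convexity, with weights proportional to the two norms;
     the slack e keeps the weights well defined when a norm vanishes. *)
  have key: "norm (f x + g x) powr p \<le> (a + b) powr p *
      (a / (a + b) * (norm (f x) powr p / a powr p) + b / (a + b) * (norm (g x) powr p / b powr p))"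
    if "a > 0" "b > 0" for a b x
  proof -
    have "norm (f x + g x) powr p \<le> (norm (f x) + norm (g x)) powr p"
      using p by (intro powr_mono2 norm_triangle_ineq) auto
    also have "norm (f x) + norm (g x) =
        (a + b) * (a / (a + b) * (norm (f x) / a) + b / (a + b) * (norm (g x) / b))"
      using that by (simp add: distrib_left)
    also have "\<dots> powr p = (a + b) powr p *
        (a / (a + b) * (norm (f x) / a) + b / (a + b) * (norm (g x) / b)) powr p"
      using that by (subst powr_mult) auto
    also have "\<dots> \<le> (a + b) powr p *
        (a / (a + b) * (norm (f x) / a) powr p + b / (a + b) * (norm (g x) / b) powr p)"
      using that p by (intro mult_left_mono powr_convex_comb) (auto simp: add_divide_distrib[symmetric])
    finally show ?thesis using that by (simp add: powr_divide)
  qed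
  have i: "integrable lebesgue (\<lambda>x. (a + b) powr p *
      (a / (a + b) * (norm (f x) powr p / a powr p) + b / (a + b) * (norm (g x) powr p / b powr p)))"
    for a b using fi gi by auto
  have int: "integrable lebesgue (\<lambda>x. norm (f x + g x) powr p)"
    by (rule Bochner_Integration.integrable_bound[OF i[of 1 1]]) (use key[of 1 1] in auto)
  then show "(\<lambda>x. f x + g x) \<in> Lp_space p" by (simp add: Lp_space_def)
  show "Lp_norm p (\<lambda>x. f x + g x) \<le> Lp_norm p f + Lp_norm p g"
  proof (rule field_le_epsilon)
    fix e :: real assume "e > 0"
    define a b where "a = Lp_norm p f + e / 2" and "b = Lp_norm p g + e / 2"
    have ab: "a > 0" "b > 0"
      using \<open>e > 0\<close> Lp_norm_nonneg[of p f] Lp_norm_nonneg[of p g] by (simp_all add: a_def b_def add_nonneg_pos)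
    have "(LINT x|lebesgue. norm (f x + g x) powr p) \<le>
        (LINT x|lebesgue. (a + b) powr p *
      (a / (a + b) * (norm (f x) powr p / a powr p) + b / (a + b) * (norm (g x) powr p / b powr p)))"
      by (intro integral_mono int i key ab)
    also have "\<dots> = (a + b) powr p *
      (a / (a + b) * (Lp_norm p f powr p / a powr p) + b / (a + b) * (Lp_norm p g powr p / b powr p))"
      using fi gi p by (simp add: Lp_norm_powr)
    also have "\<dots> \<le> (a + b) powr p * (a / (a + b) * 1 + b / (a + b) * 1)"
      using ab p \<open>e > 0\<close>
      by (intro mult_left_mono add_mono) (auto simp: a_def b_def intro!: powr_mono2)
    also have "\<dots> = (a + b) powr p"
      using ab by (simp add: add_divide_distrib[symmetric])
    finally have "Lp_norm p (\<lambda>x. f x + g x) \<le> a + b"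
      using p ab by (intro Lp_norm_leI) auto
    then show "Lp_norm p (\<lambda>x. f x + g x) \<le> Lp_norm p f + Lp_norm p g + e"
      by (simp add: a_def b_def)
  qed
qed

lemma Lp_diff:
  fixes f g :: "'a::euclidean_space \<Rightarrow> 'b::euclidean_space"
  assumes p: "1 \<le> p" and f: "f \<in> Lp_space p" and g: "g \<in> Lp_space p"
  shows "(\<lambda>x. f x - g x) \<in> Lp_space p"
    and "Lp_norm p (\<lambda>x. f x - g x) \<le> Lp_norm p f + Lp_norm p g"
    and Lp_norm_minus_commute: "Lp_norm p (\<lambda>x. f x - g x) = Lp_norm p (\<lambda>x. g x - f x)"
  using Lp_add[OF p f Lp_uminus(1)[OF g]] Lp_uminus(2)[OF g]
  by (simp_all add: Lp_norm_def norm_minus_commute)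

lemma Lp_norm_triangle_sub:
  fixes f g :: "'a::euclidean_space \<Rightarrow> 'b::euclidean_space"
  assumes p: "1 \<le> p" and f: "f \<in> Lp_space p" and g: "g \<in> Lp_space p"
  shows "Lp_norm p f \<le> Lp_norm p g + Lp_norm p (\<lambda>x. f x - g x)"
  using Lp_triangle[OF p g Lp_diff(1)[OF p f g]] by simp

lemma Lp_dist_triangle:
  fixes f g h :: "'a::euclidean_space \<Rightarrow> 'b::euclidean_space"
  assumes p: "1 \<le> p" and f: "f \<in> Lp_space p" and g: "g \<in> Lp_space p" and h: "h \<in> Lp_space p"
  shows "Lp_norm p (\<lambda>x. f x - h x) \<le> Lp_norm p (\<lambda>x. f x - g x) + Lp_norm p (\<lambda>x. g x - h x)"
  using Lp_triangle[OF p Lp_diff(1)[OF p f g] Lp_diff(1)[OF p g h]] by simp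

lemma Lp_norm_eq_0D:
  assumes "0 < p" "f \<in> Lp_space p" "Lp_norm p f = 0"
  shows "AE x in lebesgue. f x = 0"
proof -
  have "(LINT x|lebesgue. norm (f x) powr p) = 0"
    using Lp_norm_powr[OF assms(1), of f] assms by simp
  then have "AE x in lebesgue. norm (f x) powr p = 0"
    using Lp_space_integrable[OF assms(2)] by (subst (asm) integral_nonneg_eq_0_iff_AE) auto
  then show ?thesis by eventually_elim simp
qed

lemma Lp_fatou:
  fixes h :: "nat \<Rightarrow> 'a::euclidean_space \<Rightarrow> 'b::euclidean_space"
  assumes p: "0 < p" and h: "\<And>k. h k \<in> Lp_space p" and K: "0 \<le> K" "\<And>k. Lp_norm p (h k) \<le> K"
    and lim: "AE x in lebesgue. (\<lambda>k. h k x) \<longlonglongrightarrow> g x" and g: "g \<in> borel_measurable lebesgue"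
  shows "g \<in> Lp_space p" "Lp_norm p g \<le> K"
proof -
  note [measurable] = Lp_space_measurable[OF h] g
  have "(\<integral>\<^sup>+x. ennreal (norm (g x) powr p) \<partial>lebesgue)
      = (\<integral>\<^sup>+x. liminf (\<lambda>k. ennreal (norm (h k x) powr p)) \<partial>lebesgue)"
  proof (rule nn_integral_cong_AE, use lim in eventually_elim)
    case (elim x)
    have "(\<lambda>k. ennreal (norm (h k x) powr p)) \<longlonglongrightarrow> ennreal (norm (g x) powr p)"
      using p by (intro tendsto_ennrealI tendsto_powr' tendsto_norm elim tendsto_const) auto
    then show ?case by (intro lim_imp_Liminf[symmetric]) auto
  qed
  also have "\<dots> \<le> liminf (\<lambda>k. \<integral>\<^sup>+x. ennreal (norm (h k x) powr p) \<partial>lebesgue)"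
    by (intro nn_integral_liminf) auto
  also have "\<dots> \<le> liminf (\<lambda>k. ennreal (K powr p))"
  proof (intro Liminf_mono always_eventually allI)
    fix k
    have "(\<integral>\<^sup>+x. ennreal (norm (h k x) powr p) \<partial>lebesgue) = ennreal (Lp_norm p (h k) powr p)"
      using Lp_space_integrable[OF h] p by (subst nn_integral_eq_integral) (auto simp: Lp_norm_powr)
    also have "\<dots> \<le> ennreal (K powr p)"
      using K p by (intro ennreal_leI powr_mono2) auto
    finally show "(\<integral>\<^sup>+x. ennreal (norm (h k x) powr p) \<partial>lebesgue) \<le> ennreal (K powr p)" .
  qed
  finally have *: "(\<integral>\<^sup>+x. ennreal (norm (g x) powr p) \<partial>lebesgue) \<le> ennreal (K powr p)"
    by (simp add: Liminf_const)
  then have i: "integrable lebesgue (\<lambda>x. norm (g x) powr p)"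
    by (intro integrableI_bounded) (auto simp: order_le_less_trans)
  then show "g \<in> Lp_space p" by (simp add: Lp_space_def g)
  have "(LINT x|lebesgue. norm (g x) powr p) \<le> K powr p"
    using * i by (subst (asm) nn_integral_eq_integral) auto
  then show "Lp_norm p g \<le> K"
    by (intro Lp_norm_leI p K)
qed

text \<open>The Riesz--Fischer theorem. Along a subsequence whose increments have norm at most \<open>(1/4)^k\<close>, the
  functions \<open>(2^k * \<bar>increment\<bar>) powr p\<close> have a finite sum of integrals. Almost everywhere the
  increments are therefore dominated by a geometric series, and Fatou's lemma turns pointwise
  convergence of the subsequence into norm convergence of the sequence.\<close>

lemma Lp_complete:
  fixes f :: "nat \<Rightarrow> 'a::euclidean_space \<Rightarrow> 'b::euclidean_space"
  assumes p: "1 \<le> p" and f: "\<And>k. f k \<in> Lp_space p"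
    and cauchy: "\<And>e. e > 0 \<Longrightarrow> \<exists>M. \<forall>m\<ge>M. \<forall>n\<ge>M. Lp_norm p (\<lambda>x. f m x - f n x) < e"
  shows "\<exists>g\<in>Lp_space p. (\<lambda>k. Lp_norm p (\<lambda>x. f k x - g x)) \<longlonglongrightarrow> 0"
proof -
  note [measurable] = Lp_space_measurable[OF f]
  have "\<forall>k::nat. \<exists>M. \<forall>m\<ge>M. \<forall>n\<ge>M. Lp_norm p (\<lambda>x. f m x - f n x) < (1/4)^k"
    using cauchy by simp
  then obtain r where r: "\<And>k m n. m \<ge> r k \<Longrightarrow> n \<ge> r k \<Longrightarrow> Lp_norm p (\<lambda>x. f m x - f n x) < (1/4)^k"
    by metis
  define R where "R k = Max (r ` {..k})" for k
  have R: "r k \<le> R j" if "k \<le> j" for k j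
    unfolding R_def using that by (intro Max_ge) auto
  define d where "d k x = norm (f (R (Suc k)) x - f (R k) x)" for k x
  have [measurable]: "d k \<in> borel_measurable lebesgue" for k unfolding d_def by measurable
  define h where "h k x = (2^k * d k x) powr p" for k x
  have hint: "(\<integral>\<^sup>+x. ennreal (h k x) \<partial>lebesgue) \<le> ennreal ((1/2)^k)" for k
  proof -
    let ?f = "\<lambda>x. f (R (Suc k)) x - f (R k) x"
    have D: "?f \<in> Lp_space p" by (intro Lp_diff p f)
    have i: "integrable lebesgue (\<lambda>x. norm (?f x) powr p)"
      using Lp_space_integrable[OF D] .
    have "(\<integral>\<^sup>+x. ennreal (h k x) \<partial>lebesgue)
        = (\<integral>\<^sup>+x. ennreal ((2^k) powr p * norm (?f x) powr p) \<partial>lebesgue)"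
      by (simp add: h_def d_def powr_mult)
    also have "\<dots> = ennreal ((2^k) powr p * Lp_norm p ?f powr p)"
      using i p by (subst nn_integral_eq_integral) (auto simp: Lp_norm_powr)
    also have "\<dots> \<le> ennreal ((2^k) powr p * ((1/4)^k) powr p)"
      using r[of k "R (Suc k)" "R k"] R[of k] p
      by (intro ennreal_leI mult_left_mono powr_mono2) (auto simp: less_imp_le)
    also have "(2^k) powr p * ((1/4)^k) powr p = ((1/2::real)^k) powr p"
      by (simp add: powr_mult[symmetric] power_mult_distrib[symmetric])
    also have "\<dots> \<le> ((1/2)^k) powr 1"
      using p by (intro powr_mono') (auto simp: power_le_one)
    finally show ?thesis by (simp add: ennreal_leI)
  qed
  have "(\<integral>\<^sup>+x. (\<Sum>k. ennreal (h k x)) \<partial>lebesgue) = (\<Sum>k. \<integral>\<^sup>+x. ennreal (h k x) \<partial>lebesgue)"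
    unfolding h_def by (intro nn_integral_suminf) measurable
  also have "\<dots> \<le> (\<Sum>k. ennreal ((1/2)^k))"
    by (intro suminf_le hint summableI)
  also have "\<dots> = ennreal (\<Sum>k. (1/2)^k)"
    by (rule suminf_ennreal2) auto
  also have "\<dots> < \<infinity>" by simp
  finally have "(\<integral>\<^sup>+x. (\<Sum>k. ennreal (h k x)) \<partial>lebesgue) \<noteq> \<infinity>" by simp
  then have ae: "AE x in lebesgue. (\<Sum>k. ennreal (h k x)) \<noteq> \<infinity>"
    unfolding h_def by (intro nn_integral_PInf_AE) measurable
  have conv: "AE x in lebesgue. convergent (\<lambda>k. f (R k) x)"
    using ae
  proof eventually_elim
    case (elim x)
    then obtain C where C: "(\<Sum>k. ennreal (h k x)) = ennreal C" "C \<ge> 0"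
      by (metis ennreal_cases infinity_ennreal_def)
    have "h k x \<le> C" for k
    proof -
      have "ennreal (h k x) \<le> (\<Sum>k. ennreal (h k x))"
        using sum_le_suminf[of "\<lambda>k. ennreal (h k x)" "{k}"] by simp
      then show ?thesis using C by simp
    qed
    then have "(h k x) powr (1/p) \<le> C powr (1/p)" for k
      using p by (intro powr_mono2) (auto simp: h_def)
    then have "2^k * d k x \<le> C powr (1/p)" for k
      using p by (simp add: h_def d_def powr_powr)
    then have dk: "d k x \<le> C powr (1/p) * (1/2)^k" for k
      by (simp add: field_simps power_one_over)
    have "summable (\<lambda>k. f (R (Suc k)) x - f (R k) x)"
    proof (rule summable_comparison_test)
      show "\<exists>N. \<forall>n\<ge>N. norm (f (R (Suc n)) x - f (R n) x) \<le> C powr (1/p) * (1/2)^n"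
        using dk by (auto simp: d_def)
      show "summable (\<lambda>n. C powr (1/p) * (1/2)^n)" by (intro summable_mult) simp
    qed
    then have "convergent (\<lambda>n. \<Sum>k<n. f (R (Suc k)) x - f (R k) x)"
      by (simp add: summable_iff_convergent)
    then have "convergent (\<lambda>n. f (R n) x - f (R 0) x)"
      by (simp add: sum_lessThan_telescope[of "\<lambda>k. f (R k) x"])
    then show ?case
      by (simp add: convergent_diff_const_right_iff)
  qed
  define g where "g x = lim (\<lambda>k. f (R k) x)" for x
  have g[measurable]: "g \<in> borel_measurable lebesgue"
    unfolding g_def by (intro borel_measurable_lim_metric) auto
  have lim: "AE x in lebesgue. (\<lambda>k. f (R k) x) \<longlonglongrightarrow> g x"
    using conv by eventually_elim (simp add: g_def convergent_LIMSEQ_iff)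
  have close: "(\<lambda>x. f m x - g x) \<in> Lp_space p \<and> Lp_norm p (\<lambda>x. f m x - g x) \<le> (1/4)^j"
    if m: "m \<ge> r j" for m j
  proof -
    have "AE x in lebesgue. (\<lambda>k. f m x - f (R (k + j)) x) \<longlonglongrightarrow> f m x - g x"
      using lim by eventually_elim (intro tendsto_intros LIMSEQ_ignore_initial_segment)
    moreover have "Lp_norm p (\<lambda>x. f m x - f (R (k + j)) x) \<le> (1/4)^j" for k
      using r[OF m R[of j "k + j"]] by simp
    ultimately show ?thesis
      using Lp_fatou[of p "\<lambda>k x. f m x - f (R (k + j)) x" "(1/4)^j" "\<lambda>x. f m x - g x"] p
        Lp_diff(1)[OF p f f] by auto
  qed
  have "(\<lambda>x. f (r 0) x - (f (r 0) x - g x)) \<in> Lp_space p"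
    by (rule Lp_diff(1)[OF p f conjunct1[OF close[OF order_refl]]])
  moreover have "(\<lambda>x. f (r 0) x - (f (r 0) x - g x)) = g" by (simp add: fun_eq_iff)
  ultimately have "g \<in> Lp_space p" by (simp only:)
  moreover have "(\<lambda>k. Lp_norm p (\<lambda>x. f k x - g x)) \<longlonglongrightarrow> 0"
  proof (rule LIMSEQ_I)
    fix e :: real assume "e > 0"
    then obtain j where j: "(1/4)^j < e"
      using real_arch_pow_inv[of e "1/4"] by auto
    have "norm (Lp_norm p (\<lambda>x. f m x - g x) - 0) < e" if "m \<ge> r j" for m
      using close[OF that] j by simp
    then show "\<exists>no. \<forall>n\<ge>no. norm (Lp_norm p (\<lambda>x. f n x - g x) - 0) < e" by blast
  qed
  ultimately show ?thesis by blast
qed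

text \<open>A substitute for Hoelder's inequality where only smallness matters: either \<open>a\<close> is at most \<open>d\<close>, or
  \<open>a = a powr (1 - p) * a powr p\<close>, where the first factor has a nonpositive exponent and is at most
  \<open>d powr (1 - p)\<close>.\<close>

lemma le_add_powr:
  fixes a d p :: real
  assumes "1 \<le> p" "0 \<le> a" "0 < d"
  shows "a \<le> d + d powr (1 - p) * a powr p"
proof (cases "a \<le> d")
  case True
  then show ?thesis using assms by (simp add: add_increasing2)
next
  case False
  then have "a = a powr (1 - p) * a powr p"
    using assms by (simp add: powr_add[symmetric])
  also have "\<dots> \<le> d powr (1 - p) * a powr p"
    using assms False by (intro mult_right_mono powr_mono2') auto
  finally show ?thesis using assms by simp
qed

lemma Lp_integrable_on_bounded:
  fixes f :: "'a::euclidean_space \<Rightarrow> 'b::euclidean_space"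
  assumes p: "1 \<le> p" and f: "f \<in> Lp_space p" and d: "0 < d"
    and K: "K \<in> sets lebesgue" "bounded K"
  shows "integrable lebesgue (\<lambda>x. indicator K x *\<^sub>R f x)"
    and "(LINT x|lebesgue. norm (indicator K x *\<^sub>R f x))
      \<le> d * measure lebesgue K + d powr (1 - p) * Lp_norm p f powr p"
proof -
  note [measurable] = Lp_space_measurable[OF f] K(1)
  have KL: "K \<in> lmeasurable"
    using K by (simp add: bounded_set_imp_lmeasurable)
  have ib: "integrable lebesgue (\<lambda>x. d * indicator K x + d powr (1 - p) * norm (f x) powr p)"
    using Lp_space_integrable[OF f] KL by (auto simp: fmeasurable_def)
  have le: "norm (indicator K x *\<^sub>R f x) \<le> d * indicator K x + d powr (1 - p) * norm (f x) powr p" for x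
    using le_add_powr[of p "norm (f x)" d] p d by (auto simp: indicator_def)
  show i: "integrable lebesgue (\<lambda>x. indicator K x *\<^sub>R f x)"
    by (rule Bochner_Integration.integrable_bound[OF ib])
       (auto intro!: AE_I2 order_trans[OF le] simp del: norm_scaleR)
  have "(LINT x|lebesgue. norm (indicator K x *\<^sub>R f x)) \<le>
      (LINT x|lebesgue. d * indicator K x + d powr (1 - p) * norm (f x) powr p)"
    by (intro integral_mono integrable_norm i ib le)
  also have "\<dots> = d * measure lebesgue K + d powr (1 - p) * Lp_norm p f powr p"
    using Lp_space_integrable[OF f] KL p
    by (subst Bochner_Integration.integral_add) (auto simp: fmeasurable_def Lp_norm_powr)
  finally show "(LINT x|lebesgue. norm (indicator K x *\<^sub>R f x))
      \<le> d * measure lebesgue K + d powr (1 - p) * Lp_norm p f powr p" .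
qed

lemma Lp_locally_integrable:
  assumes "1 \<le> p" "f \<in> Lp_space p"
  shows "locally_integrable f"
  unfolding locally_integrable_def set_integrable_def
  using Lp_integrable_on_bounded(1)[OF assms zero_less_one]
  by (auto simp: compact_imp_bounded lmeasurable_compact fmeasurableD)

text \<open>Convergence in \<open>L\<^sup>p\<close> implies convergence of the integrals against bounded functions with
  bounded support, for every \<open>p \<ge> 1\<close>; this makes weak gradients stable under limits.\<close>

lemma Lp_pairing_tendsto:
  fixes f :: "nat \<Rightarrow> 'a::euclidean_space \<Rightarrow> real"
  assumes p: "1 \<le> p" and f: "\<And>k. f k \<in> Lp_space p" and g: "g \<in> Lp_space p"
    and lim: "(\<lambda>k. Lp_norm p (\<lambda>x. f k x - g x)) \<longlonglongrightarrow> 0"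
    and w: "w \<in> borel_measurable borel" "\<And>x. \<bar>w x\<bar> \<le> B" "\<And>x. R \<le> norm x \<Longrightarrow> w x = 0"
  shows "(\<lambda>k. LINT x|lebesgue. f k x * w x) \<longlonglongrightarrow> (LINT x|lebesgue. g x * w x)"
proof -
  have [measurable]: "w \<in> borel_measurable lebesgue"
    using w(1) by (simp add: measurable_completion)
  note [measurable] = Lp_space_measurable[OF f] Lp_space_measurable[OF g]
  let ?K = "cball 0 R :: 'a set"
  have B: "B \<ge> 0" using w(2)[of 0] by simp
  have K: "?K \<in> sets lebesgue" "bounded ?K" by auto
  have bd: "norm (h x * w x) \<le> B * norm (indicator ?K x *\<^sub>R h x)" for h :: "'a \<Rightarrow> real" and x
    using w(2)[of x] w(3)[of x] B
    by (cases "norm x \<le> R") (auto simp: abs_mult mult.commute[of B] intro!: mult_left_mono)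
  have int: "integrable lebesgue (\<lambda>x. h x * w x)"
    "\<bar>LINT x|lebesgue. h x * w x\<bar> \<le> B * (LINT x|lebesgue. norm (indicator ?K x *\<^sub>R h x))"
    if h: "h \<in> Lp_space p" for h :: "'a \<Rightarrow> real"
  proof -
    note [measurable] = Lp_space_measurable[OF h]
    have i: "integrable lebesgue (\<lambda>x. B * norm (indicator ?K x *\<^sub>R h x))"
      using Lp_integrable_on_bounded(1)[OF p h zero_less_one K] by (intro integrable_mult_right integrable_norm)
    show j: "integrable lebesgue (\<lambda>x. h x * w x)"
    proof (rule Bochner_Integration.integrable_bound[OF i])
      show "AE x in lebesgue. norm (h x * w x) \<le> norm (B * norm (indicator ?K x *\<^sub>R h x))"
        using order_trans[OF bd abs_ge_self] by (simp only: real_norm_def) simp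
    qed simp
    have "\<bar>LINT x|lebesgue. h x * w x\<bar> \<le> (LINT x|lebesgue. norm (h x * w x))"
      using integral_norm_bound[of lebesgue "\<lambda>x. h x * w x"] by simp
    also have "\<dots> \<le> (LINT x|lebesgue. B * norm (indicator ?K x *\<^sub>R h x))"
      by (intro integral_mono integrable_norm i j bd)
    finally show "\<bar>LINT x|lebesgue. h x * w x\<bar> \<le> B * (LINT x|lebesgue. norm (indicator ?K x *\<^sub>R h x))"
      by simp
  qed
  have D: "(\<lambda>x. f k x - g x) \<in> Lp_space p" for k by (intro Lp_diff p f g)
  have est: "\<bar>(LINT x|lebesgue. f k x * w x) - (LINT x|lebesgue. g x * w x)\<bar>
      \<le> B * (d * measure lebesgue ?K + d powr (1 - p) * Lp_norm p (\<lambda>x. f k x - g x) powr p)"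
    if "d > 0" for d k
  proof -
    have "(LINT x|lebesgue. f k x * w x) - (LINT x|lebesgue. g x * w x)
        = (LINT x|lebesgue. (f k x - g x) * w x)"
      unfolding left_diff_distrib
      by (rule Bochner_Integration.integral_diff[OF int(1)[OF f] int(1)[OF g], symmetric])
    then have "\<bar>(LINT x|lebesgue. f k x * w x) - (LINT x|lebesgue. g x * w x)\<bar>
        \<le> B * (LINT x|lebesgue. norm (indicator ?K x *\<^sub>R (f k x - g x)))"
      using int(2)[OF D] by simp
    also have "\<dots> \<le> B * (d * measure lebesgue ?K + d powr (1 - p) * Lp_norm p (\<lambda>x. f k x - g x) powr p)"
      using B by (intro mult_left_mono Lp_integrable_on_bounded(2)[OF p D that K])
    finally show ?thesis .
  qed
  show ?thesis
  proof (rule LIMSEQ_I)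
    fix e :: real assume e: "e > 0"
    define d where "d = (e / 2) / (B * measure lebesgue ?K + 1)"
    have BK: "B * measure lebesgue ?K + 1 > 0" using B by (simp add: add_nonneg_pos)
    have d: "d > 0" using e BK by (simp add: d_def)
    have dB: "B * (d * measure lebesgue ?K) \<le> e / 2"
    proof -
      have "B * (d * measure lebesgue ?K) = d * (B * measure lebesgue ?K)" by simp
      also have "\<dots> \<le> d * (B * measure lebesgue ?K + 1)" using d by (intro mult_left_mono) auto
      also have "\<dots> = e / 2"
        using BK d_def nonzero_eq_divide_eq[of "B * measure lebesgue ?K + 1" d "e / 2"] by simp
      finally show ?thesis .
    qed
    have "(\<lambda>k. B * (d * measure lebesgue ?K + d powr (1 - p) * Lp_norm p (\<lambda>x. f k x - g x) powr p))
      \<longlonglongrightarrow> B * (d * measure lebesgue ?K + d powr (1 - p) * 0 powr p)"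
      using p by (intro tendsto_intros tendsto_powr' lim) auto
    then have "\<forall>\<^sub>F k in sequentially. B * (d * measure lebesgue ?K
        + d powr (1 - p) * Lp_norm p (\<lambda>x. f k x - g x) powr p) < e"
      by (rule order_tendstoD(2)) (use dB e p in simp)
    then show "\<exists>no. \<forall>n\<ge>no. norm ((LINT x|lebesgue. f n x * w x) - (LINT x|lebesgue. g x * w x)) < e"
      using est[OF d] unfolding eventually_sequentially real_norm_def by (meson order_le_less_trans)
  qed
qed

subsection \<open>The inner product of two square integrable functions\<close>

lemma L2_integrable_norm_sq: "f \<in> Lp_space 2 \<Longrightarrow> integrable lebesgue (\<lambda>x. (norm (f x))\<^sup>2)"
  using Lp_space_integrable[of f 2] by (simp add: powr_numeral)

lemma L2_norm_sq: "(Lp_norm 2 f)\<^sup>2 = (LINT x|lebesgue. (norm (f x))\<^sup>2)"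
  using Lp_norm_powr[of 2 f] by (simp add: powr_numeral)

lemma L2_integrable_inner:
  fixes f g :: "'a::euclidean_space \<Rightarrow> 'b::euclidean_space"
  assumes f: "f \<in> Lp_space 2" and g: "g \<in> Lp_space 2"
  shows "integrable lebesgue (\<lambda>x. f x \<bullet> g x)"
proof -
  note [measurable] = Lp_space_measurable[OF f] Lp_space_measurable[OF g]
  have i: "integrable lebesgue (\<lambda>x. (norm (f x))\<^sup>2 + (norm (g x))\<^sup>2)"
    by (intro Bochner_Integration.integrable_add L2_integrable_norm_sq f g)
  have "\<bar>f x \<bullet> g x\<bar> \<le> (norm (f x))\<^sup>2 + (norm (g x))\<^sup>2" for x
  proof -
    have "\<bar>f x \<bullet> g x\<bar> \<le> norm (f x) * norm (g x)" by (rule Cauchy_Schwarz_ineq2)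
    also have "\<dots> \<le> 2 * norm (f x) * norm (g x)" by simp
    also have "\<dots> \<le> (norm (f x))\<^sup>2 + (norm (g x))\<^sup>2" by (rule sum_squares_bound)
    finally show ?thesis .
  qed
  then show ?thesis
    by (intro Bochner_Integration.integrable_bound[OF i]) auto
qed

lemma L2_norm_add_sq:
  fixes f g :: "'a::euclidean_space \<Rightarrow> 'b::euclidean_space"
  assumes f: "f \<in> Lp_space 2" and g: "g \<in> Lp_space 2"
  shows "(Lp_norm 2 (\<lambda>x. f x + t *\<^sub>R g x))\<^sup>2
    = (Lp_norm 2 f)\<^sup>2 + 2 * t * (LINT x|lebesgue. f x \<bullet> g x) + t\<^sup>2 * (Lp_norm 2 g)\<^sup>2"
proof -
  have "(norm (f x + t *\<^sub>R g x))\<^sup>2 = (norm (f x))\<^sup>2 + 2 * t * (f x \<bullet> g x) + t\<^sup>2 * (norm (g x))\<^sup>2" for x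
    unfolding power2_norm_eq_inner
    by (simp add: inner_add_left inner_add_right inner_commute[of "g x" "f x"] power2_eq_square algebra_simps)
  then show ?thesis
    using L2_integrable_norm_sq[OF f] L2_integrable_norm_sq[OF g] L2_integrable_inner[OF f g]
    by (simp add: L2_norm_sq)
qed

lemma L2_cauchy_schwarz:
  fixes f g :: "'a::euclidean_space \<Rightarrow> 'b::euclidean_space"
  assumes f: "f \<in> Lp_space 2" and g: "g \<in> Lp_space 2"
  shows "\<bar>LINT x|lebesgue. f x \<bullet> g x\<bar> \<le> Lp_norm 2 f * Lp_norm 2 g"
proof -
  let ?a = "Lp_norm 2 f" and ?b = "Lp_norm 2 g" and ?c = "LINT x|lebesgue. f x \<bullet> g x"
  have "?c\<^sup>2 \<le> (?a * ?b)\<^sup>2"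
  proof (cases "?b = 0")
    case True
    then have "AE x in lebesgue. g x = 0" using Lp_norm_eq_0D[of 2 g] g by simp
    then have "AE x in lebesgue. f x \<bullet> g x = 0" by eventually_elim simp
    then have "?c = 0" by (rule integral_eq_zero_AE)
    then show ?thesis by simp
  next
    case False
    have "0 \<le> ?a\<^sup>2 + 2 * (- ?c / ?b\<^sup>2) * ?c + (- ?c / ?b\<^sup>2)\<^sup>2 * ?b\<^sup>2"
      unfolding L2_norm_add_sq[OF f g, symmetric] by simp
    also have "\<dots> = ?a\<^sup>2 - ?c\<^sup>2 / ?b\<^sup>2"
      using False by (simp add: field_simps power2_eq_square)
    finally show ?thesis
      using False by (simp add: field_simps power_mult_distrib)
  qed
  then have "\<bar>?c\<bar>\<^sup>2 \<le> (?a * ?b)\<^sup>2" by (simp only: power2_abs)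
  then show ?thesis by (rule power2_le_imp_le) simp
qed

section \<open>Continuously differentiable functions and integration by parts\<close>

text \<open>The gradient is an argument rather than a derived notion, so that it can be written down explicitly
  for products, convolutions and cutoffs.\<close>

definition C1 :: "('a::euclidean_space \<Rightarrow> real) \<Rightarrow> ('a \<Rightarrow> 'a) \<Rightarrow> bool" where
  "C1 \<phi> D\<phi> \<longleftrightarrow> (\<forall>x. (\<phi> has_derivative (\<lambda>h. D\<phi> x \<bullet> h)) (at x)) \<and> continuous_on UNIV D\<phi>"

text \<open>Vector fields are differentiated component by component; the calculus is done for real-valued
  functions only.\<close>

definition C1c :: "(real^'n::finite \<Rightarrow> real^'m::finite) \<Rightarrow> (real^'n \<Rightarrow> real^'n^'m) \<Rightarrow> bool" where
  "C1c v Dv \<longleftrightarrow> (\<forall>\<alpha>. C1 (\<lambda>x. v x $ \<alpha>) (\<lambda>x. Dv x $ \<alpha>)) \<and> (\<exists>R. \<forall>x. R \<le> norm x \<longrightarrow> v x = 0)"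

lemma C1_D:
  assumes "C1 \<phi> D\<phi>"
  shows "(\<phi> has_derivative (\<lambda>h. D\<phi> x \<bullet> h)) (at x)" "continuous_on UNIV D\<phi>" "continuous_on UNIV \<phi>"
proof -
  show d: "(\<phi> has_derivative (\<lambda>h. D\<phi> x \<bullet> h)) (at x)" for x
    using assms by (simp add: C1_def)
  show "continuous_on UNIV D\<phi>" using assms by (simp add: C1_def)
  show "continuous_on UNIV \<phi>"
    by (rule has_derivative_continuous_on[where f' = "\<lambda>x h. D\<phi> x \<bullet> h"]) (simp add: d)
qed

lemma C1_measurable:
  assumes "C1 \<phi> D\<phi>"
  shows "\<phi> \<in> borel_measurable borel" "D\<phi> \<in> borel_measurable borel"
  using C1_D(2,3)[OF assms] by (auto intro: borel_measurable_continuous_onI)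

lemma C1_gradient_zero:
  assumes "C1 \<phi> D\<phi>" "\<And>y. R \<le> norm y \<Longrightarrow> \<phi> y = 0" "R < norm x"
  shows "D\<phi> x = 0"
proof -
  have "open {y::'a. R < norm y}" by (intro open_Collect_less continuous_intros)
  then have "(\<phi> has_derivative (\<lambda>h. 0)) (at x)"
    by (rule has_derivative_transform_within_open[where f = "\<lambda>_. 0", rotated])
       (use assms(2,3) in auto)
  then have "(\<lambda>h. D\<phi> x \<bullet> h) = (\<lambda>h. 0)"
    using C1_D(1)[OF assms(1)] has_derivative_unique by blast
  then show ?thesis by (metis inner_eq_zero_iff)
qed

lemma continuous_compact_support:
  fixes g :: "'a::euclidean_space \<Rightarrow> 'b::euclidean_space"
  assumes g: "continuous_on UNIV g" and R: "\<And>x. R \<le> norm x \<Longrightarrow> g x = 0"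
  shows "integrable lborel g" "\<exists>B>0. \<forall>x. norm (g x) \<le> B"
proof -
  have c: "continuous_on (cball 0 R) g" using g continuous_on_subset by blast
  have "integrable lborel (\<lambda>x. indicator (cball 0 R) x *\<^sub>R g x)"
    by (intro borel_integrable_compact compact_cball c)
  also have "(\<lambda>x. indicator (cball 0 R) x *\<^sub>R g x) = g"
    using R by (fastforce simp: indicator_def)
  finally show "integrable lborel g" .
  obtain B where B: "\<And>x. x \<in> cball 0 R \<Longrightarrow> norm (g x) \<le> B"
    using compact_imp_bounded[OF compact_continuous_image[OF c compact_cball]]
    unfolding bounded_iff by blast
  have "norm (g x) \<le> max B 1" for x
    using B[of x] R[of x] by (cases "norm x \<le> R") auto
  then show "\<exists>B>0. \<forall>x. norm (g x) \<le> B"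
    by (intro exI[of _ "max B 1"]) auto
qed

lemma continuous_compact_support_Lp:
  fixes g :: "'a::euclidean_space \<Rightarrow> 'b::euclidean_space"
  assumes g: "continuous_on UNIV g" and R: "\<And>x. R \<le> norm x \<Longrightarrow> g x = 0" and p: "0 < p"
  shows "g \<in> Lp_space p"
proof -
  have m: "g \<in> borel_measurable borel" using g by (rule borel_measurable_continuous_onI)
  have "continuous_on UNIV (\<lambda>x. norm (g x) powr p)"
    using p by (intro continuous_on_powr' continuous_intros g) auto
  then have "integrable lborel (\<lambda>x. norm (g x) powr p)"
    by (rule continuous_compact_support(1)[where R = R]) (use R in auto)
  then show ?thesis
    using m by (simp add: Lp_space_def integrable_completion measurable_completion)
qed

lemma integral_translate:
  fixes g :: "'a::euclidean_space \<Rightarrow> 'b::euclidean_space"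
  assumes "g \<in> borel_measurable borel"
  shows "(LINT x|lborel. g (c + x)) = (LINT x|lborel. g x)"
proof -
  have "(LINT x|lborel. g x) = (LINT x|distr lborel borel ((+) c). g x)"
    by (simp add: lborel_distr_plus)
  also have "\<dots> = (LINT x|lborel. g (c + x))"
    using assms by (subst integral_distr) auto
  finally show ?thesis by simp
qed

lemma C1_lipschitz:
  assumes \<phi>: "C1 \<phi> D\<phi>" and B: "\<And>x. norm (D\<phi> x) \<le> B"
  shows "\<bar>\<phi> y - \<phi> x\<bar> \<le> B * norm (y - x)"
proof -
  have "norm (\<phi> y - \<phi> x) \<le> B * norm (y - x)"
  proof (rule differentiable_bound[OF convex_UNIV])
    fix z
    show "(\<phi> has_derivative (\<lambda>h. D\<phi> z \<bullet> h)) (at z within UNIV)"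
      using C1_D(1)[OF \<phi>] by simp
    have "norm (D\<phi> z \<bullet> h) \<le> norm (D\<phi> z) * norm h" for h
      using Cauchy_Schwarz_ineq2[of "D\<phi> z" h] by simp
    then show "onorm ((\<bullet>) (D\<phi> z)) \<le> B"
      using B[of z] by (intro order_trans[OF onorm_le]) auto
  qed auto
  then show ?thesis by simp
qed

lemma C1_difference_quotient_tendsto:
  assumes \<phi>: "C1 \<phi> D\<phi>"
  shows "(\<lambda>k. real (Suc k) * (\<phi> (x + (1 / real (Suc k)) *\<^sub>R e) - \<phi> x)) \<longlonglongrightarrow> D\<phi> x \<bullet> e"
proof -
  have d: "((\<lambda>t. \<phi> (x + t *\<^sub>R e)) has_derivative (\<lambda>t. D\<phi> x \<bullet> (t *\<^sub>R e))) (at 0)"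
  proof (rule has_derivative_compose[of "\<lambda>t. x + t *\<^sub>R e" "\<lambda>t. t *\<^sub>R e" 0 UNIV \<phi> "\<lambda>h. D\<phi> x \<bullet> h"])
    show "((\<lambda>t. x + t *\<^sub>R e) has_derivative (\<lambda>t. t *\<^sub>R e)) (at 0)"
      by (auto intro!: derivative_eq_intros)
  qed (use C1_D(1)[OF \<phi>] in simp)
  then have "((\<lambda>t. \<phi> (x + t *\<^sub>R e)) has_real_derivative (D\<phi> x \<bullet> e)) (at 0)"
    unfolding has_field_derivative_def
    by (rule has_derivative_eq_rhs) (simp add: fun_eq_iff)
  then have "((\<lambda>h. (\<phi> (x + h *\<^sub>R e) - \<phi> x) / h) \<longlongrightarrow> D\<phi> x \<bullet> e) (at 0)"
    by (simp add: DERIV_def)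
  moreover have "filterlim (\<lambda>k. 1 / real (Suc k)) (at 0) sequentially"
    unfolding filterlim_at using LIMSEQ_inverse_real_of_nat
    by (auto simp: divide_inverse intro!: always_eventually)
  ultimately have "(\<lambda>k. (\<phi> (x + (1 / real (Suc k)) *\<^sub>R e) - \<phi> x) / (1 / real (Suc k)))
      \<longlonglongrightarrow> D\<phi> x \<bullet> e"
    by (rule filterlim_compose)
  then show ?thesis by (simp add: mult.commute)
qed

text \<open>The derivative of a compactly supported function has integral zero: the integral of
  \<open>\<phi> (x + t *\<^sub>R e)\<close> over \<open>x\<close> does not depend on \<open>t\<close>, and its derivative at \<open>t = 0\<close> may be taken
  under the integral sign.\<close>

lemma C1_integral_derivative_eq_0:
  assumes \<phi>: "C1 \<phi> D\<phi>" and R: "\<And>x. R \<le> norm x \<Longrightarrow> \<phi> x = 0"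
  shows "(LINT x|lborel. D\<phi> x \<bullet> e) = 0"
proof -
  note [measurable] = C1_measurable[OF \<phi>]
  have R': "D\<phi> x = 0" if "R + 1 \<le> norm x" for x
    by (rule C1_gradient_zero[OF \<phi> R]) (use that in auto)
  obtain B where B: "B > 0" "\<And>x. norm (D\<phi> x) \<le> B"
    using continuous_compact_support(2)[OF C1_D(2)[OF \<phi>] R'] by blast
  let ?q = "\<lambda>k x. real (Suc k) * (\<phi> ((1 / real (Suc k)) *\<^sub>R e + x) - \<phi> x)"
  let ?S = "cball 0 (\<bar>R\<bar> + norm e) :: 'a set"
  have int\<phi>: "integrable lborel \<phi>"
    using continuous_compact_support(1)[OF C1_D(3)[OF \<phi>] R] .
  have "(\<lambda>k. LINT x|lborel. ?q k x) \<longlonglongrightarrow> (LINT x|lborel. D\<phi> x \<bullet> e)"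
  proof (rule integral_dominated_convergence[where w = "\<lambda>x. B * norm e * indicator ?S x"])
    show "integrable lborel (\<lambda>x. B * norm e * indicator ?S x)"
      by (intro integrable_mult_right integrable_real_indicator)
         (use emeasure_bounded_finite[OF bounded_cball, of 0 "\<bar>R\<bar> + norm e"] in auto)
    show "AE x in lborel. (\<lambda>k. ?q k x) \<longlonglongrightarrow> D\<phi> x \<bullet> e"
      using C1_difference_quotient_tendsto[OF \<phi>] by (simp add: add.commute)
    fix k
    have t: "norm ((1 / real (Suc k)) *\<^sub>R e) \<le> norm e"
      using mult_right_mono[of "1 / real (Suc k)" 1 "norm e"] by simp
    have "norm (?q k x) \<le> B * norm e * indicator ?S x" for x
    proof (cases "x \<in> ?S")
      case True
      have "norm (?q k x) \<le> real (Suc k) * (B * norm ((1 / real (Suc k)) *\<^sub>R e + x - x))"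
        unfolding norm_mult real_norm_def abs_of_nat abs_mult
        by (intro mult_left_mono C1_lipschitz[OF \<phi> B(2)]) auto
      then show ?thesis using True by simp
    next
      case False
      then have "R \<le> norm x" by (simp, smt (verit) norm_ge_zero)
      moreover have "norm x \<le> norm ((1 / real (Suc k)) *\<^sub>R e + x) + norm ((1 / real (Suc k)) *\<^sub>R e)"
        using norm_triangle_ineq4[of "(1 / real (Suc k)) *\<^sub>R e + x" "(1 / real (Suc k)) *\<^sub>R e"] by simp
      then have "R \<le> norm ((1 / real (Suc k)) *\<^sub>R e + x)"
        using False t by simp
      ultimately show ?thesis using R False by simp
    qed
    then show "AE x in lborel. norm (?q k x) \<le> B * norm e * indicator ?S x" by simp
  qed measurable
  moreover have "(LINT x|lborel. ?q k x) = 0" for k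
  proof -
    let ?c = "(1 / real (Suc k)) *\<^sub>R e"
    have "integrable lborel (\<lambda>x. \<phi> (?c + x))"
    proof (rule continuous_compact_support(1))
      show "continuous_on UNIV (\<lambda>x. \<phi> (?c + x))"
        by (intro continuous_on_compose2[OF C1_D(3)[OF \<phi>]] continuous_intros) auto
      show "\<phi> (?c + x) = 0" if "\<bar>R\<bar> + norm ?c \<le> norm x" for x
        using norm_triangle_ineq4[of "?c + x" "?c"] that by (intro R) auto
    qed
    then show ?thesis
      using int\<phi> integral_translate[OF C1_measurable(1)[OF \<phi>], of ?c]
      by (simp add: algebra_simps)
  qed
  ultimately show ?thesis
    by (simp add: LIMSEQ_const_iff)
qed

lemma C1_mult:
  assumes \<phi>: "C1 \<phi> D\<phi>" and \<psi>: "C1 \<psi> D\<psi>"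
  shows "C1 (\<lambda>x. \<phi> x * \<psi> x) (\<lambda>x. \<phi> x *\<^sub>R D\<psi> x + \<psi> x *\<^sub>R D\<phi> x)"
  unfolding C1_def
proof (intro conjI allI)
  fix x
  show "((\<lambda>x. \<phi> x * \<psi> x) has_derivative (\<lambda>h. (\<phi> x *\<^sub>R D\<psi> x + \<psi> x *\<^sub>R D\<phi> x) \<bullet> h)) (at x)"
    by (rule has_derivative_eq_rhs[OF has_derivative_mult[OF C1_D(1)[OF \<phi>] C1_D(1)[OF \<psi>]]])
       (simp add: inner_add_left fun_eq_iff)
qed (intro continuous_intros C1_D[OF \<phi>] C1_D[OF \<psi>])

lemma C1_add:
  assumes \<phi>: "C1 \<phi> D\<phi>" and \<psi>: "C1 \<psi> D\<psi>"
  shows "C1 (\<lambda>x. \<phi> x + \<psi> x) (\<lambda>x. D\<phi> x + D\<psi> x)"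
  unfolding C1_def
  using C1_D[OF \<phi>] C1_D[OF \<psi>] by (auto intro!: derivative_eq_intros continuous_intros simp: inner_add_left)

lemma C1_cmult:
  assumes \<phi>: "C1 \<phi> D\<phi>"
  shows "C1 (\<lambda>x. c * \<phi> x) (\<lambda>x. c *\<^sub>R D\<phi> x)"
  unfolding C1_def
  using C1_D[OF \<phi>] by (auto intro!: derivative_eq_intros continuous_intros)

lemma C1_integration_by_parts:
  assumes \<phi>: "C1 \<phi> D\<phi>" and R: "\<And>x. R \<le> norm x \<Longrightarrow> \<phi> x = 0" and \<psi>: "C1 \<psi> D\<psi>"
  shows "(LINT x|lborel. \<psi> x * (D\<phi> x \<bullet> e)) = - (LINT x|lborel. \<phi> x * (D\<psi> x \<bullet> e))"
proof -
  have R': "D\<phi> x = 0" if "R + 1 \<le> norm x" for x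
    by (rule C1_gradient_zero[OF \<phi> R]) (use that in auto)
  have "integrable lborel (\<lambda>x. \<psi> x * (D\<phi> x \<bullet> e))"
    by (rule continuous_compact_support(1)[where R = "R + 1"])
       (intro continuous_intros C1_D[OF \<phi>] C1_D[OF \<psi>], simp add: R')
  moreover have "integrable lborel (\<lambda>x. \<phi> x * (D\<psi> x \<bullet> e))"
    by (rule continuous_compact_support(1)[where R = R])
       (intro continuous_intros C1_D[OF \<phi>] C1_D[OF \<psi>], simp add: R)
  moreover have "(LINT x|lborel. (\<phi> x *\<^sub>R D\<psi> x + \<psi> x *\<^sub>R D\<phi> x) \<bullet> e) = 0"
    by (rule C1_integral_derivative_eq_0[OF C1_mult[OF \<phi> \<psi>], where R = R]) (simp add: R)
  ultimately show ?thesis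
    by (simp add: inner_add_left)
qed

lemma C1c_component: "C1c v Dv \<Longrightarrow> C1 (\<lambda>x. v x $ \<alpha>) (\<lambda>x. Dv x $ \<alpha>)"
  by (simp add: C1c_def)

lemma C1c_support:
  assumes "C1c v Dv"
  shows "\<exists>R. \<forall>x. R \<le> norm x \<longrightarrow> v x = 0 \<and> Dv x = 0"
proof -
  obtain R where R: "\<And>x. R \<le> norm x \<Longrightarrow> v x = 0"
    using assms by (auto simp: C1c_def)
  have "Dv x = 0" if "R + 1 \<le> norm x" for x
  proof -
    have "Dv x $ \<alpha> = 0" for \<alpha>
      by (rule C1_gradient_zero[OF C1c_component[OF assms], where R = R]) (use R that in auto)
    then show ?thesis by (simp add: vec_eq_iff)
  qed
  with R show ?thesis by (intro exI[of _ "R + 1"]) auto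
qed

lemma C1c_continuous:
  assumes "C1c v Dv"
  shows "continuous_on UNIV v" "continuous_on UNIV Dv"
proof -
  have "continuous_on UNIV (\<lambda>x. \<chi> \<alpha>. v x $ \<alpha>)" "continuous_on UNIV (\<lambda>x. \<chi> \<alpha>. Dv x $ \<alpha>)"
    using C1_D(2,3)[OF C1c_component[OF assms]] by (auto intro!: continuous_on_vec_lambda simp del: vec_lambda_eta)
  then show "continuous_on UNIV v" "continuous_on UNIV Dv" by (simp_all only: vec_lambda_eta)
qed

lemma C1c_Lp:
  assumes "C1c v Dv" "0 < p"
  shows "v \<in> Lp_space p" "Dv \<in> Lp_space p"
proof -
  obtain R where R: "\<And>x. R \<le> norm x \<Longrightarrow> v x = 0" "\<And>x. R \<le> norm x \<Longrightarrow> Dv x = 0"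
    using C1c_support[OF assms(1)] by metis
  show "v \<in> Lp_space p"
    using continuous_compact_support_Lp[OF C1c_continuous(1)[OF assms(1)] _ assms(2)] R(1) .
  show "Dv \<in> Lp_space p"
    using continuous_compact_support_Lp[OF C1c_continuous(2)[OF assms(1)] _ assms(2)] R(2) .
qed

lemma C1c_zero: "C1c (\<lambda>x. 0) (\<lambda>x. 0)"
  by (simp add: C1c_def C1_def)

lemma C1c_add_scale:
  assumes "C1c v Dv" "C1c w Dw"
  shows "C1c (\<lambda>x. v x + t *\<^sub>R w x) (\<lambda>x. Dv x + t *\<^sub>R Dw x)"
proof -
  obtain R where R: "\<And>x. R \<le> norm x \<Longrightarrow> v x = 0" using C1c_support[OF assms(1)] by metis
  obtain S where S: "\<And>x. S \<le> norm x \<Longrightarrow> w x = 0" using C1c_support[OF assms(2)] by metis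
  have "\<forall>x. max R S \<le> norm x \<longrightarrow> v x + t *\<^sub>R w x = 0" using R S by auto
  moreover have "C1 (\<lambda>x. (v x + t *\<^sub>R w x) $ \<alpha>) (\<lambda>x. (Dv x + t *\<^sub>R Dw x) $ \<alpha>)" for \<alpha>
    using C1_add[OF C1c_component[OF assms(1)] C1_cmult[OF C1c_component[OF assms(2)]], of \<alpha> t \<alpha>]
    by simp
  ultimately show ?thesis unfolding C1c_def by blast
qed

lemma C1c_diff:
  assumes "C1c v Dv" "C1c w Dw"
  shows "C1c (\<lambda>x. v x - w x) (\<lambda>x. Dv x - Dw x)"
  using C1c_add_scale[OF assms, of "-1"] by simp

lemma test_function_C1:
  fixes \<phi> :: "real^'n::finite \<Rightarrow> real"
  assumes "test_function \<phi>"
  shows "C1 \<phi> (\<lambda>x. \<chi> i. partial_deriv i \<phi> x)"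
    and "\<exists>R. \<forall>x. R \<le> norm x \<longrightarrow> \<phi> x = 0"
proof -
  have "Ck (Suc 0) \<phi>" using assms unfolding test_function_def by blast
  then have d: "\<phi> differentiable_on UNIV" and c: "\<And>i. continuous_on UNIV (partial_deriv i \<phi>)" by auto
  have "(\<phi> has_derivative (\<lambda>h. (\<chi> i. partial_deriv i \<phi> x) \<bullet> h)) (at x)" for x
  proof -
    let ?f = "frechet_derivative \<phi> (at x)"
    have f: "(\<phi> has_derivative ?f) (at x)"
      using d by (simp add: differentiable_on_def frechet_derivative_works)
    interpret linear ?f using has_derivative_linear[OF f] .
    have "?f h = (\<chi> i. partial_deriv i \<phi> x) \<bullet> h" for h
    proof -
      have "?f h = ?f (\<Sum>i\<in>UNIV. (h $ i) *\<^sub>R axis i 1)"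
        using basis_expansion[of h] by (simp add: scalar_mult_eq_scaleR)
      also have "\<dots> = (\<Sum>i\<in>UNIV. h $ i * partial_deriv i \<phi> x)"
        by (simp add: sum scale partial_deriv_def)
      finally show ?thesis by (simp add: inner_vec_def mult.commute)
    qed
    then have "?f = (\<lambda>h. (\<chi> i. partial_deriv i \<phi> x) \<bullet> h)" by (simp add: fun_eq_iff)
    then show ?thesis using f by (simp only:)
  qed
  then show "C1 \<phi> (\<lambda>x. \<chi> i. partial_deriv i \<phi> x)"
    unfolding C1_def using c by (auto intro!: continuous_on_vec_lambda)
  have "bounded (closure {x. \<phi> x \<noteq> 0})"
    using assms by (simp add: test_function_def compact_imp_bounded)
  then have "bounded {x. \<phi> x \<noteq> 0}" by (rule bounded_subset) (rule closure_subset)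
  then obtain B where "\<And>x. \<phi> x \<noteq> 0 \<Longrightarrow> norm x \<le> B" by (auto simp: bounded_iff)
  then show "\<exists>R. \<forall>x. R \<le> norm x \<longrightarrow> \<phi> x = 0"
    by (intro exI[of _ "B + 1"]) force
qed

lemma C1c_has_weak_gradient:
  assumes "C1c v Dv"
  shows "has_weak_gradient v Dv"
  unfolding has_weak_gradient_def
proof (intro conjI allI impI)
  show "locally_integrable v" "locally_integrable Dv"
    using C1c_Lp[OF assms] by (auto intro!: Lp_locally_integrable[of 1])
  fix \<phi> :: "real^'a \<Rightarrow> real" and \<alpha> i
  assume t: "test_function \<phi>"
  note C = test_function_C1(1)[OF t] and Cv = C1c_component[OF assms, of \<alpha>]
  obtain R where R: "\<And>x. R \<le> norm x \<Longrightarrow> \<phi> x = 0" using test_function_C1(2)[OF t] by blast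
  have P: "partial_deriv i \<phi> x = (\<chi> i. partial_deriv i \<phi> x) \<bullet> axis i 1" for x
    by (simp add: inner_axis)
  have [measurable]: "partial_deriv i \<phi> \<in> borel_measurable borel"
    unfolding P using C1_measurable(2)[OF C] by measurable
  note [measurable] = C1_measurable[OF C] C1_measurable[OF Cv]
  have D: "Dv x $ \<alpha> $ i = Dv x $ \<alpha> \<bullet> axis i 1" for x by (simp add: inner_axis)
  have "(LINT x|lebesgue. v x $ \<alpha> * partial_deriv i \<phi> x) = (LINT x|lborel. v x $ \<alpha> * partial_deriv i \<phi> x)"
    by (intro integral_completion) measurable
  also have "\<dots> = - (LINT x|lborel. \<phi> x * (Dv x $ \<alpha> \<bullet> axis i 1))"
    unfolding P by (rule C1_integration_by_parts[OF C R Cv])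
  also have "(LINT x|lborel. \<phi> x * (Dv x $ \<alpha> \<bullet> axis i 1)) = (LINT x|lborel. Dv x $ \<alpha> $ i * \<phi> x)"
    by (simp add: D mult.commute)
  also have "\<dots> = (LINT x|lebesgue. Dv x $ \<alpha> $ i * \<phi> x)"
    unfolding D by (intro integral_completion[symmetric]) measurable
  finally show "(LINT x|lebesgue. v x $ \<alpha> * partial_deriv i \<phi> x)
      = - (LINT x|lebesgue. Dv x $ \<alpha> $ i * \<phi> x)" .
qed

section \<open>Strict ellipticity controls the gradient\<close>

lemma norm_tensor: "norm (\<eta> \<otimes>\<^sub>v a) = norm \<eta> * norm a"
proof -
  have "(norm (\<eta> \<otimes>\<^sub>v a))\<^sup>2 = (\<Sum>\<beta>\<in>UNIV. \<Sum>j\<in>UNIV. (\<eta> $ \<beta>)\<^sup>2 * (a $ j)\<^sup>2)"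
    unfolding power2_norm_eq_inner
    by (simp add: tensor_def inner_vec_def power2_eq_square algebra_simps)
  also have "\<dots> = (\<Sum>\<beta>\<in>UNIV. (\<eta> $ \<beta>)\<^sup>2) * (\<Sum>j\<in>UNIV. (a $ j)\<^sup>2)"
    by (simp add: sum_product)
  also have "\<dots> = (norm \<eta> * norm a)\<^sup>2"
    unfolding power_mult_distrib power2_norm_eq_inner
    by (simp add: inner_vec_def power2_eq_square)
  finally show ?thesis by simp
qed

lemma integral_lborel_pair:
  fixes K :: "'a::euclidean_space \<times> 'b::euclidean_space \<Rightarrow> real"
  assumes "integrable lborel K"
  shows "(LINT p|lborel. K p) = (LINT x|lborel. LINT y|lborel. K (x, y))"
  using lborel_pair.integral_fst'[of K] assms by (simp add: lborel_prod)

subsection \<open>Gaussian kernels as averages of characters\<close>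

abbreviation normal_vector :: "('n::finite \<Rightarrow> real) measure" where
  "normal_vector \<equiv> Pi\<^sub>M UNIV (\<lambda>_. std_normal_distribution)"

lemma prob_space_std_normal: "prob_space std_normal_distribution"
  using real_dist_normal_dist by (rule real_distribution.axioms(1))

lemma prob_space_normal_vector: "prob_space normal_vector"
  by (intro prob_space_PiM prob_space_std_normal)

lemma normal_vector_cos:
  fixes z :: "'n::finite \<Rightarrow> real"
  shows "(LINT \<xi>|normal_vector. cos (\<Sum>i\<in>UNIV. \<xi> i * z i)) = exp (- (\<Sum>i\<in>UNIV. (z i)\<^sup>2) / 2)"
proof -
  interpret N: prob_space std_normal_distribution by (rule prob_space_std_normal)
  interpret product_prob_space "\<lambda>_. std_normal_distribution" "UNIV :: 'n set"
    by unfold_locales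
  have i: "integrable std_normal_distribution (\<lambda>t. iexp (z i * t))" for i
    by (rule N.integrable_const_bound[where B = 1]) auto
  have "integrable normal_vector (\<lambda>\<xi>. (\<Prod>i\<in>UNIV. iexp (z i * \<xi> i)))"
    by (intro product_integrable_prod i) auto
  moreover have "(\<Prod>i\<in>UNIV. iexp (z i * \<xi> i)) = iexp (\<Sum>i\<in>UNIV. \<xi> i * z i)" for \<xi> :: "'n \<Rightarrow> real"
    by (simp add: exp_sum[symmetric] sum_distrib_left mult.commute)
  moreover have "(LINT \<xi>|normal_vector. (\<Prod>i\<in>UNIV. iexp (z i * \<xi> i)))
      = (\<Prod>i\<in>UNIV. (LINT t|std_normal_distribution. iexp (z i * t)))"
    by (intro product_integral_prod i) auto
  moreover have "(LINT t|std_normal_distribution. iexp (z i * t)) = complex_of_real (exp (- (z i)\<^sup>2 / 2))" for i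
    using char_std_normal_distribution by (simp add: char_def fun_eq_iff)
  ultimately have int: "integrable normal_vector (\<lambda>\<xi>. iexp (\<Sum>i\<in>UNIV. \<xi> i * z i))"
    and eq: "(LINT \<xi>|normal_vector. iexp (\<Sum>i\<in>UNIV. \<xi> i * z i))
      = (\<Prod>i\<in>UNIV. complex_of_real (exp (- (z i)\<^sup>2 / 2)))"
    by simp_all
  have re: "Re (iexp t) = cos t" for t by (simp add: Re_exp)
  have "(LINT \<xi>|normal_vector. cos (\<Sum>i\<in>UNIV. \<xi> i * z i))
      = Re (LINT \<xi>|normal_vector. iexp (\<Sum>i\<in>UNIV. \<xi> i * z i))"
    unfolding re[symmetric] by (rule integral_bounded_linear[OF bounded_linear_Re int])
  also have "\<dots> = (\<Prod>i\<in>UNIV. exp (- (z i)\<^sup>2 / 2))"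
    unfolding eq of_real_prod[symmetric] by (rule Re_complex_of_real)
  also have "\<dots> = exp (- (\<Sum>i\<in>UNIV. (z i)\<^sup>2) / 2)"
    by (simp add: exp_sum[symmetric] sum_negf sum_divide_distrib)
  finally show ?thesis .
qed

text \<open>The cosine of \<open>s * \<xi> \<bullet> (x - y)\<close> splits by the addition theorem into products of a function of
  \<open>x\<close> and a function of \<open>y\<close>, so the double integral of \<open>G x \<bullet> G y\<close> against it is a sum of two
  squares. Averaging over a standard normal vector \<open>\<xi>\<close> turns the cosine into a Gaussian kernel.\<close>

lemma character_energy:
  fixes G :: "real^'n::finite \<Rightarrow> 'b::euclidean_space" and s :: real
  assumes G: "continuous_on UNIV G" and R: "\<And>x. R \<le> norm x \<Longrightarrow> G x = 0"
  defines "c \<equiv> \<lambda>\<xi>. LINT x|lborel. cos (s * (\<Sum>i\<in>UNIV. \<xi> i * x $ i)) *\<^sub>R G x"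
    and "d \<equiv> \<lambda>\<xi>. LINT x|lborel. sin (s * (\<Sum>i\<in>UNIV. \<xi> i * x $ i)) *\<^sub>R G x"
  shows "(LINT \<xi>|normal_vector. (norm (c \<xi>))\<^sup>2 + (norm (d \<xi>))\<^sup>2)
      = (LINT x|lborel. LINT y|lborel. (G x \<bullet> G y) * exp (- (s * norm (x - y))\<^sup>2 / 2))"
    and "integrable normal_vector (\<lambda>\<xi>. (norm (c \<xi>))\<^sup>2 + (norm (d \<xi>))\<^sup>2)"
proof -
  let ?dot = "\<lambda>\<xi> x. \<Sum>i\<in>UNIV. \<xi> i * x $ i"
  define H where "H p = G (fst p) \<bullet> G (snd p)" for p
  have G': "continuous_on UNIV (\<lambda>p::(real^'n) \<times> (real^'n). G (fst p))"
      "continuous_on UNIV (\<lambda>p::(real^'n) \<times> (real^'n). G (snd p))"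
    by (auto intro!: continuous_on_compose2[OF G] continuous_intros)
  have HR: "H p = 0" if "2 * \<bar>R\<bar> \<le> norm p" for p
  proof -
    have "norm p \<le> norm (fst p) + norm (snd p)"
      using norm_triangle_ineq[of "(fst p, 0)" "(0, snd p)"] by (simp add: norm_Pair)
    then have "R \<le> norm (fst p) \<or> R \<le> norm (snd p)" using that by linarith
    then show ?thesis using R by (auto simp: H_def)
  qed
  have intH: "integrable lborel (\<lambda>p. H p * w p)" if "continuous_on UNIV w" for w
  proof (rule continuous_compact_support(1)[where R = "2 * \<bar>R\<bar>"])
    show "continuous_on UNIV (\<lambda>p. H p * w p)"
      unfolding H_def by (intro continuous_intros G' that)
  qed (simp add: HR)
  have Hm[measurable]: "H \<in> borel_measurable borel"
    unfolding H_def[abs_def] by (intro borel_measurable_continuous_onI continuous_intros G')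
  have intG: "integrable lborel (\<lambda>x. w x *\<^sub>R G x)" if "continuous_on UNIV w" for w
    by (rule continuous_compact_support(1)[where R = R])
       (auto simp: R intro!: continuous_intros G that)
  have sq: "(norm (LINT x|lborel. w x *\<^sub>R G x))\<^sup>2 = (LINT p|lborel. H p * (w (fst p) * w (snd p)))"
    if w: "continuous_on UNIV w" for w
  proof -
    let ?c = "LINT x|lborel. w x *\<^sub>R G x"
    have w': "continuous_on UNIV (\<lambda>p::(real^'n) \<times> (real^'n). w (fst p) * w (snd p))"
      by (auto intro!: continuous_intros continuous_on_compose2[OF w])
    have "(norm ?c)\<^sup>2 = (LINT x|lborel. (w x *\<^sub>R G x) \<bullet> ?c)"
      unfolding power2_norm_eq_inner by (rule integral_inner_left[OF intG[OF w], symmetric])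
    also have "\<dots> = (LINT x|lborel. LINT y|lborel. (w x *\<^sub>R G x) \<bullet> (w y *\<^sub>R G y))"
      using intG[OF w] by (simp del: inner_scaleR_left inner_scaleR_right)
    also have "\<dots> = (LINT x|lborel. LINT y|lborel. H (x, y) * (w (fst (x, y)) * w (snd (x, y))))"
      by (simp add: H_def mult_ac)
    also have "\<dots> = (LINT p|lborel. H p * (w (fst p) * w (snd p)))"
      by (rule integral_lborel_pair[symmetric, OF intH[OF w']])
    finally show ?thesis .
  qed
  let ?F = "\<lambda>\<xi> p. H p * cos (s * ?dot \<xi> (fst p - snd p))"
  have cF: "continuous_on UNIV (\<lambda>p::(real^'n) \<times> (real^'n). cos (s * ?dot \<xi> (fst p - snd p)))" for \<xi>
    by (intro continuous_intros)
  have cd: "(norm (c \<xi>))\<^sup>2 + (norm (d \<xi>))\<^sup>2 = (LINT p|lborel. ?F \<xi> p)" for \<xi>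
  proof -
    have w: "continuous_on UNIV (\<lambda>x. cos (s * ?dot \<xi> x))" "continuous_on UNIV (\<lambda>x. sin (s * ?dot \<xi> x))"
      by (intro continuous_intros)+
    have w': "continuous_on UNIV (\<lambda>p::(real^'n) \<times> (real^'n). cos (s * ?dot \<xi> (fst p)) * cos (s * ?dot \<xi> (snd p)))"
      "continuous_on UNIV (\<lambda>p::(real^'n) \<times> (real^'n). sin (s * ?dot \<xi> (fst p)) * sin (s * ?dot \<xi> (snd p)))"
      by (intro continuous_intros)+
    have "s * ?dot \<xi> (fst p - snd p) = s * ?dot \<xi> (fst p) - s * ?dot \<xi> (snd p)" for p
      by (simp add: right_diff_distrib sum_subtractf)
    then have "?F \<xi> p = H p * (cos (s * ?dot \<xi> (fst p)) * cos (s * ?dot \<xi> (snd p)))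
        + H p * (sin (s * ?dot \<xi> (fst p)) * sin (s * ?dot \<xi> (snd p)))" for p
      by (simp only: cos_diff distrib_left)
    then show ?thesis
      unfolding c_def d_def sq[OF w(1)] sq[OF w(2)]
      by (simp only: Bochner_Integration.integral_add[OF intH[OF w'(1)] intH[OF w'(2)]])
  qed
  interpret N: prob_space "normal_vector :: ('n \<Rightarrow> real) measure" by (rule prob_space_normal_vector)
  interpret P: pair_sigma_finite "normal_vector :: ('n \<Rightarrow> real) measure" "lborel :: ((real^'n) \<times> (real^'n)) measure"
    by unfold_locales
  let ?N = "normal_vector \<Otimes>\<^sub>M lborel :: (('n \<Rightarrow> real) \<times> ((real^'n) \<times> (real^'n))) measure"
  have "(\<lambda>p::(real^'n) \<times> (real^'n). (fst p - snd p) $ i) \<in> borel_measurable lborel" for i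
    by (simp, intro borel_measurable_continuous_onI continuous_intros)
  from measurable_compose[OF measurable_snd this]
  have m1: "(\<lambda>q. (fst (snd q) - snd (snd q)) $ i) \<in> borel_measurable ?N" for i .
  have "(\<lambda>\<xi>. \<xi> i) \<in> borel_measurable normal_vector" for i :: 'n
    by measurable
  from measurable_compose[OF measurable_fst this]
  have m2: "(\<lambda>q. fst q i) \<in> borel_measurable ?N" for i .
  have mH: "(\<lambda>q. H (snd q)) \<in> borel_measurable ?N" by measurable
  have mcos: "cos \<in> borel_measurable (borel :: real measure)"
    by (intro borel_measurable_continuous_onI continuous_intros)
  have Fm: "case_prod ?F \<in> borel_measurable ?N"
    unfolding case_prod_beta'
    by (intro borel_measurable_times mH measurable_compose[OF _ mcos] borel_measurable_const
        borel_measurable_sum m1 m2)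
  have F1: "integrable lborel (?F \<xi>)" for \<xi> by (rule intH[OF cF])
  have Habs: "integrable lborel (\<lambda>p. \<bar>H p\<bar>)"
    using integrable_abs[OF intH[of "\<lambda>_. 1"]] by simp
  have intP: "integrable (normal_vector \<Otimes>\<^sub>M lborel) (case_prod ?F)"
  proof (rule P.Fubini_integrable[OF Fm])
    show "integrable normal_vector (\<lambda>\<xi>. LINT p|lborel. norm (case (\<xi>, p) of (\<xi>, p) \<Rightarrow> ?F \<xi> p))"
    proof (rule N.integrable_const_bound[where B = "LINT p|lborel. \<bar>H p\<bar>"])
      show "AE \<xi> in normal_vector. norm (LINT p|lborel. norm (case (\<xi>, p) of (\<xi>, p) \<Rightarrow> ?F \<xi> p))
          \<le> (LINT p|lborel. \<bar>H p\<bar>)"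
      proof (intro AE_I2)
        fix \<xi> :: "'n \<Rightarrow> real"
        have "(LINT p|lborel. norm (?F \<xi> p)) \<le> (LINT p|lborel. \<bar>H p\<bar>)"
          by (intro integral_mono integrable_norm F1 Habs)
             (auto simp: abs_mult intro!: mult_left_le abs_cos_le_one)
        then show "norm (LINT p|lborel. norm (case (\<xi>, p) of (\<xi>, p) \<Rightarrow> ?F \<xi> p)) \<le> (LINT p|lborel. \<bar>H p\<bar>)"
          by simp
      qed
      have "(\<lambda>\<xi>p. norm (case_prod ?F \<xi>p)) \<in> borel_measurable (normal_vector \<Otimes>\<^sub>M lborel)"
        using Fm by measurable
      then show "(\<lambda>\<xi>. LINT p|lborel. norm (case (\<xi>, p) of (\<xi>, p) \<Rightarrow> ?F \<xi> p)) \<in> borel_measurable normal_vector"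
        by (intro lborel.borel_measurable_lebesgue_integral) (simp add: case_prod_beta')
    qed
  qed (use F1 in simp)
  show "integrable normal_vector (\<lambda>\<xi>. (norm (c \<xi>))\<^sup>2 + (norm (d \<xi>))\<^sup>2)"
    unfolding cd using P.integrable_fst'[OF intP] by simp
  have "(LINT \<xi>|normal_vector. (norm (c \<xi>))\<^sup>2 + (norm (d \<xi>))\<^sup>2)
      = (LINT p|lborel. LINT \<xi>|normal_vector. ?F \<xi> p)"
    unfolding cd by (rule P.Fubini_integral[OF intP, symmetric])
  also have "\<dots> = (LINT p|lborel. H p * exp (- (s * norm (fst p - snd p))\<^sup>2 / 2))"
  proof (intro Bochner_Integration.integral_cong refl)
    fix p :: "(real^'n) \<times> (real^'n)"
    have "s * ?dot \<xi> (fst p - snd p) = (\<Sum>i\<in>UNIV. \<xi> i * (s * (fst p - snd p) $ i))" for \<xi>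
      by (simp add: sum_distrib_left mult_ac)
    then have "(LINT \<xi>|normal_vector. ?F \<xi> p)
        = H p * (LINT \<xi>|normal_vector. cos (\<Sum>i\<in>UNIV. \<xi> i * (s * (fst p - snd p) $ i)))"
      by simp
    also have "\<dots> = H p * exp (- (\<Sum>i\<in>UNIV. (s * (fst p - snd p) $ i)\<^sup>2) / 2)"
      by (simp only: normal_vector_cos)
    also have "(\<Sum>i\<in>UNIV. (s * (fst p - snd p) $ i)\<^sup>2) = (s * norm (fst p - snd p))\<^sup>2"
      unfolding power_mult_distrib power2_norm_eq_inner inner_vec_def
      by (simp add: sum_distrib_left power2_eq_square)
    finally show "(LINT \<xi>|normal_vector. ?F \<xi> p) = H p * exp (- (s * norm (fst p - snd p))\<^sup>2 / 2)" .
  qed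
  also have "\<dots> = (LINT x|lborel. LINT y|lborel. H (x, y) * exp (- (s * norm (fst (x, y) - snd (x, y)))\<^sup>2 / 2))"
    by (intro integral_lborel_pair intH continuous_intros) auto
  finally show "(LINT \<xi>|normal_vector. (norm (c \<xi>))\<^sup>2 + (norm (d \<xi>))\<^sup>2)
      = (LINT x|lborel. LINT y|lborel. (G x \<bullet> G y) * exp (- (s * norm (x - y))\<^sup>2 / 2))"
    by (simp add: H_def)
qed

subsection \<open>Concentration of the Gaussian kernels\<close>

lemma integrable_gaussian: "integrable lborel (\<lambda>z::'a::euclidean_space. exp (- (norm z)\<^sup>2 / 2))"
proof (rule integrableI_nonneg)
  have 1: "integrable lborel (\<lambda>t::real. exp (- t\<^sup>2 / 2))"
  proof -
    have "exp (- t\<^sup>2 / 2) = sqrt (2 * pi) * normal_density 0 1 t" for t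
      by (simp add: normal_density_def)
    then show ?thesis by simp
  qed
  have "(norm z)\<^sup>2 = (\<Sum>b\<in>Basis. (z \<bullet> b)\<^sup>2)" for z :: 'a
    unfolding power2_norm_eq_inner by (subst euclidean_inner) (simp add: power2_eq_square)
  then have "exp (- (norm z)\<^sup>2 / 2) = (\<Prod>b\<in>Basis. exp (- (z \<bullet> b)\<^sup>2 / 2))" for z :: 'a
    by (simp add: exp_sum[symmetric] sum_negf sum_divide_distrib)
  then have "(\<integral>\<^sup>+z. ennreal (exp (- (norm (z::'a))\<^sup>2 / 2)) \<partial>lborel)
      = (\<integral>\<^sup>+z. (\<Prod>b\<in>Basis. ennreal (exp (- ((z::'a) \<bullet> b)\<^sup>2 / 2))) \<partial>lborel)"
    by (simp add: prod_ennreal)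
  also have "\<dots> = (\<Prod>b\<in>(Basis::'a set). \<integral>\<^sup>+t. ennreal (exp (- t\<^sup>2 / 2)) \<partial>lborel)"
    by (rule nn_integral_lborel_prod) auto
  also have "\<dots> < \<infinity>"
    using nn_integral_eq_integral[OF 1] by (simp add: prod_ennreal ennreal_power)
  finally show "(\<integral>\<^sup>+z. ennreal (exp (- (norm (z::'a))\<^sup>2 / 2)) \<partial>lborel) < \<infinity>" .
qed auto

lemma gaussian_integral_pos: "(LINT z|lborel. exp (- (norm (z::'a::euclidean_space))\<^sup>2 / 2)) > 0"
proof -
  have "(LINT z|lborel. exp (- (norm (z::'a))\<^sup>2 / 2)) \<noteq> 0"
    using integral_nonneg_eq_0_iff_AE[OF integrable_gaussian] 
    by (auto simp: trivial_limit_def[symmetric] eventually_False ae_filter_eq_bot_iff)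
  moreover have "(LINT z|lborel. exp (- (norm (z::'a))\<^sup>2 / 2)) \<ge> 0"
    by (intro Bochner_Integration.integral_nonneg) auto
  ultimately show ?thesis by linarith
qed

lemma integral_affine:
  fixes g :: "'a::euclidean_space \<Rightarrow> real"
  assumes [measurable]: "g \<in> borel_measurable borel" and "c > 0"
  shows "(LINT y|lborel. g y) = c ^ DIM('a) * (LINT z|lborel. g (x + c *\<^sub>R z))"
proof -
  have "(LINT y|lborel. g y)
      = (LINT y|density (distr lborel borel (\<lambda>z. x + c *\<^sub>R z)) (\<lambda>_. \<bar>c\<bar>^DIM('a)). g y)"
    using lborel_affine[of c x] assms by simp
  also have "\<dots> = c ^ DIM('a) * (LINT z|lborel. g (x + c *\<^sub>R z))"
    using assms by (subst integral_density) (auto simp: integral_distr)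
  finally show ?thesis .
qed

text \<open>Substituting \<open>y = x + z / s\<close> in the inner integral absorbs the factor \<open>s ^ DIM('a)\<close> and leaves an
  average of \<open>G x \<bullet> G (x + z / s)\<close> over a fixed Gaussian, to which dominated convergence applies.\<close>

lemma gaussian_concentration:
  fixes G :: "'a::euclidean_space \<Rightarrow> 'b::euclidean_space"
  assumes G: "continuous_on UNIV G" and R: "\<And>x. R \<le> norm x \<Longrightarrow> G x = 0"
  shows "(\<lambda>k. real (Suc k) ^ DIM('a) * (LINT x|lborel. LINT y|lborel. (G x \<bullet> G y) *
      exp (- (real (Suc k) * norm (x - y))\<^sup>2 / 2)))
    \<longlonglongrightarrow> (LINT z|lborel. exp (- (norm (z::'a))\<^sup>2 / 2)) * (LINT x|lborel. (norm (G x))\<^sup>2)"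
proof -
  let ?g = "\<lambda>z::'a. exp (- (norm z)\<^sup>2 / 2)"
  have [measurable]: "G \<in> borel_measurable borel" using G by (rule borel_measurable_continuous_onI)
  obtain B where B: "B > 0" "\<And>x. norm (G x) \<le> B"
    using continuous_compact_support(2)[OF G R] by blast
  have intG: "integrable lborel (\<lambda>x. norm (G x))"
    using continuous_compact_support(1)[OF G R] by (intro integrable_norm)
  let ?h = "\<lambda>k x. LINT z|lborel. (G x \<bullet> G (x + (1 / real (Suc k)) *\<^sub>R z)) * ?g z"
  have h: "real (Suc k) ^ DIM('a) * (LINT y|lborel. (G x \<bullet> G y) * exp (- (real (Suc k) * norm (x - y))\<^sup>2 / 2))
      = ?h k x" for k x
  proof -
    have "(LINT y|lborel. (G x \<bullet> G y) * exp (- (real (Suc k) * norm (x - y))\<^sup>2 / 2))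
      = (1 / real (Suc k)) ^ DIM('a) * ?h k x"
      by (subst integral_affine[where c = "1 / real (Suc k)" and x = x]) auto
    then show ?thesis by (simp add: power_one_over)
  qed
  have int: "integrable lborel (\<lambda>z. (G x \<bullet> G (x + (1 / real (Suc k)) *\<^sub>R z)) * ?g z)"
    and bd: "norm (?h k x) \<le> B * (LINT z|lborel. ?g z) * norm (G x)" for k x
  proof -
    have le: "norm ((G x \<bullet> G (x + (1 / real (Suc k)) *\<^sub>R z)) * ?g z) \<le> B * norm (G x) * ?g z" for z
    proof -
      have "\<bar>G x \<bullet> G (x + (1 / real (Suc k)) *\<^sub>R z)\<bar> \<le> norm (G x) * norm (G (x + (1 / real (Suc k)) *\<^sub>R z))"
        by (rule Cauchy_Schwarz_ineq2)
      also have "\<dots> \<le> norm (G x) * B" by (intro mult_left_mono B) auto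
      finally show ?thesis by (simp add: abs_mult mult.commute)
    qed
    have i: "integrable lborel (\<lambda>z. B * norm (G x) * ?g z)"
      by (intro integrable_mult_right integrable_gaussian)
    show j: "integrable lborel (\<lambda>z. (G x \<bullet> G (x + (1 / real (Suc k)) *\<^sub>R z)) * ?g z)"
      by (rule Bochner_Integration.integrable_bound[OF i])
         (use le order_trans[OF le abs_ge_self] in auto)
    have "norm (?h k x) \<le> (LINT z|lborel. norm ((G x \<bullet> G (x + (1 / real (Suc k)) *\<^sub>R z)) * ?g z))"
      by (rule integral_norm_bound)
    also have "\<dots> \<le> (LINT z|lborel. B * norm (G x) * ?g z)"
      by (intro integral_mono integrable_norm i j le)
    finally show "norm (?h k x) \<le> B * (LINT z|lborel. ?g z) * norm (G x)"
      by (simp add: mult_ac)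
  qed
  have lim: "(\<lambda>k. ?h k x) \<longlonglongrightarrow> (LINT z|lborel. (norm (G x))\<^sup>2 * ?g z)" for x
  proof (rule integral_dominated_convergence[where w = "\<lambda>z. B * norm (G x) * ?g z"])
    show "integrable lborel (\<lambda>z. B * norm (G x) * ?g z)"
      by (intro integrable_mult_right integrable_gaussian)
    show "AE z in lborel. (\<lambda>k. (G x \<bullet> G (x + (1 / real (Suc k)) *\<^sub>R z)) * ?g z) \<longlonglongrightarrow> (norm (G x))\<^sup>2 * ?g z"
    proof (intro AE_I2 tendsto_mult tendsto_const)
      fix z
      have "(\<lambda>k. x + (1 / real (Suc k)) *\<^sub>R z) \<longlonglongrightarrow> x + 0 *\<^sub>R z"
        using LIMSEQ_inverse_real_of_nat by (intro tendsto_intros) (simp add: inverse_eq_divide)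
      then have "(\<lambda>k. G (x + (1 / real (Suc k)) *\<^sub>R z)) \<longlonglongrightarrow> G x"
        using continuous_on_tendsto_compose[OF G, of _ x] by simp
      then show "(\<lambda>k. G x \<bullet> G (x + (1 / real (Suc k)) *\<^sub>R z)) \<longlonglongrightarrow> (norm (G x))\<^sup>2"
        unfolding power2_norm_eq_inner by (intro tendsto_intros)
    qed
    fix k
    show "AE z in lborel. norm ((G x \<bullet> G (x + (1 / real (Suc k)) *\<^sub>R z)) * ?g z) \<le> B * norm (G x) * ?g z"
    proof (intro AE_I2)
      fix z
      have "\<bar>G x \<bullet> G (x + (1 / real (Suc k)) *\<^sub>R z)\<bar> \<le> norm (G x) * norm (G (x + (1 / real (Suc k)) *\<^sub>R z))"
        by (rule Cauchy_Schwarz_ineq2)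
      also have "\<dots> \<le> norm (G x) * B" by (intro mult_left_mono B) auto
      finally show "norm ((G x \<bullet> G (x + (1 / real (Suc k)) *\<^sub>R z)) * ?g z) \<le> B * norm (G x) * ?g z"
        by (simp add: abs_mult mult.commute)
    qed
  qed measurable
  have "(\<lambda>k. LINT x|lborel. ?h k x) \<longlonglongrightarrow> (LINT x|lborel. (norm (G x))\<^sup>2 * (LINT z|lborel. ?g z))"
  proof (rule integral_dominated_convergence[where w = "\<lambda>x. B * (LINT z|lborel. ?g z) * norm (G x)"])
    show "integrable lborel (\<lambda>x. B * (LINT z|lborel. ?g z) * norm (G x))"
      by (intro integrable_mult_right intG)
    show "AE x in lborel. (\<lambda>k. ?h k x) \<longlonglongrightarrow> (norm (G x))\<^sup>2 * (LINT z|lborel. ?g z)"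
      using lim by simp
  qed (use bd in auto)
  then show ?thesis
    unfolding h[symmetric] by (simp add: mult.commute)
qed

subsection \<open>The energy inequality\<close>

text \<open>Integration by parts moves the derivative from \<open>v\<close> to the character, whose gradient always points in
  the direction \<open>a\<close>. For this reason the behaviour of \<open>A\<close> on rank-one matrices suffices below.\<close>

lemma character_gradient_rank_one:
  fixes v :: "real^'n::finite \<Rightarrow> real^'m::finite"
  assumes v: "C1c v Dv" and \<psi>: "C1 \<psi> (\<lambda>x. w x *\<^sub>R a)"
  shows "\<exists>\<eta>. (LINT x|lborel. \<psi> x *\<^sub>R Dv x) = \<eta> \<otimes>\<^sub>v a"
proof -
  obtain R where R: "\<And>x. R \<le> norm x \<Longrightarrow> v x = 0" "\<And>x. R \<le> norm x \<Longrightarrow> Dv x = 0"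
    using C1c_support[OF v] by metis
  have int: "integrable lborel (\<lambda>x. \<psi> x *\<^sub>R Dv x)"
    by (rule continuous_compact_support(1)[where R = R])
       (auto simp: R intro!: continuous_intros C1_D[OF \<psi>] C1c_continuous[OF v])
  have "(LINT x|lborel. \<psi> x *\<^sub>R Dv x) $ \<alpha> $ j = - (LINT x|lborel. v x $ \<alpha> * w x) * a $ j" for \<alpha> j
  proof -
    have "(LINT x|lborel. \<psi> x *\<^sub>R Dv x) $ \<alpha> $ j = (LINT x|lborel. (\<psi> x *\<^sub>R Dv x) $ \<alpha> $ j)"
      using integral_bounded_linear[OF bounded_linear_compose[OF bounded_linear_vec_nth bounded_linear_vec_nth] int]
      by simp
    also have "\<dots> = (LINT x|lborel. \<psi> x * (Dv x $ \<alpha> \<bullet> axis j 1))"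
      by (simp add: inner_axis)
    also have "\<dots> = - (LINT x|lborel. v x $ \<alpha> * ((w x *\<^sub>R a) \<bullet> axis j 1))"
      by (rule C1_integration_by_parts[OF C1c_component[OF v] _ \<psi>, where R = R]) (simp add: R)
    also have "\<dots> = - (LINT x|lborel. (v x $ \<alpha> * w x) * a $ j)"
      by (simp add: inner_axis mult.assoc)
    finally show ?thesis by simp
  qed
  then have "(LINT x|lborel. \<psi> x *\<^sub>R Dv x) = (\<chi> \<alpha>. - (LINT x|lborel. v x $ \<alpha> * w x)) \<otimes>\<^sub>v a"
    by (simp add: vec_eq_iff tensor_def)
  then show ?thesis by blast
qed

definition gaussian_energy :: "real \<Rightarrow> ('a::euclidean_space \<Rightarrow> 'b::euclidean_space) \<Rightarrow> real" where
  "gaussian_energy s G =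
    (LINT x|lborel. LINT y|lborel. (G x \<bullet> G y) * exp (- (s * norm (x - y))\<^sup>2 / 2))"

text \<open>A quadratic form that is nonnegative on rank-one matrices has a nonnegative integral over gradient
  fields. For every \<open>s\<close> the Gaussian energies of \<open>Dv\<close> and \<open>A (Dv)\<close> are averages of squares of rank-one
  matrices and of their images, which are comparable by assumption; as \<open>s\<close> grows, the energies
  concentrate to the \<open>L\<^sup>2\<close> norms. The constant \<open>\<nu>\<close> is not diminished in the process, which is what the
  contraction argument for the nonlinear system relies on.\<close>

theorem elliptic_gradient_bound:
  fixes v :: "real^'n::finite \<Rightarrow> real^'m::finite" and A :: "real^'n^'m \<Rightarrow> real^'k::finite"
  assumes A: "linear A" and \<nu>: "0 \<le> \<nu>" "\<And>\<eta> a. \<nu> * norm (\<eta> \<otimes>\<^sub>v a) \<le> norm (A (\<eta> \<otimes>\<^sub>v a))"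
    and v: "C1c v Dv"
  shows "\<nu> * Lp_norm 2 Dv \<le> Lp_norm 2 (\<lambda>x. A (Dv x))"
proof -
  have A': "bounded_linear A" using A by (simp add: linear_conv_bounded_linear)
  obtain R where R: "\<And>x. R \<le> norm x \<Longrightarrow> v x = 0" "\<And>x. R \<le> norm x \<Longrightarrow> Dv x = 0"
    using C1c_support[OF v] by metis
  have cD: "continuous_on UNIV Dv" by (rule C1c_continuous[OF v])
  have cA: "continuous_on UNIV (\<lambda>x. A (Dv x))"
    by (intro continuous_intros linear_continuous_on_compose[OF cD A])
  have RA: "A (Dv x) = 0" if "R \<le> norm x" for x
    using R(2)[OF that] A by (simp add: linear_0)
  let ?dot = "\<lambda>\<xi> x. \<Sum>i\<in>UNIV. \<xi> i * x $ i"
  have key: "\<nu>\<^sup>2 * gaussian_energy s Dv \<le> gaussian_energy s (\<lambda>x. A (Dv x))" for s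
  proof -
    let ?c = "\<lambda>\<xi>. LINT x|lborel. cos (s * ?dot \<xi> x) *\<^sub>R Dv x"
    let ?d = "\<lambda>\<xi>. LINT x|lborel. sin (s * ?dot \<xi> x) *\<^sub>R Dv x"
    have dot: "s * ?dot \<xi> x = (\<chi> i. s * \<xi> i) \<bullet> x" for \<xi> :: "'n \<Rightarrow> real" and x
      by (simp add: inner_vec_def sum_distrib_left mult_ac)
    have Ac: "A (LINT x|lborel. w x *\<^sub>R Dv x) = (LINT x|lborel. w x *\<^sub>R A (Dv x))"
      if "continuous_on UNIV w" for w
    proof -
      have "integrable lborel (\<lambda>x. w x *\<^sub>R Dv x)"
        by (rule continuous_compact_support(1)[where R = R])
           (auto simp: R intro!: continuous_intros that cD)
      from integral_bounded_linear[OF A' this] show ?thesis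
        by (simp add: linear_cmul[OF A])
    qed
    have C1cos: "C1 (\<lambda>x. cos (a \<bullet> x)) (\<lambda>x. (- sin (a \<bullet> x)) *\<^sub>R a)" for a :: "real^'n"
      unfolding C1_def by (auto intro!: derivative_eq_intros continuous_intros)
    have C1sin: "C1 (\<lambda>x. sin (a \<bullet> x)) (\<lambda>x. cos (a \<bullet> x) *\<^sub>R a)" for a :: "real^'n"
      unfolding C1_def by (auto intro!: derivative_eq_intros continuous_intros)
    have cs: "\<nu>\<^sup>2 * (norm (?c \<xi>))\<^sup>2 \<le> (norm (LINT x|lborel. cos (s * ?dot \<xi> x) *\<^sub>R A (Dv x)))\<^sup>2"
      "\<nu>\<^sup>2 * (norm (?d \<xi>))\<^sup>2 \<le> (norm (LINT x|lborel. sin (s * ?dot \<xi> x) *\<^sub>R A (Dv x)))\<^sup>2" for \<xi>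
    proof -
      have "\<exists>\<eta>. ?c \<xi> = \<eta> \<otimes>\<^sub>v (\<chi> i. s * \<xi> i)" "\<exists>\<eta>. ?d \<xi> = \<eta> \<otimes>\<^sub>v (\<chi> i. s * \<xi> i)"
        unfolding dot
        by (rule character_gradient_rank_one[OF v C1cos], rule character_gradient_rank_one[OF v C1sin])
      then have "\<nu> * norm (?c \<xi>) \<le> norm (A (?c \<xi>))" "\<nu> * norm (?d \<xi>) \<le> norm (A (?d \<xi>))"
        using \<nu>(2) by metis+
      moreover have "A (?c \<xi>) = (LINT x|lborel. cos (s * ?dot \<xi> x) *\<^sub>R A (Dv x))"
        "A (?d \<xi>) = (LINT x|lborel. sin (s * ?dot \<xi> x) *\<^sub>R A (Dv x))"
        by (rule Ac, intro continuous_intros)+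
      ultimately have "\<nu> * norm (?c \<xi>) \<le> norm (LINT x|lborel. cos (s * ?dot \<xi> x) *\<^sub>R A (Dv x))"
        "\<nu> * norm (?d \<xi>) \<le> norm (LINT x|lborel. sin (s * ?dot \<xi> x) *\<^sub>R A (Dv x))"
        by simp_all
      then show "\<nu>\<^sup>2 * (norm (?c \<xi>))\<^sup>2 \<le> (norm (LINT x|lborel. cos (s * ?dot \<xi> x) *\<^sub>R A (Dv x)))\<^sup>2"
        "\<nu>\<^sup>2 * (norm (?d \<xi>))\<^sup>2 \<le> (norm (LINT x|lborel. sin (s * ?dot \<xi> x) *\<^sub>R A (Dv x)))\<^sup>2"
        unfolding power_mult_distrib[symmetric] using \<nu>(1) by (auto intro!: power_mono)
    qed
    have "\<nu>\<^sup>2 * gaussian_energy s Dv = (LINT \<xi>|normal_vector. \<nu>\<^sup>2 * ((norm (?c \<xi>))\<^sup>2 + (norm (?d \<xi>))\<^sup>2))"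
      unfolding gaussian_energy_def using character_energy(1)[OF cD R(2), where s = s] by simp
    also have "\<dots> \<le> (LINT \<xi>|normal_vector. (norm (LINT x|lborel. cos (s * ?dot \<xi> x) *\<^sub>R A (Dv x)))\<^sup>2
        + (norm (LINT x|lborel. sin (s * ?dot \<xi> x) *\<^sub>R A (Dv x)))\<^sup>2)"
      by (intro integral_mono integrable_mult_right character_energy(2)[OF cD R(2)]
          character_energy(2)[OF cA RA]) (use cs in \<open>auto simp: distrib_left intro: add_mono\<close>)
    also have "\<dots> = gaussian_energy s (\<lambda>x. A (Dv x))"
      unfolding gaussian_energy_def by (rule character_energy(1)[OF cA RA])
    finally show ?thesis .
  qed
  let ?K = "LINT z|lborel. exp (- (norm (z::real^'n))\<^sup>2 / 2)"
  let ?n = "DIM(real^'n)"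
  have "(\<lambda>k. \<nu>\<^sup>2 * (real (Suc k) ^ ?n * gaussian_energy (real (Suc k)) Dv))
      \<longlonglongrightarrow> \<nu>\<^sup>2 * (?K * (LINT x|lborel. (norm (Dv x))\<^sup>2))"
    unfolding gaussian_energy_def by (intro tendsto_mult tendsto_const gaussian_concentration[OF cD R(2)])
  moreover have "(\<lambda>k. real (Suc k) ^ ?n * gaussian_energy (real (Suc k)) (\<lambda>x. A (Dv x)))
      \<longlonglongrightarrow> ?K * (LINT x|lborel. (norm (A (Dv x)))\<^sup>2)"
    unfolding gaussian_energy_def by (intro gaussian_concentration[OF cA RA])
  moreover have "\<nu>\<^sup>2 * (real (Suc k) ^ ?n * gaussian_energy (real (Suc k)) Dv)
      \<le> real (Suc k) ^ ?n * gaussian_energy (real (Suc k)) (\<lambda>x. A (Dv x))" for k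
    using mult_left_mono[OF key[of "real (Suc k)"], of "real (Suc k) ^ ?n"] by (simp add: mult_ac)
  ultimately have "\<nu>\<^sup>2 * (?K * (LINT x|lborel. (norm (Dv x))\<^sup>2)) \<le> ?K * (LINT x|lborel. (norm (A (Dv x)))\<^sup>2)"
    by (intro LIMSEQ_le) auto
  then have "?K * (\<nu>\<^sup>2 * (LINT x|lborel. (norm (Dv x))\<^sup>2)) \<le> ?K * (LINT x|lborel. (norm (A (Dv x)))\<^sup>2)"
    by (simp only: mult.left_commute)
  then have "\<nu>\<^sup>2 * (LINT x|lborel. (norm (Dv x))\<^sup>2) \<le> (LINT x|lborel. (norm (A (Dv x)))\<^sup>2)"
    using gaussian_integral_pos[where 'a = "real^'n"] by (rule mult_left_le_imp_le)
  moreover have "(LINT x|lborel. (norm (Dv x))\<^sup>2) = (Lp_norm 2 Dv)\<^sup>2"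
    unfolding L2_norm_sq using borel_measurable_continuous_onI[OF cD]
    by (intro integral_completion[symmetric]) auto
  moreover have "(LINT x|lborel. (norm (A (Dv x)))\<^sup>2) = (Lp_norm 2 (\<lambda>x. A (Dv x)))\<^sup>2"
    unfolding L2_norm_sq using borel_measurable_continuous_onI[OF cA]
    by (intro integral_completion[symmetric]) auto
  ultimately have "(\<nu> * Lp_norm 2 Dv)\<^sup>2 \<le> (Lp_norm 2 (\<lambda>x. A (Dv x)))\<^sup>2"
    by (simp only: power_mult_distrib)
  then show ?thesis by (rule power2_le_imp_le) simp
qed

section \<open>The Gagliardo--Nirenberg--Sobolev inequality\<close>

subsection \<open>Hoelder's inequality for several factors\<close>

lemma weighted_arith_geom_mean:
  fixes a w :: "'i \<Rightarrow> real"
  assumes "finite I" "\<And>i. i \<in> I \<Longrightarrow> 0 \<le> a i" "\<And>i. i \<in> I \<Longrightarrow> 0 \<le> w i" "sum w I = 1"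
  shows "(\<Prod>i\<in>I. a i powr w i) \<le> (\<Sum>i\<in>I. w i * a i)"
proof (cases "\<exists>i\<in>I. a i = 0")
  case True
  then have "(\<Prod>i\<in>I. a i powr w i) = 0"
    using assms(1) by (intro prod_zero) auto
  also have "\<dots> \<le> (\<Sum>i\<in>I. w i * a i)" using assms by (intro sum_nonneg) auto
  finally show ?thesis .
next
  case False
  then have pos: "a i > 0" if "i \<in> I" for i using assms(2)[OF that] that by fastforce
  have "I \<noteq> {}" using assms(4) by auto
  have "(\<Prod>i\<in>I. a i powr w i) = (\<Prod>i\<in>I. exp (w i * ln (a i)))"
    by (intro prod.cong refl) (use False in \<open>auto simp: powr_def\<close>)
  also have "\<dots> = exp (\<Sum>i\<in>I. w i *\<^sub>R ln (a i))"
    using assms(1) by (simp add: exp_sum)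
  also have "\<dots> \<le> (\<Sum>i\<in>I. w i * exp (ln (a i)))"
    using assms \<open>I \<noteq> {}\<close> by (intro convex_on_sum[OF _ _ exp_convex]) auto
  also have "\<dots> = (\<Sum>i\<in>I. w i * a i)"
    using pos by (intro sum.cong) auto
  finally show ?thesis .
qed

text \<open>If one factor has integral zero, the product vanishes almost everywhere; otherwise the factors are
  normalised and compared pointwise with their weighted arithmetic mean. A weight may be zero: since
  \<open>0 powr 0 = 0\<close>, both sides then treat a vanishing factor in the same way.\<close>

lemma Holder_prod:
  fixes f :: "'i \<Rightarrow> 'x \<Rightarrow> real"
  assumes I: "finite I" and int: "\<And>i. i \<in> I \<Longrightarrow> integrable M (f i)"
    and nn: "\<And>i x. i \<in> I \<Longrightarrow> 0 \<le> f i x"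
    and w: "\<And>i. i \<in> I \<Longrightarrow> 0 \<le> w i" "sum w I = 1"
  shows "(LINT x|M. (\<Prod>i\<in>I. f i x powr w i)) \<le> (\<Prod>i\<in>I. (LINT x|M. f i x) powr w i)"
proof (cases "\<exists>j\<in>I. (LINT x|M. f j x) = 0")
  case True
  then obtain j where j: "j \<in> I" "(LINT x|M. f j x) = 0" by blast
  then have "AE x in M. f j x = 0"
    using integral_nonneg_eq_0_iff_AE[OF int[OF j(1)]] nn by simp
  then have "AE x in M. (\<Prod>i\<in>I. f i x powr w i) = 0"
  proof eventually_elim
    case (elim x)
    then show ?case using I j by (intro prod_zero) auto
  qed
  then have "(LINT x|M. (\<Prod>i\<in>I. f i x powr w i)) = 0" by (rule integral_eq_zero_AE)
  also have "0 \<le> (\<Prod>i\<in>I. (LINT x|M. f i x) powr w i)" by (intro prod_nonneg) auto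
  finally show ?thesis .
next
  case False
  let ?c = "\<lambda>i. LINT x|M. f i x"
  have c: "?c i > 0" if "i \<in> I" for i
    using False that nn[OF that] Bochner_Integration.integral_nonneg[of M "f i"]
    by (metis order_le_imp_less_or_eq)
  have le: "(\<Prod>i\<in>I. f i x powr w i) \<le> (\<Prod>i\<in>I. ?c i powr w i) * (\<Sum>i\<in>I. w i * (f i x / ?c i))" for x
  proof -
    have "(\<Prod>i\<in>I. f i x powr w i) = (\<Prod>i\<in>I. ?c i powr w i * (f i x / ?c i) powr w i)"
    proof (intro prod.cong refl)
      fix i assume i: "i \<in> I"
      then show "f i x powr w i = ?c i powr w i * (f i x / ?c i) powr w i"
        using c[OF i] nn[OF i, of x] by (simp add: powr_divide)
    qed
    also have "\<dots> = (\<Prod>i\<in>I. ?c i powr w i) * (\<Prod>i\<in>I. (f i x / ?c i) powr w i)"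
      by (rule prod.distrib)
    also have "\<dots> \<le> (\<Prod>i\<in>I. ?c i powr w i) * (\<Sum>i\<in>I. w i * (f i x / ?c i))"
      using I w nn c by (intro mult_left_mono weighted_arith_geom_mean prod_nonneg) (auto intro: divide_nonneg_pos)
    finally show ?thesis .
  qed
  have "(LINT x|M. (\<Prod>i\<in>I. f i x powr w i))
      \<le> (LINT x|M. (\<Prod>i\<in>I. ?c i powr w i) * (\<Sum>i\<in>I. w i * (f i x / ?c i)))"
  proof (rule integral_mono'[OF _ le])
    show "integrable M (\<lambda>x. (\<Prod>i\<in>I. ?c i powr w i) * (\<Sum>i\<in>I. w i * (f i x / ?c i)))"
      by (intro integrable_mult_right Bochner_Integration.integrable_sum integrable_divide int)
    show "0 \<le> (\<Prod>i\<in>I. ?c i powr w i) * (\<Sum>i\<in>I. w i * (f i x / ?c i))" for x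
      by (rule order_trans[OF prod_nonneg le]) simp
  qed
  also have "\<dots> = (\<Prod>i\<in>I. ?c i powr w i) * (\<Sum>i\<in>I. w i * (?c i / ?c i))"
    using int by (simp, intro disjI2 sum.cong) auto
  also have "(\<Sum>i\<in>I. w i * (?c i / ?c i)) = sum w I"
  proof (intro sum.cong refl)
    fix i assume "i \<in> I"
    from c[OF this] show "w i * (?c i / ?c i) = w i" by simp
  qed
  finally show ?thesis using w(2) by simp
qed

subsection \<open>The grid-lines inequality\<close>

lemma line_integral_bounded_measurable:
  fixes M :: "'x measure" and f :: "('i \<Rightarrow> 'x) \<Rightarrow> real"
  assumes M: "finite_measure M" and f: "f \<in> borel_measurable (Pi\<^sub>M I (\<lambda>_. M))"
    and B: "\<And>x. 0 \<le> f x" "\<And>x. f x \<le> B" and sub: "insert i J = I"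
  shows "(\<lambda>x. LINT t|M. f (x(i := t))) \<in> borel_measurable (Pi\<^sub>M J (\<lambda>_. M))"
    and "0 \<le> (LINT t|M. f (x(i := t)))" "(LINT t|M. f (x(i := t))) \<le> B * measure M (space M)"
proof -
  interpret finite_measure M by fact
  have "(\<lambda>(x, t). x(i := t)) \<in> Pi\<^sub>M J (\<lambda>_. M) \<Otimes>\<^sub>M M \<rightarrow>\<^sub>M Pi\<^sub>M I (\<lambda>_. M)"
    using measurable_add_dim[of i J "\<lambda>_. M"] sub by simp
  from measurable_compose[OF this f]
  have "(\<lambda>(x, t). f (x(i := t))) \<in> borel_measurable (Pi\<^sub>M J (\<lambda>_. M) \<Otimes>\<^sub>M M)"
    by (simp add: case_prod_beta')
  then show "(\<lambda>x. LINT t|M. f (x(i := t))) \<in> borel_measurable (Pi\<^sub>M J (\<lambda>_. M))"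
    by (rule borel_measurable_lebesgue_integral)
  show "0 \<le> (LINT t|M. f (x(i := t)))" using B by simp
  have "(LINT t|M. f (x(i := t))) \<le> (LINT t|M. B)"
    using B order_trans[OF B] by (intro integral_mono') auto
  then show "(LINT t|M. f (x(i := t))) \<le> B * measure M (space M)"
    by (simp add: mult.commute)
qed

lemma finite_measure_PiM:
  assumes "finite_measure M" "finite I"
  shows "finite_measure (Pi\<^sub>M I (\<lambda>_. M))"
proof -
  interpret M: finite_measure M by fact
  interpret finite_product_sigma_finite "\<lambda>_. M" I
    by standard (rule assms)
  show ?thesis
    by (rule finite_measureI) (simp add: space_PiM measure_times M.emeasure_eq_measure ennreal_power)
qed

lemma grid_integrand_integrable:
  fixes M :: "'x measure" and f :: "('i \<Rightarrow> 'x) \<Rightarrow> real"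
  assumes M: "finite_measure M" and I: "finite I" and f: "f \<in> borel_measurable (Pi\<^sub>M I (\<lambda>_. M))"
    and B: "\<And>x. 0 \<le> f x" "\<And>x. f x \<le> B" and e: "0 \<le> e" "0 \<le> p"
  shows "integrable (Pi\<^sub>M I (\<lambda>_. M)) (\<lambda>x. f x powr e * (\<Prod>i\<in>I. (LINT t|M. f (x(i := t))) powr p))"
proof -
  interpret P: finite_measure "Pi\<^sub>M I (\<lambda>_. M)"
    by (rule finite_measure_PiM[OF M I])
  have L: "(\<lambda>x. LINT t|M. f (x(i := t))) \<in> borel_measurable (Pi\<^sub>M I (\<lambda>_. M))"
    "0 \<le> (LINT t|M. f (x(i := t)))" "(LINT t|M. f (x(i := t))) \<le> B * measure M (space M)"
    if "i \<in> I" for i x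
    using line_integral_bounded_measurable[OF M f B, where i = i and J = I] that
    by (auto simp: insert_absorb)
  show ?thesis
  proof (rule P.integrable_const_bound)
    let ?C = "B powr e * (\<Prod>i\<in>I. (B * measure M (space M)) powr p)"
    show "AE x in Pi\<^sub>M I (\<lambda>_. M). norm (f x powr e * (\<Prod>i\<in>I. (LINT t|M. f (x(i := t))) powr p)) \<le> ?C"
    proof (intro AE_I2)
      fix x
      have "f x powr e * (\<Prod>i\<in>I. (LINT t|M. f (x(i := t))) powr p) \<le> ?C"
        using B e L by (intro mult_mono prod_mono powr_mono2 conjI prod_nonneg) auto
      moreover have "0 \<le> f x powr e * (\<Prod>i\<in>I. (LINT t|M. f (x(i := t))) powr p)"
        by (intro mult_nonneg_nonneg prod_nonneg) auto
      ultimately show "norm (f x powr e * (\<Prod>i\<in>I. (LINT t|M. f (x(i := t))) powr p)) \<le> ?C" by simp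
    qed
    show "(\<lambda>x. f x powr e * (\<Prod>i\<in>I. (LINT t|M. f (x(i := t))) powr p)) \<in> borel_measurable (Pi\<^sub>M I (\<lambda>_. M))"
      using L(1) f by (intro borel_measurable_times borel_measurable_prod powr_real_measurable) auto
  qed
qed

text \<open>A version of the Loomis--Whitney inequality that reproduces itself under induction on the set of
  coordinates: integrating out the coordinate \<open>j\<close> with Hoelder's inequality bounds the left-hand side
  for \<open>f\<close> by the left-hand side for the partial integral \<open>g\<close> of \<open>f\<close>, with one coordinate fewer, while
  the total integrals of \<open>f\<close> and \<open>g\<close> agree.\<close>

lemma grid_lines_inequality:
  fixes M :: "'x measure" and f :: "('i \<Rightarrow> 'x) \<Rightarrow> real"
  assumes M: "finite_measure M" and I: "finite I" and f: "f \<in> borel_measurable (Pi\<^sub>M I (\<lambda>_. M))"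
    and B: "\<And>x. 0 \<le> f x" "\<And>x. f x \<le> B" and p: "0 \<le> p" "(real (card I) - 1) * p \<le> 1"
  shows "(LINT x|Pi\<^sub>M I (\<lambda>_. M). f x powr (1 - (real (card I) - 1) * p) *
      (\<Prod>i\<in>I. (LINT t|M. f (x(i := t))) powr p)) \<le> (LINT x|Pi\<^sub>M I (\<lambda>_. M). f x) powr (1 + p)"
  using I f B p
proof (induction I arbitrary: f B rule: finite_induct)
  case empty
  then show ?case
    by (simp add: PiM_empty lebesgue_integral_count_space_finite)
next
  case (insert j I f B)
  interpret M: finite_measure M by fact
  interpret S: product_sigma_finite "\<lambda>_::'i. M"
    by standard
  interpret MM: pair_sigma_finite M M by standard
  let ?P = "Pi\<^sub>M I (\<lambda>_. M)" and ?Q = "Pi\<^sub>M (insert j I) (\<lambda>_. M)"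
  let ?k = "real (card I)"
  have k: "real (card (insert j I)) - 1 = ?k" using insert by simp
  have kp: "?k * p \<le> 1" and p: "0 \<le> p" using insert.prems k by simp_all
  have kp': "(?k - 1) * p \<le> 1" using kp p by (simp add: left_diff_distrib)
  define g where "g x = (LINT t|M. f (x(j := t)))" for x
  have g: "g \<in> borel_measurable ?P" "\<And>x. 0 \<le> g x" "\<And>x. g x \<le> B * measure M (space M)"
    unfolding g_def by (fact line_integral_bounded_measurable[OF M insert.prems(1-3) refl])+
  have fm: "(\<lambda>t. f (x(j := t))) \<in> borel_measurable M" if "x \<in> space ?P" for x
    using measurable_compose[OF measurable_component_update[OF that insert.hyps(2)] insert.prems(1)] .
  have "(LINT x|?Q. f x powr (1 - ?k * p) * (\<Prod>i\<in>insert j I. (LINT t|M. f (x(i := t))) powr p))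
      = (LINT x|?P. LINT y|M. f (x(j := y)) powr (1 - ?k * p) *
          (\<Prod>i\<in>insert j I. (LINT t|M. f (x(j := y, i := t))) powr p))"
    using kp p by (intro S.product_integral_insert grid_integrand_integrable[OF M _ insert.prems(1-3)]
        insert.hyps) (use insert.hyps in auto)
  also have "\<dots> \<le> (LINT x|?P. g x powr (1 - (?k - 1) * p) * (\<Prod>i\<in>I. (LINT t|M. g (x(i := t))) powr p))"
  proof (rule integral_mono'[OF grid_integrand_integrable[OF M insert.hyps(1) g]])
    fix x assume x: "x \<in> space ?P"
    (* For fixed x the inner integral is estimated by Hoelder's inequality with the weight
       1 - k p on f itself and the weight p on each of the k remaining line integrals. *)
    define F where "F i y = (if i = j then f (x(j := y)) else LINT t|M. f (x(i := t, j := y)))" for i y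
    define w where "w i = (if i = j then 1 - ?k * p else p)" for i
    have xi: "x(i := t) \<in> space ?P" if "i \<in> I" "t \<in> space M" for i t
      using x that by (auto simp: space_PiM PiE_iff extensional_def)
    have fpair: "(\<lambda>(y, t). f (x(i := t, j := y))) \<in> borel_measurable (M \<Otimes>\<^sub>M M)" if i: "i \<in> I" for i
    proof -
      have "(\<lambda>q. x(i := snd q)) \<in> M \<Otimes>\<^sub>M M \<rightarrow>\<^sub>M ?P"
      proof (rule measurable_PiM_single')
        fix i' assume "i' \<in> I"
        then show "(\<lambda>q. (x(i := snd q)) i') \<in> M \<Otimes>\<^sub>M M \<rightarrow>\<^sub>M M"
          using x by (cases "i' = i") (auto simp: space_PiM intro!: measurable_const dest: PiE_mem)
      next
        show "(\<lambda>q. x(i := snd q)) \<in> space (M \<Otimes>\<^sub>M M) \<rightarrow> (\<Pi>\<^sub>E i\<in>I. space M)"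
        proof
          fix q assume "q \<in> space (M \<Otimes>\<^sub>M M)"
          then have "snd q \<in> space M" by (auto simp: space_pair_measure)
          from xi[OF i this] show "x(i := snd q) \<in> (\<Pi>\<^sub>E i\<in>I. space M)" by (simp only: space_PiM)
        qed
      qed
      then have "(\<lambda>q. (x(i := snd q), fst q)) \<in> M \<Otimes>\<^sub>M M \<rightarrow>\<^sub>M ?P \<Otimes>\<^sub>M M"
        by (intro measurable_Pair) auto
      from measurable_compose[OF measurable_compose[OF this measurable_add_dim] insert.prems(1)]
      show ?thesis by (simp only: case_prod_beta' fst_conv snd_conv)
    qed
    interpret MM: finite_measure "M \<Otimes>\<^sub>M M"
      by (rule finite_measure_pair_measure[OF M M])
    have ipair: "integrable (M \<Otimes>\<^sub>M M) (\<lambda>(y, t). f (x(i := t, j := y)))" if i: "i \<in> I" for i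
      by (rule MM.integrable_const_bound[where B = B, OF _ fpair[OF i]]) (use insert.prems in auto)
    have Fint: "integrable M (F i)" if i: "i \<in> insert j I" for i
    proof (cases "i = j")
      case True
      then show ?thesis unfolding F_def
        by (auto intro!: M.integrable_const_bound[where B = B] fm x simp: insert.prems)
    next
      case False
      then have "i \<in> I" using i by simp
      from MM.integrable_fst'[OF ipair[OF this]] show ?thesis
        unfolding F_def using False by simp
    qed
    have Fnn: "0 \<le> F i y" for i y
      unfolding F_def using insert.prems by simp
    have sum_w: "sum w (insert j I) = 1"
    proof -
      have "sum w I = (\<Sum>i\<in>I. p)"
        by (intro sum.cong) (use insert.hyps in \<open>auto simp: w_def\<close>)
      then show ?thesis using insert.hyps by (simp add: w_def)
    qed
    have gF: "(LINT y|M. F i y) = (LINT t|M. g (x(i := t)))" if i: "i \<in> I" for i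
    proof -
      have ij: "i \<noteq> j" using i insert.hyps by auto
      have "(LINT y|M. F i y) = (LINT y|M. LINT t|M. f (x(i := t, j := y)))"
        using ij by (simp add: F_def)
      also have "\<dots> = (LINT t|M. LINT y|M. f (x(i := t, j := y)))"
        using MM.Fubini_integral[OF ipair[OF i]] by simp
      finally show ?thesis by (simp add: g_def)
    qed
    have "f (x(j := y)) powr (1 - ?k * p) * (\<Prod>i\<in>insert j I. (LINT t|M. f (x(j := y, i := t))) powr p)
        = g x powr p * (\<Prod>i\<in>insert j I. F i y powr w i)" for y
    proof -
      have "(\<Prod>i\<in>I. (LINT t|M. f (x(j := y, i := t))) powr p) = (\<Prod>i\<in>I. F i y powr w i)"
      proof (intro prod.cong refl)
        fix i assume "i \<in> I"
        then have ij: "i \<noteq> j" using insert.hyps by auto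
        then show "(LINT t|M. f (x(j := y, i := t))) powr p = F i y powr w i"
          by (simp add: F_def w_def fun_upd_twist[OF ij])
      qed
      then show ?thesis using insert.hyps by (simp add: F_def w_def g_def)
    qed
    then have "(LINT y|M. f (x(j := y)) powr (1 - ?k * p) *
          (\<Prod>i\<in>insert j I. (LINT t|M. f (x(j := y, i := t))) powr p))
        = g x powr p * (LINT y|M. (\<Prod>i\<in>insert j I. F i y powr w i))"
      by simp
    also have "\<dots> \<le> g x powr p * (\<Prod>i\<in>insert j I. (LINT y|M. F i y) powr w i)"
      using insert.hyps Fint Fnn sum_w kp p
      by (intro mult_left_mono Holder_prod) (auto simp: w_def)
    also have "(\<Prod>i\<in>insert j I. (LINT y|M. F i y) powr w i)
        = g x powr (1 - ?k * p) * (\<Prod>i\<in>I. (LINT t|M. g (x(i := t))) powr p)"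
    proof -
      have "(\<Prod>i\<in>I. (LINT y|M. F i y) powr w i) = (\<Prod>i\<in>I. (LINT t|M. g (x(i := t))) powr p)"
        by (intro prod.cong refl) (use gF insert.hyps in \<open>auto simp: w_def\<close>)
      then show ?thesis using insert.hyps by (simp add: F_def w_def g_def)
    qed
    also have "g x powr p * (g x powr (1 - ?k * p) * (\<Prod>i\<in>I. (LINT t|M. g (x(i := t))) powr p))
        = g x powr (1 - (?k - 1) * p) * (\<Prod>i\<in>I. (LINT t|M. g (x(i := t))) powr p)"
      unfolding mult.assoc[symmetric] powr_add[symmetric] by (simp add: algebra_simps)
    finally show "(LINT y|M. f (x(j := y)) powr (1 - ?k * p) *
          (\<Prod>i\<in>insert j I. (LINT t|M. f (x(j := y, i := t))) powr p))
        \<le> g x powr (1 - (?k - 1) * p) * (\<Prod>i\<in>I. (LINT t|M. g (x(i := t))) powr p)" .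
  qed (use kp' p in \<open>auto intro!: mult_nonneg_nonneg prod_nonneg\<close>)
  also have "\<dots> \<le> (LINT x|?P. g x) powr (1 + p)"
    by (rule insert.IH[OF g p kp'])
  also have "(LINT x|?P. g x) = (LINT x|?Q. f x)"
  proof -
    interpret Q: finite_measure ?Q
      by (rule finite_measure_PiM[OF M]) (use insert.hyps in simp)
    have "integrable ?Q f"
      by (rule Q.integrable_const_bound[where B = B]) (use insert.prems in auto)
    then show ?thesis
      unfolding g_def by (intro S.product_integral_insert[symmetric] insert.hyps)
  qed
  finally show ?case unfolding k .
qed

subsection \<open>From lines to space\<close>

text \<open>Lebesgue measure is restricted to an interval containing the support, so that all bounded measurable
  functions on lines and boxes are integrable.\<close>

definition box_measure :: "real \<Rightarrow> real measure" where
  "box_measure R = density lborel (indicator {- R..R})"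

lemma box_measure_simps [simp]:
  "sets (box_measure R) = sets borel" "space (box_measure R) = UNIV"
  by (simp_all add: box_measure_def)

lemma finite_box_measure: "finite_measure (box_measure R)"
proof (rule finite_measureI)
  have "emeasure (box_measure R) (space (box_measure R)) = emeasure lborel {- R..R}"
    by (simp add: box_measure_def emeasure_density)
  also have "\<dots> \<noteq> \<infinity>" by (cases "-R \<le> R") auto
  finally show "emeasure (box_measure R) (space (box_measure R)) \<noteq> \<infinity>" .
qed

lemma integral_box_measure:
  fixes g :: "real \<Rightarrow> real"
  assumes "g \<in> borel_measurable borel"
  shows "(LINT t|box_measure R. g t) = (LINT t|lborel. indicator {- R..R} t * g t)"
proof -
  have "box_measure R = density lborel (\<lambda>t. ennreal (indicator {- R..R} t))"
    by (simp add: box_measure_def ennreal_indicator)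
  then show ?thesis using assms by (simp add: integral_density)
qed

lemma PiM_box_measure:
  assumes I: "finite I"
  shows "Pi\<^sub>M I (\<lambda>_. box_measure R)
    = density (Pi\<^sub>M I (\<lambda>_. lborel)) (indicator (\<Pi>\<^sub>E i\<in>I. {- R..R}))"
proof -
  interpret B: finite_measure "box_measure R" by (rule finite_box_measure)
  interpret P: product_sigma_finite "\<lambda>_. box_measure R" by standard
  interpret L: finite_product_sigma_finite "\<lambda>_. lborel :: real measure" I by standard (rule I)
  have box: "(\<Pi>\<^sub>E i\<in>I. {- R..R}) \<in> sets (Pi\<^sub>M I (\<lambda>_. lborel :: real measure))"
    using I by (intro sets_PiM_I_finite) auto
  show ?thesis
  proof (rule P.PiM_eqI[symmetric, OF I])
    show "sets (density (Pi\<^sub>M I (\<lambda>_. lborel)) (indicator (\<Pi>\<^sub>E i\<in>I. {- R..R})))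
        = sets (Pi\<^sub>M I (\<lambda>_. box_measure R))"
      by (simp cong: sets_PiM_cong)
    fix A :: "'a \<Rightarrow> real set" assume A: "\<And>i. i \<in> I \<Longrightarrow> A i \<in> sets (box_measure R)"
    have A': "Pi\<^sub>E I A \<in> sets (Pi\<^sub>M I (\<lambda>_. lborel :: real measure))"
      using I A by (intro sets_PiM_I_finite) auto
    have "emeasure (density (Pi\<^sub>M I (\<lambda>_. lborel)) (indicator (\<Pi>\<^sub>E i\<in>I. {- R..R}))) (Pi\<^sub>E I A)
        = (\<integral>\<^sup>+x. indicator (\<Pi>\<^sub>E i\<in>I. {- R..R}) x * indicator (Pi\<^sub>E I A) x \<partial>Pi\<^sub>M I (\<lambda>_. lborel))"
      using box A' by (intro emeasure_density) auto
    also have "\<dots> = emeasure (Pi\<^sub>M I (\<lambda>_. lborel)) ((\<Pi>\<^sub>E i\<in>I. {- R..R}) \<inter> Pi\<^sub>E I A)"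
      using box A' by (subst indicator_inter_arith[symmetric]) simp
    also have "(\<Pi>\<^sub>E i\<in>I. {- R..R}) \<inter> Pi\<^sub>E I A = (\<Pi>\<^sub>E i\<in>I. {- R..R} \<inter> A i)"
      by (auto simp: PiE_iff)
    also have "emeasure (Pi\<^sub>M I (\<lambda>_. lborel)) \<dots> = (\<Prod>i\<in>I. emeasure lborel ({- R..R} \<inter> A i))"
      using A by (intro L.measure_times) auto
    also have "\<dots> = (\<Prod>i\<in>I. emeasure (box_measure R) (A i))"
    proof (intro prod.cong refl)
      fix i assume "i \<in> I"
      then show "emeasure lborel ({- R..R} \<inter> A i) = emeasure (box_measure R) (A i)"
        using A[of i] unfolding box_measure_def
        by (subst emeasure_density) (auto simp: indicator_inter_arith[symmetric])
    qed
    finally show "emeasure (density (Pi\<^sub>M I (\<lambda>_. lborel)) (indicator (\<Pi>\<^sub>E i\<in>I. {- R..R}))) (Pi\<^sub>E I A)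
        = (\<Prod>i\<in>I. emeasure (box_measure R) (A i))" .
  qed
qed

abbreviation from_coords :: "('a::euclidean_space \<Rightarrow> real) \<Rightarrow> 'a" where
  "from_coords f \<equiv> \<Sum>b\<in>Basis. f b *\<^sub>R b"

lemma from_coords_measurable:
  "(from_coords :: ('a::euclidean_space \<Rightarrow> real) \<Rightarrow> 'a) \<in> borel_measurable (Pi\<^sub>M Basis (\<lambda>_. box_measure R))"
  "(from_coords :: ('a \<Rightarrow> real) \<Rightarrow> 'a) \<in> borel_measurable (Pi\<^sub>M Basis (\<lambda>_. lborel))"
proof -
  have "(\<lambda>f. f b) \<in> borel_measurable (Pi\<^sub>M Basis (\<lambda>_. box_measure R))" if "b \<in> Basis" for b :: 'a
    using measurable_component_singleton[OF that, of "\<lambda>_. box_measure R"]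
    by (simp cong: measurable_cong_sets)
  then show "from_coords \<in> borel_measurable (Pi\<^sub>M (Basis :: 'a set) (\<lambda>_. box_measure R))"
    by (intro borel_measurable_sum borel_measurable_scaleR) auto
  have "(\<lambda>f. f b) \<in> borel_measurable (Pi\<^sub>M Basis (\<lambda>_. lborel))" if "b \<in> Basis" for b :: 'a
    using measurable_component_singleton[OF that, of "\<lambda>_. lborel"] by simp
  then show "from_coords \<in> borel_measurable (Pi\<^sub>M (Basis :: 'a set) (\<lambda>_. lborel))"
    by (intro borel_measurable_sum borel_measurable_scaleR) auto
qed

lemma integral_box_coords:
  fixes K :: "'a::euclidean_space \<Rightarrow> real"
  assumes K: "K \<in> borel_measurable borel" and R: "\<And>x. R \<le> norm x \<Longrightarrow> K x = 0"
  shows "(LINT x|lborel. K x) = (LINT f|Pi\<^sub>M Basis (\<lambda>_. box_measure R). K (from_coords f))"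
proof -
  let ?B = "\<Pi>\<^sub>E b\<in>(Basis :: 'a set). {- R..R}"
  have box: "?B \<in> sets (Pi\<^sub>M Basis (\<lambda>_. lborel :: real measure))"
    by (intro sets_PiM_I_finite) auto
  note m = measurable_compose[OF from_coords_measurable(2) K]
  have "(LINT x|lborel. K x) = (LINT f|Pi\<^sub>M Basis (\<lambda>_. lborel). K (from_coords f))"
    unfolding lborel_eq[where 'a = 'a] by (rule integral_distr[OF from_coords_measurable(2) K])
  also have "\<dots> = (LINT f|Pi\<^sub>M Basis (\<lambda>_. lborel). indicator ?B f *\<^sub>R K (from_coords f))"
  proof (intro Bochner_Integration.integral_cong refl)
    fix f assume f: "f \<in> space (Pi\<^sub>M (Basis :: 'a set) (\<lambda>_. lborel :: real measure))"
    show "K (from_coords f) = indicator ?B f *\<^sub>R K (from_coords f)"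
    proof (cases "f \<in> ?B")
      case False
      then obtain b where b: "b \<in> Basis" "R < \<bar>f b\<bar>"
        using f by (force simp: space_PiM PiE_iff)
      have "from_coords f \<bullet> b = f b" using b by simp
      then have "R \<le> norm (from_coords f)"
        using Basis_le_norm[OF b(1), of "from_coords f"] b(2) by simp
      then show ?thesis using R by simp
    qed simp
  qed
  also have "\<dots> = (LINT f|density (Pi\<^sub>M Basis (\<lambda>_. lborel)) (indicator ?B). K (from_coords f))"
    unfolding ennreal_indicator[symmetric] using box m
    by (intro integral_density[symmetric]) auto
  finally show ?thesis by (simp add: PiM_box_measure)
qed

text \<open>The product of the \<open>n\<close> line bounds, each raised to the power \<open>p\<close>, bounds \<open>W powr (n * p)\<close>, and
  \<open>n * p = 1 + p\<close>. For this \<open>p\<close> the power of \<open>f\<close> itself in the grid-lines inequality is zero, so only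
  line integrals remain.\<close>

lemma lines_to_space:
  fixes W G :: "'a::euclidean_space \<Rightarrow> real"
  assumes n: "DIM('a) \<ge> 2"
    and W: "continuous_on UNIV W" "\<And>x. 0 \<le> W x" "\<And>x. R \<le> norm x \<Longrightarrow> W x = 0"
    and G: "continuous_on UNIV G" "\<And>x. 0 \<le> G x" "\<And>x. R \<le> norm x \<Longrightarrow> G x = 0"
    and le: "\<And>x b. b \<in> Basis \<Longrightarrow> W x \<le> (LINT t|box_measure R. G (x + (t - x \<bullet> b) *\<^sub>R b))"
  defines "p \<equiv> 1 / (real DIM('a) - 1)"
  shows "(LINT x|lborel. W x powr (1 + p)) \<le> (LINT x|lborel. G x) powr (1 + p)"
proof -
  interpret M: finite_measure "box_measure R" by (rule finite_box_measure)
  interpret P: finite_measure "Pi\<^sub>M (Basis :: 'a set) (\<lambda>_. box_measure R)"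
    by (rule finite_measure_PiM[OF finite_box_measure]) simp
  let ?P = "Pi\<^sub>M (Basis :: 'a set) (\<lambda>_. box_measure R)"
  let ?V = "measure ?P (space ?P)"
  have n1: "real DIM('a) - 1 > 0" using n by linarith
  have p: "p > 0" "(real DIM('a) - 1) * p = 1" "real DIM('a) * p = 1 + p"
    using n1 by (auto simp: p_def field_simps)
  have mW: "W \<in> borel_measurable borel" and mG: "G \<in> borel_measurable borel"
    using W G by (auto intro: borel_measurable_continuous_onI)
  obtain B where B: "B > 0" "\<And>x. G x \<le> B"
    using continuous_compact_support(2)[OF G(1), where R = R] G(2,3) by auto
  obtain B' where B': "B' > 0" "\<And>x. W x \<le> B'"
    using continuous_compact_support(2)[OF W(1), where R = R] W(2,3) by auto
  have coords: "from_coords (f(b := t)) = from_coords f + (t - from_coords f \<bullet> b) *\<^sub>R b"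
    if b: "b \<in> Basis" for f :: "'a \<Rightarrow> real" and b t
  proof (rule euclidean_eqI)
    fix c :: 'a assume "c \<in> Basis"
    then show "from_coords (f(b := t)) \<bullet> c = (from_coords f + (t - from_coords f \<bullet> b) *\<^sub>R b) \<bullet> c"
      using b by (cases "c = b") (auto simp: inner_add_left inner_Basis)
  qed
  have est: "(LINT x|lborel. W x powr (1 + p)) \<le> ((LINT x|lborel. G x) + d * ?V) powr (1 + p)"
    if d: "d > 0" for d
  proof -
    (* The exponent of f in the grid-lines inequality is 0 here, and 0 powr 0 = 0;
       adding d makes f positive, so that this factor is 1 everywhere. *)
    define f where "f x = G (from_coords x) + d" for x
    have fm: "f \<in> borel_measurable ?P"
      unfolding f_def using measurable_compose[OF from_coords_measurable(1) mG] by measurable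
    have f: "0 < f x" "0 \<le> f x" "f x \<le> B + d" for x
      using G(2) B(2) d by (auto simp: f_def add_nonneg_pos)
    have line: "W (from_coords x) \<le> (LINT t|box_measure R. f (x(b := t)))" if b: "b \<in> Basis" for x b
    proof -
      have m: "(\<lambda>t. G (from_coords x + (t - from_coords x \<bullet> b) *\<^sub>R b)) \<in> borel_measurable borel"
        by (intro borel_measurable_continuous_onI continuous_on_compose2[OF G(1)] continuous_intros) auto
      have "integrable (box_measure R) (\<lambda>t. f (x(b := t)))"
      proof (rule M.integrable_const_bound[where B = "B + d"])
        show "(\<lambda>t. f (x(b := t))) \<in> borel_measurable (box_measure R)"
          unfolding f_def coords[OF b] using m by (simp cong: measurable_cong_sets)
      qed (use f in auto)
      then have "(LINT t|box_measure R. G (from_coords x + (t - from_coords x \<bullet> b) *\<^sub>R b))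
          \<le> (LINT t|box_measure R. f (x(b := t)))"
        by (rule integral_mono') (use f d G(2) in \<open>auto simp: f_def coords[OF b] add_nonneg_nonneg simp del: fun_upd_apply\<close>)
      then show ?thesis using le[OF b, of "from_coords x"] by linarith
    qed
    have "(LINT x|lborel. W x powr (1 + p)) = (LINT x|?P. W (from_coords x) powr (1 + p))"
      using W(3) by (intro integral_box_coords) (use mW in auto)
    also have "\<dots> \<le> (LINT x|?P. f x powr (1 - (real (card (Basis :: 'a set)) - 1) * p) *
        (\<Prod>b\<in>Basis. (LINT t|box_measure R. f (x(b := t))) powr p))"
    proof (rule integral_mono')
      show "integrable ?P (\<lambda>x. f x powr (1 - (real (card (Basis :: 'a set)) - 1) * p) *
          (\<Prod>b\<in>Basis. (LINT t|box_measure R. f (x(b := t))) powr p))"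
        using p by (intro grid_integrand_integrable[OF finite_box_measure _ fm f(2,3)]) auto
      fix x
      have "W (from_coords x) powr (1 + p) = (\<Prod>b\<in>(Basis :: 'a set). W (from_coords x) powr p)"
        using W(2) by (simp add: powr_realpow' powr_powr[symmetric] p(3)[symmetric] powr_power mult.commute)
      also have "\<dots> \<le> (\<Prod>b\<in>Basis. (LINT t|box_measure R. f (x(b := t))) powr p)"
        using W(2) line p by (intro prod_mono conjI powr_mono2) auto
      finally show "W (from_coords x) powr (1 + p) \<le> f x powr (1 - (real (card (Basis :: 'a set)) - 1) * p) *
          (\<Prod>b\<in>Basis. (LINT t|box_measure R. f (x(b := t))) powr p)"
        using f(1)[of x] p by simp
    qed (use f in \<open>auto intro!: mult_nonneg_nonneg prod_nonneg\<close>)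
    also have "\<dots> \<le> (LINT x|?P. f x) powr (1 + p)"
      using p by (intro grid_lines_inequality[OF finite_box_measure _ fm f(2,3)]) auto
    also have "(LINT x|?P. f x) = (LINT x|lborel. G x) + d * ?V"
    proof -
      have "integrable ?P (\<lambda>x. G (from_coords x))"
        by (rule P.integrable_const_bound[where B = B])
           (use B G measurable_compose[OF from_coords_measurable(1) mG] in auto)
      then have "(LINT x|?P. f x) = (LINT x|?P. G (from_coords x)) + d * ?V"
        unfolding f_def by simp
      then show ?thesis using integral_box_coords[OF mG G(3)] by simp
    qed
    finally show ?thesis .
  qed
  have "(\<lambda>k. ((LINT x|lborel. G x) + 1 / real (Suc k) * ?V) powr (1 + p))
      \<longlonglongrightarrow> ((LINT x|lborel. G x) + 0 * ?V) powr (1 + p)"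
  proof (intro tendsto_powr' tendsto_add tendsto_mult tendsto_const)
    show "(\<lambda>k. 1 / real (Suc k)) \<longlonglongrightarrow> 0"
      using LIMSEQ_inverse_real_of_nat by (simp add: inverse_eq_divide)
    show "(LINT x|lborel. G x) + 0 * ?V \<noteq> 0 \<or> 0 < 1 + p \<and>
        (\<forall>\<^sub>F k in sequentially. 0 \<le> (LINT x|lborel. G x) + 1 / real (Suc k) * ?V)"
      using p G(2) by (auto intro!: always_eventually add_nonneg_nonneg)
  qed
  then have "(LINT x|lborel. W x powr (1 + p)) \<le> ((LINT x|lborel. G x) + 0 * ?V) powr (1 + p)"
  proof (rule LIMSEQ_le_const, intro exI allI impI)
    fix k :: nat
    show "(LINT x|lborel. W x powr (1 + p)) \<le> ((LINT x|lborel. G x) + 1 / real (Suc k) * ?V) powr (1 + p)"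
      by (rule est) simp
  qed
  then show ?thesis by simp
qed

subsection \<open>The inequality for functions of compact support\<close>

text \<open>The power \<open>\<bar>s\<bar> powr (2 * \<beta>)\<close> is written with \<open>s\<^sup>2\<close>, which gives one formula for the derivative,
  valid at \<open>0\<close> too.\<close>

lemma square_powr_has_derivative:
  fixes s \<beta> :: real
  assumes "\<beta> > 1"
  shows "((\<lambda>s. (s\<^sup>2) powr \<beta>) has_real_derivative 2 * \<beta> * (s\<^sup>2) powr (\<beta> - 1) * s) (at s)"
proof (cases "s = 0")
  case False
  then have "s\<^sup>2 > 0" by simp
  then have "((\<lambda>s. (s\<^sup>2) powr \<beta>) has_real_derivative \<beta> * (s\<^sup>2) powr (\<beta> - 1) * (2 * s)) (at s)"
    by (auto intro!: derivative_eq_intros)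
  then show ?thesis by (simp add: mult_ac)
next
  case True
  have "((\<lambda>h::real. (h\<^sup>2) powr (\<beta> - 1) * h) \<longlongrightarrow> (0\<^sup>2) powr (\<beta> - 1) * 0) (at 0)"
    using assms by (intro tendsto_intros tendsto_powr') auto
  moreover have "\<forall>\<^sub>F h in at (0::real). (h\<^sup>2) powr (\<beta> - 1) * h = ((0 + h)\<^sup>2) powr \<beta> / h - (0\<^sup>2) powr \<beta> / h"
  proof (rule eventually_at_filter[THEN iffD2], intro always_eventually allI impI)
    fix h :: real assume "h \<noteq> 0"
    then have "(h\<^sup>2) powr \<beta> = (h\<^sup>2) powr (\<beta> - 1) * h\<^sup>2"
      using powr_add[of "h\<^sup>2" "\<beta> - 1" 1] by simp
    then show "(h\<^sup>2) powr (\<beta> - 1) * h = ((0 + h)\<^sup>2) powr \<beta> / h - (0\<^sup>2) powr \<beta> / h"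
      using \<open>h \<noteq> 0\<close> by (simp add: power2_eq_square)
  qed
  ultimately have "((\<lambda>h. (((0 + h)\<^sup>2) powr \<beta> - (0\<^sup>2) powr \<beta>) / h) \<longlongrightarrow> 0) (at 0)"
    using Lim_transform_eventually by (fastforce simp: diff_divide_distrib)
  then show ?thesis using True by (simp add: DERIV_def)
qed

text \<open>The fundamental theorem of calculus on the part of the line that leads from the boundary of the
  support to \<open>x\<close>.\<close>

lemma C1_power_line_bound:
  fixes u :: "'a::euclidean_space \<Rightarrow> real"
  assumes u: "C1 u Du" and R: "\<And>x. R \<le> norm x \<Longrightarrow> u x = 0" and \<beta>: "\<beta> > 1" and b: "b \<in> Basis"
  shows "((u x)\<^sup>2) powr \<beta> \<le> (LINT t|box_measure R.
      2 * \<beta> * ((u (x + (t - x \<bullet> b) *\<^sub>R b))\<^sup>2) powr (\<beta> - 1) * \<bar>u (x + (t - x \<bullet> b) *\<^sub>R b)\<bar> *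
      norm (Du (x + (t - x \<bullet> b) *\<^sub>R b)))"
proof -
  let ?y = "\<lambda>t. x + (t - x \<bullet> b) *\<^sub>R b"
  let ?G = "\<lambda>t. 2 * \<beta> * ((u (?y t))\<^sup>2) powr (\<beta> - 1) * \<bar>u (?y t)\<bar> * norm (Du (?y t))"
  let ?f = "\<lambda>t. 2 * \<beta> * ((u (?y t))\<^sup>2) powr (\<beta> - 1) * u (?y t) * (Du (?y t) \<bullet> b)"
  have cu: "continuous_on UNIV (\<lambda>t. u (?y t))"
    by (intro continuous_on_compose2[OF C1_D(3)[OF u]] continuous_intros) auto
  have cDu: "continuous_on UNIV (\<lambda>t. Du (?y t))"
    by (intro continuous_on_compose2[OF C1_D(2)[OF u]] continuous_intros) auto
  have cp: "continuous_on UNIV (\<lambda>t. ((u (?y t))\<^sup>2) powr (\<beta> - 1))"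
    using \<beta> by (intro continuous_on_powr' continuous_intros cu) auto
  have cf: "continuous_on UNIV ?f" and cG: "continuous_on UNIV ?G"
    by (intro continuous_intros cp cu cDu)+
  have mG: "?G \<in> borel_measurable borel"
    using cG by (rule borel_measurable_continuous_onI)
  have Gnn: "0 \<le> ?G t" for t using \<beta> by simp
  have fG: "?f t \<le> ?G t" for t
  proof -
    have "?f t \<le> \<bar>?f t\<bar>" by simp
    also have "\<dots> = 2 * \<beta> * ((u (?y t))\<^sup>2) powr (\<beta> - 1) * \<bar>u (?y t)\<bar> * \<bar>Du (?y t) \<bullet> b\<bar>"
      using \<beta> by (simp add: abs_mult)
    also have "\<dots> \<le> ?G t"
      using \<beta> Cauchy_Schwarz_ineq2[of "Du (?y t)" b] b by (intro mult_left_mono) auto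
    finally show ?thesis .
  qed
  have rhs: "(LINT t|box_measure R. ?G t) = (LINT t|lborel. indicator {- R..R} t * ?G t)"
    by (rule integral_box_measure[OF mG])
  show ?thesis
  proof (cases "R \<le> \<bar>x \<bullet> b\<bar>")
    case True
    then have "u x = 0" using Basis_le_norm[OF b, of x] by (intro R) simp
    then show ?thesis using Gnn by (simp add: Bochner_Integration.integral_nonneg)
  next
    case False
    have end0: "u (?y (- R)) = 0"
    proof (rule R)
      have "?y (- R) \<bullet> b = - R" using b by (simp add: inner_add_left)
      then show "R \<le> norm (?y (- R))" using Basis_le_norm[OF b, of "?y (- R)"] False by simp
    qed
    have line: "((\<lambda>t. u (?y t)) has_real_derivative (Du (?y t) \<bullet> b)) (at t)" for t
    proof -
      have "((\<lambda>t. u (?y t)) has_derivative (\<lambda>h. Du (?y t) \<bullet> (h *\<^sub>R b))) (at t)"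
      proof (rule has_derivative_compose[of ?y "\<lambda>h. h *\<^sub>R b" t UNIV u "\<lambda>h. Du (?y t) \<bullet> h"])
        show "(?y has_derivative (\<lambda>h. h *\<^sub>R b)) (at t)"
          by (auto intro!: derivative_eq_intros)
      qed (rule C1_D(1)[OF u])
      then show ?thesis
        unfolding has_field_derivative_def by (rule has_derivative_eq_rhs) (simp add: fun_eq_iff)
    qed
    have "((\<lambda>t. ((u (?y t))\<^sup>2) powr \<beta>) has_real_derivative ?f t) (at t)" for t
      using DERIV_chain2[OF square_powr_has_derivative[OF \<beta>] line[of t]] by simp
    moreover have "isCont ?f t" for t
      using cf by (simp add: continuous_on_eq_continuous_at)
    ultimately have ftc: "has_bochner_integral lborel (\<lambda>t. ?f t * indicator {- R..x \<bullet> b} t)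
        (((u (?y (x \<bullet> b)))\<^sup>2) powr \<beta> - ((u (?y (- R)))\<^sup>2) powr \<beta>)"
      using False by (intro has_bochner_integral_FTC_Icc_real) auto
    have "((u x)\<^sup>2) powr \<beta> = (LINT t|lborel. ?f t * indicator {- R..x \<bullet> b} t)"
      using has_bochner_integral_integral_eq[OF ftc] end0 by simp
    also have "\<dots> \<le> (LINT t|lborel. indicator {- R..R} t * ?G t)"
    proof (rule integral_mono)
      show "integrable lborel (\<lambda>t. ?f t * indicator {- R..x \<bullet> b} t)"
        using ftc by (auto simp: has_bochner_integral_iff)
      show "integrable lborel (\<lambda>t. indicator {- R..R} t * ?G t)"
        using borel_integrable_compact[OF compact_Icc continuous_on_subset[OF cG subset_UNIV], of "- R" R] by simp
      fix t
      show "?f t * indicator {- R..x \<bullet> b} t \<le> indicator {- R..R} t * ?G t"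
      proof (cases "t \<in> {- R..x \<bullet> b}")
        case True
        then have "t \<in> {- R..R}" using False by auto
        with True show ?thesis using fG[of t] by simp
      next
        case False
        have "0 \<le> indicator {- R..R} t * ?G t" by (intro mult_nonneg_nonneg Gnn) simp
        with False show ?thesis by simp
      qed
    qed
    finally show ?thesis unfolding rhs .
  qed
qed

text \<open>The line argument is applied to a power of \<open>u\<close> and the result is absorbed. With
  \<open>\<beta> = (n - 1) / (n - 2)\<close>, the power \<open>n / (n - 1)\<close> of \<open>\<bar>u\<bar> powr (2 * \<beta>)\<close> is the critical power of
  \<open>u\<close>. By the Cauchy--Schwarz inequality, the integral of the gradient of \<open>\<bar>u\<bar> powr (2 * \<beta>)\<close> is
  bounded by the \<open>L\<^sup>2\<close> norm of \<open>Du\<close> times the \<open>L\<^sup>2\<close> norm of \<open>\<bar>u\<bar> powr (2 * \<beta> - 1)\<close>, whose square is again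
  the critical power; dividing by it leaves the Sobolev norm.\<close>

theorem Sobolev_inequality_scalar:
  fixes u :: "'a::euclidean_space \<Rightarrow> real"
  assumes n: "DIM('a) \<ge> 3" and u: "C1 u Du" and R: "\<And>x. R \<le> norm x \<Longrightarrow> u x = 0"
  shows "Lp_norm (sobolev_exponent DIM('a)) u
    \<le> 2 * (real DIM('a) - 1) / (real DIM('a) - 2) * Lp_norm 2 Du"
proof -
  let ?n = "real DIM('a)"
  let ?q = "sobolev_exponent DIM('a)"
  define \<beta> where "\<beta> = (?n - 1) / (?n - 2)"
  define p where "p = 1 / (?n - 1)"
  have n3: "?n \<ge> 3" using n by linarith
  have \<beta>: "\<beta> > 1" "\<beta> > 0" using n3 by (auto simp: \<beta>_def field_simps)
  have p0: "p > 0" using n3 by (simp add: p_def)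
  have "2 * ((r - 1) / (r - 2)) * (1 + 1 / (r - 1)) = 2 * r / (r - 2)"
    "4 * ((r - 1) / (r - 2)) - 2 = 2 * r / (r - 2)" "2 * r / (r - 2) > 0"
    "1 / (1 + 1 / (r - 1)) = 1 / 2 + 1 / (2 * r / (r - 2))" if "r \<ge> 3" for r :: real
  proof -
    have "1 + 1 / (r - 1) = r / (r - 1)" "r - 1 \<noteq> 0" "r - 2 \<noteq> 0" "r \<noteq> 0"
      using that by (auto simp: field_simps)
    then show "2 * ((r - 1) / (r - 2)) * (1 + 1 / (r - 1)) = 2 * r / (r - 2)"
      "1 / (1 + 1 / (r - 1)) = 1 / 2 + 1 / (2 * r / (r - 2))"
      "4 * ((r - 1) / (r - 2)) - 2 = 2 * r / (r - 2)"
      by (simp_all add: divide_simps)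
    show "2 * r / (r - 2) > 0" using that by simp
  qed
  from this[OF n3] have e1: "2 * \<beta> * (1 + p) = ?q" and e2: "4 * \<beta> - 2 = ?q" and q: "?q > 0"
    and e3: "1 / (1 + p) = 1 / 2 + 1 / ?q"
    by (simp_all add: \<beta>_def p_def sobolev_exponent_def)
  define R' where "R' = R + 1"
  have R': "u x = 0" "Du x = 0" if "R' \<le> norm x" for x
    using R C1_gradient_zero[OF u, of R x] that by (auto simp: R'_def)
  define W where "W x = ((u x)\<^sup>2) powr \<beta>" for x
  define w where "w x = ((u x)\<^sup>2) powr (\<beta> - 1) * \<bar>u x\<bar>" for x
  define G where "G x = 2 * \<beta> * w x * norm (Du x)" for x
  have cW: "continuous_on UNIV W" unfolding W_def
    using \<beta> by (intro continuous_on_powr' continuous_intros C1_D[OF u]) auto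
  have cw: "continuous_on UNIV w" unfolding w_def
    using \<beta> by (intro continuous_intros continuous_on_powr' C1_D[OF u]) auto
  have cG: "continuous_on UNIV G" unfolding G_def
    by (intro continuous_intros cw C1_D[OF u])
  define S where "S = Lp_norm ?q u powr ?q"
  have S: "S = (LINT x|lebesgue. \<bar>u x\<bar> powr ?q)" "S \<ge> 0"
    using q by (simp_all add: S_def Lp_norm_powr)
  have mu: "u \<in> borel_measurable borel" by (rule C1_measurable[OF u])
  have "S = (LINT x|lborel. \<bar>u x\<bar> powr ?q)"
    unfolding S(1) using mu by (intro integral_completion) auto
  also have "\<dots> = (LINT x|lborel. W x powr (1 + p))"
    unfolding W_def e1[symmetric] powr_powr
    by (simp add: powr_powr[symmetric] powr_numeral flip: mult.assoc)
  also have "\<dots> \<le> (LINT x|lborel. G x) powr (1 + p)"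
    unfolding p_def
  proof (rule lines_to_space[where R = R'])
    show "W x \<le> (LINT t|box_measure R'. G (x + (t - x \<bullet> b) *\<^sub>R b))" if "b \<in> Basis" for x b
      unfolding W_def G_def w_def mult.assoc[symmetric]
      by (rule C1_power_line_bound[OF u R'(1) \<beta>(1) that])
  qed (use n cW cG R' \<beta> in \<open>auto simp: W_def G_def w_def\<close>)
  finally have SG: "S \<le> (LINT x|lborel. G x) powr (1 + p)" .
  have GX: "(LINT x|lborel. G x) \<le> 2 * \<beta> * (S powr (1 / 2) * Lp_norm 2 Du)"
  proof -
    have wL: "w \<in> Lp_space 2"
      by (rule continuous_compact_support_Lp[OF cw, where R = R']) (auto simp: w_def R')
    have DL: "(\<lambda>x. norm (Du x)) \<in> Lp_space 2"
      by (rule continuous_compact_support_Lp[where R = R']) (auto intro!: continuous_intros C1_D[OF u] simp: R')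
    have "norm (w x) powr 2 = \<bar>u x\<bar> powr ?q" for x
    proof (cases "u x = 0")
      case False
      have "norm (w x) powr 2 = ((\<bar>u x\<bar> powr 2) powr (\<beta> - 1) * \<bar>u x\<bar> powr 1) powr 2"
      proof -
        have *: "(u x)\<^sup>2 = \<bar>u x\<bar> powr 2"
          using powr_realpow[of "\<bar>u x\<bar>" 2] False by simp
        have w: "norm (w x) = (u x)\<^sup>2 powr (\<beta> - 1) * \<bar>u x\<bar>"
          by (simp add: w_def abs_mult)
        have o: "\<bar>u x\<bar> powr 1 = \<bar>u x\<bar>" by simp
        show ?thesis unfolding w * o by (rule refl)
      qed
      also have "\<dots> = \<bar>u x\<bar> powr ((2 * (\<beta> - 1) + 1) * 2)"
        by (simp only: powr_powr powr_add[symmetric])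
      also have "(2 * (\<beta> - 1) + 1) * 2 = ?q" using e2 by (simp add: algebra_simps)
      finally show ?thesis .
    qed (simp add: w_def)
    then have w2: "Lp_norm 2 w = S powr (1 / 2)"
      unfolding Lp_norm_def S(1) by simp
    have D2: "Lp_norm 2 (\<lambda>x. norm (Du x)) = Lp_norm 2 Du"
      by (simp add: Lp_norm_def)
    have "(LINT x|lborel. G x) = 2 * \<beta> * (LINT x|lborel. w x * norm (Du x))"
      unfolding G_def by (simp add: mult.assoc)
    also have "(LINT x|lborel. w x * norm (Du x)) = (LINT x|lebesgue. w x \<bullet> norm (Du x))"
      using borel_measurable_continuous_onI[OF cw] C1_measurable(2)[OF u]
      by (subst integral_completion) auto
    also have "\<dots> \<le> Lp_norm 2 w * Lp_norm 2 (\<lambda>x. norm (Du x))"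
      using L2_cauchy_schwarz[OF wL DL] by linarith
    finally show ?thesis unfolding w2 D2 using \<beta> by simp
  qed
  have "0 \<le> (LINT x|lborel. G x)"
    using \<beta> by (intro Bochner_Integration.integral_nonneg) (simp add: G_def w_def)
  then have *: "S \<le> (2 * \<beta> * (S powr (1 / 2) * Lp_norm 2 Du)) powr (1 + p)"
    using p0 by (intro order_trans[OF SG] powr_mono2 GX) auto
  have "Lp_norm ?q u \<le> 2 * \<beta> * Lp_norm 2 Du"
  proof (cases "S = 0")
    case True
    then have "Lp_norm ?q u = 0" by (simp add: S_def)
    then show ?thesis using \<beta> by simp
  next
    case False
    then have S0: "S > 0" using S(2) by simp
    have "S powr (1 / 2) * S powr (1 / ?q) = S powr (1 / (1 + p))"
      unfolding e3 powr_add by (rule refl)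
    also have "\<dots> \<le> ((2 * \<beta> * (S powr (1 / 2) * Lp_norm 2 Du)) powr (1 + p)) powr (1 / (1 + p))"
      using * S0 p0 by (intro powr_mono2) auto
    also have "\<dots> = 2 * \<beta> * (S powr (1 / 2) * Lp_norm 2 Du)"
      using p0 \<beta> by (simp add: powr_powr)
    also have "\<dots> = S powr (1 / 2) * (2 * \<beta> * Lp_norm 2 Du)" by simp
    finally have "S powr (1 / 2) * S powr (1 / ?q) \<le> S powr (1 / 2) * (2 * \<beta> * Lp_norm 2 Du)" .
    then have "S powr (1 / ?q) \<le> 2 * \<beta> * Lp_norm 2 Du"
      using S0 by (simp add: mult_le_cancel_left_pos)
    moreover have "S powr (1 / ?q) = Lp_norm ?q u"
      using q by (simp add: S_def powr_powr)
    ultimately show ?thesis by simp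
  qed
  then show ?thesis by (simp add: \<beta>_def)
qed

lemma Lp_norm_sum_le:
  fixes f :: "'i \<Rightarrow> 'a::euclidean_space \<Rightarrow> 'b::euclidean_space"
  assumes p: "1 \<le> p" and I: "finite I" and f: "\<And>i. i \<in> I \<Longrightarrow> f i \<in> Lp_space p"
  shows "(\<lambda>x. \<Sum>i\<in>I. f i x) \<in> Lp_space p \<and> Lp_norm p (\<lambda>x. \<Sum>i\<in>I. f i x) \<le> (\<Sum>i\<in>I. Lp_norm p (f i))"
  using I f
proof (induction I rule: finite_induct)
  case (insert j I)
  then show ?case
    using Lp_add[OF p, of "f j" "\<lambda>x. \<Sum>i\<in>I. f i x"] by simp
qed simp

definition sobolev_constant :: "nat \<Rightarrow> nat \<Rightarrow> real" where
  "sobolev_constant n m = real m * (2 * (real n - 1) / (real n - 2))"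

theorem Sobolev_inequality:
  fixes v :: "real^'n::finite \<Rightarrow> real^'m::finite"
  assumes n: "CARD('n) \<ge> 3" and v: "C1c v Dv"
  shows "Lp_norm (sobolev_exponent CARD('n)) v \<le> sobolev_constant CARD('n) CARD('m) * Lp_norm 2 Dv"
proof -
  let ?q = "sobolev_exponent CARD('n)"
  let ?\<gamma> = "2 * (real CARD('n) - 1) / (real CARD('n) - 2)"
  have q: "?q \<ge> 1" and \<gamma>: "?\<gamma> \<ge> 0" using n by (auto simp: sobolev_exponent_def field_simps)
  obtain R where R: "\<And>x. R \<le> norm x \<Longrightarrow> v x = 0" "\<And>x. R \<le> norm x \<Longrightarrow> Dv x = 0"
    using C1c_support[OF v] by metis
  have vL: "v \<in> Lp_space ?q" and DL: "Dv \<in> Lp_space 2"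
    using C1c_Lp[OF v] q by auto
  have comp: "(\<lambda>x. norm (v x $ \<alpha>)) \<in> Lp_space ?q" for \<alpha>
    using q by (intro continuous_compact_support_Lp[where R = R] continuous_intros C1_D[OF C1c_component[OF v]])
       (auto simp: R)
  have sumL: "(\<lambda>x. \<Sum>\<alpha>\<in>UNIV. norm (v x $ \<alpha>)) \<in> Lp_space ?q"
    "Lp_norm ?q (\<lambda>x. \<Sum>\<alpha>\<in>UNIV. norm (v x $ \<alpha>)) \<le> (\<Sum>\<alpha>\<in>UNIV. Lp_norm ?q (\<lambda>x. norm (v x $ \<alpha>)))"
    using Lp_norm_sum_le[OF q finite, of UNIV "\<lambda>\<alpha> x. norm (v x $ \<alpha>)"] comp by blast+
  have "Lp_norm ?q v \<le> Lp_norm ?q (\<lambda>x. \<Sum>\<alpha>\<in>UNIV. norm (v x $ \<alpha>))"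
  proof (rule Lp_mono(2)[OF _ Lp_space_measurable[OF vL] sumL(1)])
    show "0 < ?q" using q by simp
    have "norm (v x) \<le> norm (\<Sum>\<alpha>\<in>UNIV. norm (v x $ \<alpha>))" for x
      using norm_le_l1_cart[of "v x"] by (simp add: sum_nonneg)
    then show "AE x in lebesgue. norm (v x) \<le> norm (\<Sum>\<alpha>\<in>UNIV. norm (v x $ \<alpha>))" by simp
  qed
  also have "\<dots> \<le> (\<Sum>\<alpha>\<in>UNIV. Lp_norm ?q (\<lambda>x. norm (v x $ \<alpha>)))" by (rule sumL(2))
  also have "\<dots> \<le> (\<Sum>\<alpha>\<in>(UNIV :: 'm set). ?\<gamma> * Lp_norm 2 Dv)"
  proof (intro sum_mono)
    fix \<alpha>
    have "Lp_norm ?q (\<lambda>x. norm (v x $ \<alpha>)) = Lp_norm ?q (\<lambda>x. v x $ \<alpha>)"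
      by (simp add: Lp_norm_def)
    also have "\<dots> \<le> ?\<gamma> * Lp_norm 2 (\<lambda>x. Dv x $ \<alpha>)"
      using Sobolev_inequality_scalar[OF _ C1c_component[OF v, of \<alpha>], of R] n R by simp
    also have "\<dots> \<le> ?\<gamma> * Lp_norm 2 Dv"
    proof (rule mult_left_mono[OF _ \<gamma>])
      have "(\<lambda>x. Dv x $ \<alpha>) \<in> borel_measurable lebesgue"
        using C1_measurable(2)[OF C1c_component[OF v]] by (simp add: measurable_completion)
      then show "Lp_norm 2 (\<lambda>x. Dv x $ \<alpha>) \<le> Lp_norm 2 Dv"
        by (rule Lp_mono(2)[OF zero_less_numeral _ DL]) (simp add: Finite_Cartesian_Product.norm_nth_le)
    qed
    finally show "Lp_norm ?q (\<lambda>x. norm (v x $ \<alpha>)) \<le> ?\<gamma> * Lp_norm 2 Dv" .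
  qed
  finally show ?thesis by (simp add: sobolev_constant_def)
qed

section \<open>Mollification\<close>

subsection \<open>Smooth bump functions\<close>

definition flat_exp :: "nat \<Rightarrow> real \<Rightarrow> real" where
  "flat_exp k t = (if t > 0 then (inverse t) ^ k * exp (- inverse t) else 0)"

text \<open>A class that contains the derivatives of its members, so that membership gives infinite
  differentiability without any formula for higher derivatives.\<close>

inductive smooth_fun :: "(real \<Rightarrow> real) \<Rightarrow> bool" where
  flat: "smooth_fun (flat_exp k)"
| const: "smooth_fun (\<lambda>t. c)"
| add: "smooth_fun f \<Longrightarrow> smooth_fun g \<Longrightarrow> smooth_fun (\<lambda>t. f t + g t)"
| mult: "smooth_fun f \<Longrightarrow> smooth_fun g \<Longrightarrow> smooth_fun (\<lambda>t. f t * g t)"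
| affine: "smooth_fun f \<Longrightarrow> smooth_fun (\<lambda>t. f (a + b * t))"

lemma flat_exp_has_derivative:
  "(flat_exp k has_real_derivative (flat_exp (k + 2) t + (- real k) * flat_exp (k + 1) t)) (at t)"
proof -
  consider "t > 0" | "t < 0" | "t = 0" by linarith
  then show ?thesis
  proof cases
    case 1
    have "((\<lambda>t. (inverse t) ^ k * exp (- inverse t)) has_real_derivative
        (flat_exp (k + 2) t + (- real k) * flat_exp (k + 1) t)) (at t)"
    proof -
      let ?x = "inverse t"
      have "((\<lambda>t. inverse t ^ k) has_real_derivative real k * ?x ^ (k - 1) * (- (?x ^ 2))) (at t)"
        using DERIV_power[OF DERIV_inverse[of t], of k] 1 by (simp add: power2_eq_square mult_ac)
      moreover have "((\<lambda>t. exp (- inverse t)) has_real_derivative exp (- ?x) * ?x ^ 2) (at t)"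
        using 1 by (auto intro!: derivative_eq_intros simp: power2_eq_square)
      ultimately have "((\<lambda>t. inverse t ^ k * exp (- inverse t)) has_real_derivative
          real k * ?x ^ (k - 1) * (- (?x ^ 2)) * exp (- ?x) + exp (- ?x) * ?x ^ 2 * ?x ^ k) (at t)"
        by (rule DERIV_mult)
      moreover have "real k * ?x ^ (k - 1) * (- (?x ^ 2)) * exp (- ?x) + exp (- ?x) * ?x ^ 2 * ?x ^ k
          = ?x ^ (k + 2) * exp (- ?x) + (- real k) * (?x ^ (k + 1) * exp (- ?x))"
        by (cases k) (simp_all add: power2_eq_square algebra_simps)
      ultimately show ?thesis
        using 1 by (simp only: flat_exp_def if_True)
    qed
    then show ?thesis
      by (rule has_field_derivative_transform_within_open[where S = "{0<..}"])
         (use 1 in \<open>auto simp: flat_exp_def\<close>)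
  next
    case 2
    have "((\<lambda>t. 0) has_real_derivative (flat_exp (k + 2) t + (- real k) * flat_exp (k + 1) t)) (at t)"
      using 2 by (simp add: flat_exp_def)
    then show ?thesis
      by (rule has_field_derivative_transform_within_open[where S = "{..<0}"])
         (use 2 in \<open>auto simp: flat_exp_def\<close>)
  next
    case 3
    have "((\<lambda>h. (flat_exp k (0 + h) - flat_exp k 0) / h) \<longlongrightarrow> 0) (at_right 0)"
    proof -
      have "((\<lambda>h::real. inverse h ^ (k + 1) / exp (inverse h)) \<longlongrightarrow> 0) (at_right 0)"
        by (rule filterlim_compose[OF tendsto_power_div_exp_0 filterlim_inverse_at_top_right])
      moreover have "\<forall>\<^sub>F h in at_right (0::real). inverse h ^ (k + 1) / exp (inverse h)
          = (flat_exp k (0 + h) - flat_exp k 0) / h"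
        using eventually_at_right_less[of "0::real"]
        by eventually_elim (simp add: flat_exp_def exp_minus field_simps)
      ultimately show ?thesis by (rule Lim_transform_eventually)
    qed
    moreover have "((\<lambda>h. (flat_exp k (0 + h) - flat_exp k 0) / h) \<longlongrightarrow> 0) (at_left 0)"
    proof (rule Lim_transform_eventually[OF tendsto_const])
      show "\<forall>\<^sub>F h in at_left (0::real). 0 = (flat_exp k (0 + h) - flat_exp k 0) / h"
        by (auto simp: eventually_at_left_field flat_exp_def intro!: exI[of _ "-1"])
    qed
    ultimately have "((\<lambda>h. (flat_exp k (0 + h) - flat_exp k 0) / h) \<longlongrightarrow> 0) (at 0)"
      by (simp add: filterlim_split_at)
    then show ?thesis using 3 by (simp add: DERIV_def flat_exp_def)
  qed
qed

lemma smooth_fun_derivative: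
  "smooth_fun f \<Longrightarrow> \<exists>f'. smooth_fun f' \<and> (\<forall>t. (f has_real_derivative f' t) (at t))"
proof (induction rule: smooth_fun.induct)
  case (flat k)
  have "smooth_fun (\<lambda>t. flat_exp (k + 2) t + (- real k) * flat_exp (k + 1) t)"
    by (intro smooth_fun.intros)
  with flat_exp_has_derivative[of k] show ?case by blast
next
  case (const c)
  have "smooth_fun (\<lambda>t. 0)" by (rule smooth_fun.const)
  then show ?case by (intro exI[of _ "\<lambda>t. 0"]) auto
next
  case (add f g)
  then obtain f' g' where *: "smooth_fun f'" "smooth_fun g'"
    "\<And>t. (f has_real_derivative f' t) (at t)" "\<And>t. (g has_real_derivative g' t) (at t)" by blast
  then have "smooth_fun (\<lambda>t. f' t + g' t)" by (intro smooth_fun.intros)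
  with * show ?case by (intro exI[of _ "\<lambda>t. f' t + g' t"]) (auto intro!: derivative_intros)
next
  case (mult f g)
  then obtain f' g' where *: "smooth_fun f'" "smooth_fun g'"
    "\<And>t. (f has_real_derivative f' t) (at t)" "\<And>t. (g has_real_derivative g' t) (at t)" by blast
  then have "smooth_fun (\<lambda>t. f' t * g t + g' t * f t)" using mult by (intro smooth_fun.intros)
  with * show ?case
    by (intro exI[of _ "\<lambda>t. f' t * g t + g' t * f t"]) (auto intro!: DERIV_mult)
next
  case (affine f a b)
  then obtain f' where *: "smooth_fun f'" "\<And>t. (f has_real_derivative f' t) (at t)" by blast
  then have "smooth_fun (\<lambda>t. f' (a + b * t) * b)" by (intro smooth_fun.intros)
  moreover have "((\<lambda>t. f (a + b * t)) has_real_derivative f' (a + b * t) * b) (at t)" for t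
    by (rule DERIV_chain2[OF *(2)]) (auto intro!: derivative_eq_intros)
  ultimately show ?case by (intro exI[of _ "\<lambda>t. f' (a + b * t) * b"]) auto
qed

lemma smooth_fun_continuous: "smooth_fun f \<Longrightarrow> continuous_on UNIV f"
  using smooth_fun_derivative by (meson DERIV_isCont continuous_at_imp_continuous_on)

text \<open>A partial derivative of a product of functions of one coordinate each is again such a product, with
  one factor replaced by its derivative.\<close>

lemma smooth_product_Ck:
  fixes h :: "'n::finite \<Rightarrow> real \<Rightarrow> real"
  assumes "\<And>i. smooth_fun (h i)"
  shows "Ck k (\<lambda>x::real^'n. \<Prod>i\<in>UNIV. h i (x $ i))"
  using assms
proof (induction k arbitrary: h)
  case 0
  have "continuous_on UNIV (\<lambda>x::real^'n. x $ i)" for i by (intro continuous_intros)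
  from continuous_on_compose2[OF smooth_fun_continuous[OF 0] this]
  have "continuous_on UNIV (\<lambda>x::real^'n. h i (x $ i))" for i by simp
  then show ?case by (simp add: continuous_on_prod)
next
  case (Suc k)
  obtain h' where h': "\<And>i. smooth_fun (h' i)" "\<And>i t. (h i has_real_derivative h' i t) (at t)"
    using smooth_fun_derivative[OF Suc.prems] by metis
  let ?\<phi> = "\<lambda>x::real^'n. \<Prod>i\<in>UNIV. h i (x $ i)"
  have D: "(?\<phi> has_derivative
      (\<lambda>y. \<Sum>i\<in>UNIV. (h' i (x $ i) * y $ i) * (\<Prod>j\<in>UNIV - {i}. h j (x $ j)))) (at x)" for x
  proof (rule has_derivative_prod)
    fix i :: 'n
    have "((\<lambda>x::real^'n. x $ i) has_derivative (\<lambda>y. y $ i)) (at x)"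
      by (rule bounded_linear_imp_has_derivative) (rule bounded_linear_vec_nth)
    from has_derivative_compose[OF this h'(2)[of i "x $ i", unfolded has_field_derivative_def]]
    show "((\<lambda>x. h i (x $ i)) has_derivative (\<lambda>y. h' i (x $ i) * y $ i)) (at x)" .
  qed
  have "partial_deriv i ?\<phi> = (\<lambda>x. \<Prod>j\<in>UNIV. (h(i := h' i)) j (x $ j))" for i
  proof
    fix x :: "real^'n"
    have "partial_deriv i ?\<phi> x
        = (\<Sum>j\<in>UNIV. (h' j (x $ j) * axis i 1 $ j) * (\<Prod>l\<in>UNIV - {j}. h l (x $ l)))"
      unfolding partial_deriv_def frechet_derivative_at[OF D, symmetric] by (rule refl)
    also have "\<dots> = (\<Sum>j\<in>UNIV. if j = i then h' i (x $ i) * (\<Prod>l\<in>UNIV - {i}. h l (x $ l)) else 0)"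
      by (intro sum.cong) (auto simp: axis_def)
    also have "\<dots> = h' i (x $ i) * (\<Prod>l\<in>UNIV - {i}. h l (x $ l))" by simp
    also have "\<dots> = (\<Prod>j\<in>UNIV. (h(i := h' i)) j (x $ j))"
      by (subst prod.remove[of UNIV i]) auto
    finally show "partial_deriv i ?\<phi> x = (\<Prod>j\<in>UNIV. (h(i := h' i)) j (x $ j))" .
  qed
  moreover have "Ck k (\<lambda>x::real^'n. \<Prod>j\<in>UNIV. (h(i := h' i)) j (x $ j))" for i
    by (rule Suc.IH) (use Suc.prems h' in auto)
  moreover have "?\<phi> differentiable_on UNIV"
    using D by (auto simp: differentiable_on_def differentiable_def)
  ultimately show ?case by simp
qed

definition bump :: "real \<Rightarrow> real" where
  "bump t = flat_exp 0 (1 + t) * flat_exp 0 (1 - t)"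

lemma bump_simps: "0 \<le> bump t" "1 \<le> \<bar>t\<bar> \<Longrightarrow> bump t = 0" "bump 0 > 0"
  by (auto simp: bump_def flat_exp_def)

lemma smooth_bump: "smooth_fun (\<lambda>t. bump (a + b * t))"
proof -
  have "smooth_fun (\<lambda>t. flat_exp 0 (1 + 1 * t) * flat_exp 0 (1 + (- 1) * t))"
    by (intro smooth_fun.intros)
  then have "smooth_fun bump" by (simp add: bump_def[abs_def])
  then show ?thesis by (rule smooth_fun.affine)
qed

lemma test_function_bump:
  fixes a :: "real^'n::finite"
  assumes s: "s \<noteq> 0"
  shows "test_function (\<lambda>y. c * (\<Prod>i\<in>UNIV. bump (a $ i + s * y $ i)))"
  unfolding test_function_def
proof (intro conjI allI)
  (* The constant c is absorbed into the factor belonging to one fixed coordinate. *)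
  obtain i0 :: 'n where True by blast
  define h where "h i t = (if i = i0 then c else 1) * bump (a $ i + s * t)" for i t
  have "smooth_fun (h i)" for i
    unfolding h_def[abs_def] by (intro smooth_fun.mult smooth_fun.const smooth_bump)
  then have "Ck k (\<lambda>x::real^'n. \<Prod>i\<in>UNIV. h i (x $ i))" for k
    by (rule smooth_product_Ck)
  moreover have "(\<Prod>i\<in>UNIV. h i (x $ i)) = c * (\<Prod>i\<in>UNIV. bump (a $ i + s * x $ i))" for x :: "real^'n"
    by (simp add: h_def prod.distrib)
  ultimately show "Ck k (\<lambda>y. c * (\<Prod>i\<in>UNIV. bump (a $ i + s * y $ i)))" for k by simp
  have "norm y \<le> (\<Sum>i\<in>UNIV. (1 + \<bar>a $ i\<bar>) / \<bar>s\<bar>)"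
    if "c * (\<Prod>i\<in>UNIV. bump (a $ i + s * y $ i)) \<noteq> 0" for y
  proof -
    have "\<bar>y $ i\<bar> \<le> (1 + \<bar>a $ i\<bar>) / \<bar>s\<bar>" for i
    proof -
      have "\<bar>a $ i + s * y $ i\<bar> < 1"
        using that bump_simps(2)[of "a $ i + s * y $ i"] by (force simp: not_less)
      then have "\<bar>s * y $ i\<bar> \<le> 1 + \<bar>a $ i\<bar>" by linarith
      then show ?thesis using s by (simp add: abs_mult field_simps)
    qed
    then show ?thesis using norm_le_l1_cart[of y] by (meson order_trans sum_mono)
  qed
  then have "bounded {y. c * (\<Prod>i\<in>UNIV. bump (a $ i + s * y $ i)) \<noteq> 0}"
    unfolding bounded_iff by blast
  then show "compact (closure {y. c * (\<Prod>i\<in>UNIV. bump (a $ i + s * y $ i)) \<noteq> 0})"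
    by (simp add: compact_closure)
qed

lemma integral_pos_of_continuous:
  fixes f :: "'a::euclidean_space \<Rightarrow> real"
  assumes f: "continuous_on UNIV f" "integrable lborel f" "\<And>x. 0 \<le> f x" and a: "f a > 0"
  shows "(LINT x|lborel. f x) > 0"
proof (rule ccontr)
  assume "\<not> (LINT x|lborel. f x) > 0"
  then have "(LINT x|lborel. f x) = 0"
    using Bochner_Integration.integral_nonneg[of lborel f] f(3) by fastforce
  then have "AE x in lborel. f x = 0"
    using integral_nonneg_eq_0_iff_AE[OF f(2)] f(3) by simp
  then have "AE x in lborel. x \<notin> {x. f x > 0}" by eventually_elim simp
  moreover have o: "open {x. f x > 0}"
    by (rule open_Collect_less[OF continuous_on_const f(1)])
  ultimately have "{x. f x > 0} \<in> null_sets lborel"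
    using AE_iff_null_sets[of "{x. f x > 0}" lborel] by (simp add: borel_open)
  then have "{x. f x > 0} \<in> null_sets lebesgue" by (rule null_sets_completionI)
  then have "negligible {x. f x > 0}" by (simp add: negligible_iff_null_sets)
  then show False using open_not_negligible[OF o] a by blast
qed

text \<open>The final clause is what convolution with a weak gradient needs: for fixed \<open>x\<close>, the kernel is an
  admissible test function of \<open>y\<close>.\<close>

definition mollifier :: "real \<Rightarrow> (real^'n::finite \<Rightarrow> real) \<Rightarrow> (real^'n \<Rightarrow> real^'n) \<Rightarrow> bool" where
  "mollifier e \<rho> D\<rho> \<longleftrightarrow> C1 \<rho> D\<rho> \<and> (\<forall>x. 0 \<le> \<rho> x) \<and> (LINT x|lborel. \<rho> x) = 1 \<and>
    (\<forall>x. e \<le> norm x \<longrightarrow> \<rho> x = 0) \<and> (\<forall>x. test_function (\<lambda>y. \<rho> (x - y)))"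

lemma mollifier_exists:
  assumes e: "e > 0"
  shows "\<exists>\<rho> D\<rho> :: real^'n::finite \<Rightarrow> real^'n. mollifier e \<rho> D\<rho>"
proof -
  let ?n = "real CARD('n)"
  define s where "s = ?n / e"
  have s: "s > 0" using e by (simp add: s_def)
  define g where "g x = (\<Prod>i\<in>UNIV. bump (s * x $ i))" for x :: "real^'n"
  have t: "test_function (\<lambda>y. c * g y)" for c
    using test_function_bump[of s c 0] s by (simp add: g_def)
  have c: "continuous_on UNIV g"
    using C1_D(3)[OF test_function_C1(1)[OF t[of 1]]] by simp
  have gnn: "0 \<le> g x" for x unfolding g_def by (intro prod_nonneg) (simp add: bump_simps)
  have supp: "g x = 0" if "e \<le> norm x" for x
  proof -
    have "\<exists>i. 1 \<le> \<bar>s * x $ i\<bar>"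
    proof (rule ccontr)
      assume "\<not> (\<exists>i. 1 \<le> \<bar>s * x $ i\<bar>)"
      then have "\<bar>x $ i\<bar> < e / ?n" for i
        using s e by (auto simp: s_def abs_mult not_le field_simps)
      then have "(\<Sum>i\<in>UNIV. \<bar>x $ i\<bar>) < (\<Sum>i\<in>(UNIV::'n set). e / ?n)"
        by (intro sum_strict_mono) auto
      then show False using norm_le_l1_cart[of x] that by simp
    qed
    then show ?thesis using bump_simps(2) unfolding g_def by (auto intro!: prod_zero)
  qed
  have ig: "integrable lborel g" by (rule continuous_compact_support(1)[OF c supp])
  have "g 0 > 0" unfolding g_def by (simp add: bump_simps(3))
  then have pos: "(LINT x|lborel. g x) > 0"
    by (rule integral_pos_of_continuous[OF c ig gnn])
  define c0 where "c0 = 1 / (LINT x|lborel. g x)"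
  let ?\<rho> = "\<lambda>x. c0 * g x"
  have "mollifier e ?\<rho> (\<lambda>x. \<chi> i. partial_deriv i ?\<rho> x)"
    unfolding mollifier_def
  proof (intro conjI allI impI)
    show "C1 ?\<rho> (\<lambda>x. \<chi> i. partial_deriv i ?\<rho> x)" by (rule test_function_C1[OF t])
    show "0 \<le> ?\<rho> x" for x using pos gnn by (simp add: c0_def)
    show "(LINT x|lborel. ?\<rho> x) = 1" using pos by (simp add: c0_def)
    show "?\<rho> x = 0" if "e \<le> norm x" for x using supp[OF that] by simp
    fix x :: "real^'n"
    have "(\<lambda>y. ?\<rho> (x - y)) = (\<lambda>y. c0 * (\<Prod>i\<in>UNIV. bump ((s *\<^sub>R x) $ i + (- s) * y $ i)))"
      by (simp add: g_def right_diff_distrib fun_eq_iff)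
    then show "test_function (\<lambda>y. ?\<rho> (x - y))"
      using test_function_bump[of "- s" c0 "s *\<^sub>R x"] s by simp
  qed
  then show ?thesis by blast
qed

subsection \<open>Convolution\<close>

definition conv :: "('a::euclidean_space \<Rightarrow> real) \<Rightarrow> ('a \<Rightarrow> 'b::euclidean_space) \<Rightarrow> 'a \<Rightarrow> 'b" where
  "conv g f x = (LINT y|lebesgue. g (x - y) *\<^sub>R f y)"

lemma locally_integrable_cball:
  "locally_integrable f \<Longrightarrow> integrable lebesgue (\<lambda>y. indicator (cball 0 C) y *\<^sub>R f y)"
  unfolding locally_integrable_def set_integrable_def using compact_cball by blast

lemma continuous_reflect_measurable:
  fixes g :: "'a::euclidean_space \<Rightarrow> 'b::euclidean_space"
  assumes "continuous_on UNIV g"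
  shows "(\<lambda>y. g (x - y)) \<in> borel_measurable lebesgue"
  by (intro measurable_completion, simp, intro borel_measurable_continuous_onI
      continuous_on_compose2[OF assms] continuous_intros) auto

lemma conv_integrable:
  fixes f :: "'a::euclidean_space \<Rightarrow> 'b::euclidean_space"
  assumes g: "continuous_on UNIV g" and R: "\<And>x. R \<le> norm x \<Longrightarrow> g x = 0"
    and f: "locally_integrable f"
  shows "integrable lebesgue (\<lambda>y. g (x - y) *\<^sub>R f y)"
proof -
  let ?F = "\<lambda>y. indicator (cball 0 (norm x + \<bar>R\<bar>)) y *\<^sub>R f y"
  obtain B where B: "\<And>x. norm (g x) \<le> B" "B > 0"
    using continuous_compact_support(2)[OF g R] by blast
  have F: "integrable lebesgue ?F" by (rule locally_integrable_cball[OF f])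
  have eq: "g (x - y) *\<^sub>R f y = g (x - y) *\<^sub>R ?F y" for y
  proof (cases "norm y \<le> norm x + \<bar>R\<bar>")
    case False
    then have "R \<le> norm (x - y)" using norm_triangle_ineq2[of y x] by (simp add: norm_minus_commute)
    then show ?thesis using R by simp
  qed simp
  have "integrable lebesgue (\<lambda>y. g (x - y) *\<^sub>R ?F y)"
  proof (rule Bochner_Integration.integrable_bound)
    show "integrable lebesgue (\<lambda>y. B * norm (?F y))"
      by (intro integrable_mult_right integrable_norm F)
    show "(\<lambda>y. g (x - y) *\<^sub>R ?F y) \<in> borel_measurable lebesgue"
      by (intro borel_measurable_scaleR continuous_reflect_measurable[OF g] borel_measurable_integrable[OF F])
    have "norm (g (x - y) *\<^sub>R ?F y) \<le> norm (B * norm (?F y))" for y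
    proof -
      have "norm (g (x - y) *\<^sub>R ?F y) = norm (g (x - y)) * norm (?F y)"
        by (simp only: norm_scaleR real_norm_def)
      also have "\<dots> \<le> B * norm (?F y)" by (intro mult_right_mono B) simp
      finally show ?thesis by (simp only: real_norm_def order_trans[OF _ abs_ge_self])
    qed
    then show "AE y in lebesgue. norm (g (x - y) *\<^sub>R ?F y) \<le> norm (B * norm (?F y))" by simp
  qed
  then show ?thesis unfolding eq[symmetric] .
qed

lemma conv_diff:
  assumes g: "continuous_on UNIV g" and R: "\<And>x. R \<le> norm x \<Longrightarrow> g x = 0"
    and f: "locally_integrable f" "locally_integrable h"
  shows "conv g (\<lambda>y. f y - h y) x = conv g f x - conv g h x"
  unfolding conv_def scaleR_diff_right
  by (intro Bochner_Integration.integral_diff conv_integrable[OF g R] f) auto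

lemma bounded_sequence_cball:
  fixes X :: "nat \<Rightarrow> 'a::euclidean_space"
  assumes "X \<longlonglongrightarrow> x"
  shows "\<exists>C. (\<forall>k. norm (X k) \<le> C) \<and> norm x \<le> C"
proof -
  have "bounded (range X)" using assms by (rule convergent_imp_bounded)
  then obtain C where "\<And>k. norm (X k) \<le> C" by (auto simp: bounded_iff)
  then show ?thesis by (intro exI[of _ "max C (norm x)"]) (auto simp: le_max_iff_disj)
qed

lemma conv_continuous:
  fixes f :: "'a::euclidean_space \<Rightarrow> 'b::euclidean_space"
  assumes g: "continuous_on UNIV g" and R: "\<And>x. R \<le> norm x \<Longrightarrow> g x = 0"
    and f: "locally_integrable f"
  shows "continuous_on UNIV (conv g f)"
proof (subst continuous_on_sequentially, intro ballI allI impI)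
  fix x :: 'a and X :: "nat \<Rightarrow> 'a"
  assume "(\<forall>n. X n \<in> UNIV) \<and> X \<longlonglongrightarrow> x"
  then have X: "X \<longlonglongrightarrow> x" by simp
  obtain C where C: "\<And>k. norm (X k) \<le> C" using bounded_sequence_cball[OF X] by metis
  obtain B where B: "\<And>x. norm (g x) \<le> B" "B > 0"
    using continuous_compact_support(2)[OF g R] by blast
  let ?F = "\<lambda>y. indicator (cball 0 (C + \<bar>R\<bar>)) y *\<^sub>R f y"
  have F: "integrable lebesgue ?F" by (rule locally_integrable_cball[OF f])
  have "(\<lambda>k. LINT y|lebesgue. g (X k - y) *\<^sub>R f y) \<longlonglongrightarrow> (LINT y|lebesgue. g (x - y) *\<^sub>R f y)"
  proof (rule integral_dominated_convergence[where w = "\<lambda>y. B * norm (?F y)"])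
    show "(\<lambda>y. g (x - y) *\<^sub>R f y) \<in> borel_measurable lebesgue"
      "(\<lambda>y. g (X k - y) *\<^sub>R f y) \<in> borel_measurable lebesgue" for k
      using conv_integrable[OF g R f] by (auto intro: borel_measurable_integrable)
    show "integrable lebesgue (\<lambda>y. B * norm (?F y))"
      by (intro integrable_mult_right integrable_norm F)
    show "AE y in lebesgue. (\<lambda>k. g (X k - y) *\<^sub>R f y) \<longlonglongrightarrow> g (x - y) *\<^sub>R f y"
      by (intro AE_I2 tendsto_scaleR tendsto_const continuous_on_tendsto_compose[OF g] tendsto_diff X) auto
    fix k
    have "norm (g (X k - y) *\<^sub>R f y) \<le> B * norm (?F y)" for y
    proof (cases "norm y \<le> C + \<bar>R\<bar>")
      case True
      then show ?thesis using B(1)[of "X k - y"] by (simp add: mult_right_mono)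
    next
      case False
      then have "R \<le> norm (X k - y)"
        using norm_triangle_ineq2[of y "X k"] C[of k] by (simp add: norm_minus_commute)
      then show ?thesis using R False by simp
    qed
    then show "AE y in lebesgue. norm (g (X k - y) *\<^sub>R f y) \<le> B * norm (?F y)" by simp
  qed
  then show "(conv g f \<circ> X) \<longlonglongrightarrow> conv g f x"
    by (simp add: conv_def o_def)
qed

lemma C1_remainder:
  assumes \<rho>: "C1 \<rho> D\<rho>" and X: "X \<longlonglongrightarrow> x" "\<And>k. X k \<noteq> x"
  shows "(\<lambda>k. (\<rho> (X k - y) - \<rho> (x - y) - D\<rho> (x - y) \<bullet> (X k - x)) / norm (X k - x)) \<longlonglongrightarrow> 0"
proof -
  have "((\<lambda>z. (\<rho> z - \<rho> (x - y) - D\<rho> (x - y) \<bullet> (z - (x - y))) /\<^sub>R norm (z - (x - y))) \<longlongrightarrow> 0) (at (x - y))"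
    using C1_D(1)[OF \<rho>, of "x - y"] by (simp add: has_derivative_at_within)
  moreover have "filterlim (\<lambda>k. X k - y) (at (x - y)) sequentially"
    unfolding filterlim_at using X by (auto intro!: tendsto_intros)
  ultimately have "(\<lambda>k. (\<rho> (X k - y) - \<rho> (x - y) - D\<rho> (x - y) \<bullet> (X k - y - (x - y))) /\<^sub>R
      norm (X k - y - (x - y))) \<longlonglongrightarrow> 0"
    by (rule filterlim_compose)
  then show ?thesis by (simp add: divide_inverse mult.commute)
qed

text \<open>Difference quotients of \<open>\<rho>\<close> are bounded by its Lipschitz constant and supported in a fixed ball, on
  which \<open>f\<close> is integrable; hence the derivative may be taken under the integral sign.\<close>

lemma conv_C1:
  fixes f :: "real^'n::finite \<Rightarrow> real"
  assumes \<rho>: "C1 \<rho> D\<rho>" and R: "\<And>x. R \<le> norm x \<Longrightarrow> \<rho> x = 0" and f: "locally_integrable f"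
  shows "C1 (conv \<rho> f) (\<lambda>x. \<chi> j. conv (\<lambda>z. D\<rho> z $ j) f x)"
  unfolding C1_def
proof (intro conjI allI)
  define S where "S = \<bar>R\<bar> + 1"
  have S: "\<rho> x = 0" "D\<rho> x = 0" if "S \<le> norm x" for x
    using R C1_gradient_zero[OF \<rho>, where R = R and x = x] that by (auto simp: S_def)
  have cj: "continuous_on UNIV (\<lambda>z. D\<rho> z $ j)" for j
    by (intro continuous_intros C1_D[OF \<rho>])
  have Sj: "D\<rho> x $ j = 0" if "S \<le> norm x" for x j using S that by simp
  show "continuous_on UNIV (\<lambda>x. \<chi> j. conv (\<lambda>z. D\<rho> z $ j) f x)"
    by (intro continuous_on_vec_lambda, rule conv_continuous[OF cj _ f], erule Sj)
  fix x :: "real^'n"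
  let ?D = "\<chi> j. conv (\<lambda>z. D\<rho> z $ j) f x"
  have inner: "?D \<bullet> h = (LINT y|lebesgue. (D\<rho> (x - y) \<bullet> h) * f y)"
    and int_inner: "integrable lebesgue (\<lambda>y. (D\<rho> (x - y) \<bullet> h) * f y)" for h
  proof -
    have i: "integrable lebesgue (\<lambda>y. h $ j * (D\<rho> (x - y) $ j * f y))" for j
    proof -
      have "integrable lebesgue (\<lambda>y. D\<rho> (x - y) $ j *\<^sub>R f y)"
        by (rule conv_integrable[OF cj _ f]) (erule Sj)
      then show ?thesis by (intro integrable_mult_right) simp
    qed
    have eq: "(D\<rho> (x - y) \<bullet> h) * f y = (\<Sum>j\<in>UNIV. h $ j * (D\<rho> (x - y) $ j * f y))" for y
      by (simp add: inner_vec_def sum_distrib_left sum_distrib_right mult_ac)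
    show "integrable lebesgue (\<lambda>y. (D\<rho> (x - y) \<bullet> h) * f y)"
      unfolding eq by (intro Bochner_Integration.integrable_sum i)
    have "?D \<bullet> h = (\<Sum>j\<in>UNIV. h $ j * (LINT y|lebesgue. D\<rho> (x - y) $ j * f y))"
      by (simp add: inner_vec_def conv_def mult.commute)
    also have "\<dots> = (\<Sum>j\<in>UNIV. LINT y|lebesgue. h $ j * (D\<rho> (x - y) $ j * f y))"
      by simp
    also have "\<dots> = (LINT y|lebesgue. (\<Sum>j\<in>UNIV. h $ j * (D\<rho> (x - y) $ j * f y)))"
      by (rule Bochner_Integration.integral_sum[symmetric]) (rule i)
    finally show "?D \<bullet> h = (LINT y|lebesgue. (D\<rho> (x - y) \<bullet> h) * f y)" unfolding eq .
  qed
  have int: "integrable lebesgue (\<lambda>y. \<rho> (z - y) * f y)" for z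
  proof -
    have "integrable lebesgue (\<lambda>y. \<rho> (z - y) *\<^sub>R f y)"
      by (rule conv_integrable[OF C1_D(3)[OF \<rho>] _ f]) (erule S(1))
    then show ?thesis by simp
  qed
  obtain B where B: "\<And>x. norm (D\<rho> x) \<le> B" "B > 0"
    using continuous_compact_support(2)[OF C1_D(2)[OF \<rho>] S(2)] by blast
  show "(conv \<rho> f has_derivative (\<lambda>h. ?D \<bullet> h)) (at x)"
    unfolding has_derivative_at_within
  proof (intro conjI)
    show "bounded_linear (\<lambda>h. ?D \<bullet> h)" by (rule bounded_linear_inner_right)
    show "((\<lambda>z. (conv \<rho> f z - conv \<rho> f x - ?D \<bullet> (z - x)) /\<^sub>R norm (z - x)) \<longlongrightarrow> 0) (at x)"
      unfolding tendsto_at_iff_sequentially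
    proof (intro allI impI)
      fix X assume X1: "\<forall>k. X k \<in> UNIV - {x}" and X: "X \<longlonglongrightarrow> x"
      have X2: "X k \<noteq> x" for k using X1 by auto
      obtain C where C: "\<And>k. norm (X k) \<le> C" "norm x \<le> C" using bounded_sequence_cball[OF X] by metis
      let ?F = "\<lambda>y. indicator (cball 0 (C + S)) y *\<^sub>R f y"
      have F: "integrable lebesgue ?F" by (rule locally_integrable_cball[OF f])
      let ?r = "\<lambda>k y. (\<rho> (X k - y) - \<rho> (x - y) - D\<rho> (x - y) \<bullet> (X k - x)) / norm (X k - x) * f y"
      have ri: "integrable lebesgue (?r k)" for k
      proof -
        have "integrable lebesgue (\<lambda>y. (\<rho> (X k - y) * f y - \<rho> (x - y) * f y
            - (D\<rho> (x - y) \<bullet> (X k - x)) * f y) / norm (X k - x))"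
          by (intro integrable_divide Bochner_Integration.integrable_diff int int_inner)
        then show ?thesis by (simp add: algebra_simps)
      qed
      have "(\<lambda>k. LINT y|lebesgue. ?r k y) \<longlonglongrightarrow> integral\<^sup>L (lebesgue :: (real^'n) measure) (\<lambda>y. 0::real)"
      proof (rule integral_dominated_convergence[where w = "\<lambda>y. 2 * B * norm (?F y)"])
        show "?r k \<in> borel_measurable lebesgue" for k using ri by (rule borel_measurable_integrable)
        show "integrable lebesgue (\<lambda>y. 2 * B * norm (?F y))"
          by (intro integrable_mult_right integrable_norm F)
        show "AE y in lebesgue. (\<lambda>k. ?r k y) \<longlonglongrightarrow> 0"
          by (intro AE_I2 tendsto_mult_left_zero C1_remainder[OF \<rho> X X2])
        fix k
        have "norm (?r k y) \<le> 2 * B * norm (?F y)" for y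
        proof (cases "norm y \<le> C + S")
          case True
          have "\<bar>\<rho> (X k - y) - \<rho> (x - y)\<bar> \<le> B * norm (X k - x)"
            using C1_lipschitz[OF \<rho> B(1), where y = "X k - y" and x = "x - y"] by simp
          moreover have "\<bar>D\<rho> (x - y) \<bullet> (X k - x)\<bar> \<le> B * norm (X k - x)"
            using Cauchy_Schwarz_ineq2[of "D\<rho> (x - y)" "X k - x"] B(1)[of "x - y"]
            by (meson mult_right_mono norm_ge_zero order_trans)
          ultimately have "\<bar>\<rho> (X k - y) - \<rho> (x - y) - D\<rho> (x - y) \<bullet> (X k - x)\<bar> \<le> 2 * B * norm (X k - x)"
            by linarith
          then have "\<bar>\<rho> (X k - y) - \<rho> (x - y) - D\<rho> (x - y) \<bullet> (X k - x)\<bar> / norm (X k - x) \<le> 2 * B"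
            using X2[of k] by (simp add: divide_le_eq)
          then have "\<bar>\<rho> (X k - y) - \<rho> (x - y) - D\<rho> (x - y) \<bullet> (X k - x)\<bar> / norm (X k - x) * \<bar>f y\<bar>
              \<le> 2 * B * \<bar>f y\<bar>"
            by (intro mult_right_mono) auto
          then show ?thesis using True by (simp add: abs_mult)
        next
          case False
          then have "S \<le> norm (X k - y)" "S \<le> norm (x - y)"
            using norm_triangle_ineq2[of y "X k"] norm_triangle_ineq2[of y x] C(1)[of k] C(2)
            by (simp_all add: norm_minus_commute)
          then show ?thesis using S False by simp
        qed
        then show "AE y in lebesgue. norm (?r k y) \<le> 2 * B * norm (?F y)" by simp
      qed simp
      moreover have "(LINT y|lebesgue. ?r k y) = (conv \<rho> f (X k) - conv \<rho> f x - ?D \<bullet> (X k - x)) /\<^sub>R norm (X k - x)" for k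
      proof -
        have "(LINT y|lebesgue. ?r k y) = (LINT y|lebesgue. (\<rho> (X k - y) * f y - \<rho> (x - y) * f y
            - (D\<rho> (x - y) \<bullet> (X k - x)) * f y) / norm (X k - x))"
          by (simp add: algebra_simps)
        also have "\<dots> = (conv \<rho> f (X k) - conv \<rho> f x - ?D \<bullet> (X k - x)) / norm (X k - x)"
          unfolding inner unfolding conv_def using int int_inner by simp
        finally show ?thesis by (simp add: divide_inverse mult.commute)
      qed
      ultimately show "((\<lambda>z. (conv \<rho> f z - conv \<rho> f x - ?D \<bullet> (z - x)) /\<^sub>R norm (z - x)) \<circ> X) \<longlonglongrightarrow> 0"
        by (simp add: o_def)
    qed
  qed
qed

subsection \<open>Mollification in Lebesgue spaces\<close>

lemma AE_not_in_negligible: "negligible N \<Longrightarrow> AE x in lebesgue. x \<notin> N"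
  by (intro AE_not_in) (simp add: negligible_iff_null_sets)

lemma lebesgue_measurable_limit_of_continuous:
  fixes f :: "'a::euclidean_space \<Rightarrow> 'b::euclidean_space"
  assumes "f \<in> borel_measurable lebesgue"
  shows "\<exists>g. (\<forall>n::nat. continuous_on UNIV (g n)) \<and> (AE x in lebesgue. (\<lambda>n. g n x) \<longlonglongrightarrow> f x)"
proof -
  have "f measurable_on UNIV"
    using assms by (intro lebesgue_measurable_imp_measurable_on) auto
  then obtain N g where N: "negligible N" and g: "\<And>n. continuous_on UNIV (g n)"
    "\<And>x. x \<notin> N \<Longrightarrow> (\<lambda>n. g n x) \<longlonglongrightarrow> f x"
    by (auto simp: measurable_on_def)
  have "AE x in lebesgue. (\<lambda>n. g n x) \<longlonglongrightarrow> f x"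
    using AE_not_in_negligible[OF N] by eventually_elim (rule g)
  with g(1) show ?thesis by blast
qed

lemma borel_representative:
  fixes f :: "'a::euclidean_space \<Rightarrow> 'b::euclidean_space"
  assumes "f \<in> borel_measurable lebesgue"
  shows "\<exists>f'\<in>borel_measurable borel. AE x in lebesgue. f x = f' x"
proof -
  obtain g where g: "\<And>n::nat. continuous_on UNIV (g n)" "AE x in lebesgue. (\<lambda>n. g n x) \<longlonglongrightarrow> f x"
    using lebesgue_measurable_limit_of_continuous[OF assms] by blast
  define f' where "f' x = lim (\<lambda>n. g n x)" for x
  have "f' \<in> borel_measurable borel"
    unfolding f'_def by (intro borel_measurable_lim_metric borel_measurable_continuous_onI g)
  moreover have "AE x in lebesgue. f x = f' x"
    using g(2) by eventually_elim (simp add: f'_def limI)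
  ultimately show ?thesis by blast
qed

lemma Lp_norm_tendsto_0:
  fixes h :: "nat \<Rightarrow> 'a::euclidean_space \<Rightarrow> 'b::euclidean_space"
  assumes p: "0 < p" and h: "\<And>k. h k \<in> borel_measurable lebesgue"
    and w: "integrable lebesgue w" "\<And>k. AE x in lebesgue. norm (h k x) powr p \<le> w x"
    and lim: "AE x in lebesgue. (\<lambda>k. h k x) \<longlonglongrightarrow> 0"
  shows "(\<lambda>k. Lp_norm p (h k)) \<longlonglongrightarrow> 0"
proof -
  note [measurable] = h
  have "(\<lambda>k. LINT x|lebesgue. norm (h k x) powr p) \<longlonglongrightarrow> integral\<^sup>L lebesgue (\<lambda>x::'a. 0::real)"
  proof (rule integral_dominated_convergence[OF _ _ w(1)])
    show "AE x in lebesgue. (\<lambda>k. norm (h k x) powr p) \<longlonglongrightarrow> 0"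
      using lim
    proof eventually_elim
      case (elim x)
      have "(\<lambda>k. norm (h k x) powr p) \<longlonglongrightarrow> norm (0::'b) powr p"
        using p by (intro tendsto_powr' tendsto_norm elim tendsto_const) auto
      then show ?case by simp
    qed
  qed (use w(2) in auto)
  then have "(\<lambda>k. (LINT x|lebesgue. norm (h k x) powr p) powr (1 / p)) \<longlonglongrightarrow> 0 powr (1 / p)"
    using p by (intro tendsto_powr' tendsto_const) (auto intro!: always_eventually)
  then show ?thesis by (simp add: Lp_norm_def)
qed

text \<open>First \<open>f\<close> is truncated in its values and in its domain. The truncated function is an almost everywhere
  limit of continuous functions; clipping these to the same bound and multiplying them by a continuous
  cutoff makes dominated convergence applicable.\<close>

lemma Lp_dense_continuous:
  fixes f :: "'a::euclidean_space \<Rightarrow> 'b::euclidean_space"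
  assumes p: "1 \<le> p" and f: "f \<in> Lp_space p" and \<delta>: "\<delta> > 0"
  shows "\<exists>g R. continuous_on UNIV g \<and> (\<forall>x. R \<le> norm x \<longrightarrow> g x = 0) \<and> Lp_norm p (\<lambda>x. f x - g x) < \<delta>"
proof -
  note [measurable] = Lp_space_measurable[OF f]
  have [measurable]: "(\<lambda>x::'a. norm x) \<in> borel_measurable lebesgue"
    by (intro measurable_completion) simp
  define fk where "fk k x = (if norm x \<le> real k \<and> norm (f x) \<le> real k then f x else 0)" for k x
  have fkm[measurable]: "fk k \<in> borel_measurable lebesgue" for k
    unfolding fk_def by measurable
  have "(\<lambda>k. Lp_norm p (\<lambda>x. f x - fk k x)) \<longlonglongrightarrow> 0"
  proof (rule Lp_norm_tendsto_0[OF _ _ Lp_space_integrable[OF f]])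
    show "AE x in lebesgue. norm (f x - fk k x) powr p \<le> norm (f x) powr p" for k
      using p by (intro AE_I2 powr_mono2) (auto simp: fk_def)
    show "AE x in lebesgue. (\<lambda>k. f x - fk k x) \<longlonglongrightarrow> 0"
    proof (intro AE_I2)
      fix x
      obtain k0 where k0: "max (norm x) (norm (f x)) \<le> real k0" using real_arch_simple by blast
      have "\<forall>\<^sub>F k in sequentially. 0 = f x - fk k x"
        using eventually_ge_at_top[of k0]
      proof eventually_elim
        case (elim k)
        then have "norm x \<le> real k" "norm (f x) \<le> real k" using k0 by auto
        then show ?case by (simp add: fk_def)
      qed
      then show "(\<lambda>k. f x - fk k x) \<longlonglongrightarrow> 0" by (rule Lim_transform_eventually[OF tendsto_const])
    qed
  qed (use p in auto)
  then have "\<forall>\<^sub>F k in sequentially. Lp_norm p (\<lambda>x. f x - fk k x) < \<delta> / 2"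
    by (rule order_tendstoD) (use \<delta> in simp)
  then obtain k where k: "Lp_norm p (\<lambda>x. f x - fk k x) < \<delta> / 2"
    using eventually_happens'[OF sequentially_bot] by blast
  (* The summand 1 keeps the radius positive when k = 0. *)
  define K where "K = real k + 1"
  have K: "K > 0" by (simp add: K_def)
  have FK: "norm (fk k x) \<le> K" "K < norm x \<Longrightarrow> fk k x = 0" for x by (auto simp: fk_def K_def)
  obtain g where g: "\<And>n::nat. continuous_on UNIV (g n)" "AE x in lebesgue. (\<lambda>n. g n x) \<longlonglongrightarrow> fk k x"
    using lebesgue_measurable_limit_of_continuous[OF fkm] by blast
  define cut where "cut x = max 0 (min 1 (K + 1 - norm x))" for x :: 'a
  define clip where "clip z = inverse (max 1 (norm z / K)) *\<^sub>R z" for z :: 'b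
  define G where "G n x = cut x *\<^sub>R clip (g n x)" for n x
  have cc: "continuous_on UNIV clip"
    unfolding clip_def by (intro continuous_intros) (auto simp: K_def max_def)
  have cont: "continuous_on UNIV (G n)" for n
    unfolding G_def cut_def
    by (intro continuous_intros continuous_on_compose2[OF cc g(1)]) auto
  have clipK: "norm (clip z) \<le> K" for z
  proof (cases "norm z \<le> K")
    case True
    then have "max 1 (norm z / K) = 1" using K by (auto simp: max_def field_simps)
    then show ?thesis using True by (simp add: clip_def)
  next
    case False
    then have "max 1 (norm z / K) = norm z / K" using K by (auto simp: max_def field_simps)
    moreover have "norm z > 0" using False K by linarith
    ultimately show ?thesis using K by (simp add: clip_def field_simps)
  qed
  have clipid: "clip z = z" if "norm z \<le> K" for z
    using that K by (simp add: clip_def max_def field_simps)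
  have supp: "G n x = 0" if "K + 1 \<le> norm x" for n x using that by (simp add: G_def cut_def)
  have GK: "norm (G n x) \<le> K" for n x
  proof -
    have "norm (G n x) \<le> 1 * norm (clip (g n x))"
      unfolding G_def norm_scaleR by (intro mult_right_mono) (auto simp: cut_def)
    then show ?thesis using clipK[of "g n x"] by simp
  qed
  let ?S = "cball 0 (K + 1) :: 'a set"
  have "(\<lambda>n. Lp_norm p (\<lambda>x. fk k x - G n x)) \<longlonglongrightarrow> 0"
  proof (rule Lp_norm_tendsto_0)
    have [measurable]: "G n \<in> borel_measurable lebesgue" for n
      by (intro measurable_completion) (simp add: borel_measurable_continuous_onI cont)
    show "(\<lambda>x. fk k x - G n x) \<in> borel_measurable lebesgue" for n by measurable
    show "integrable lebesgue (\<lambda>x. (2 * K) powr p * indicator ?S x)"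
      by (intro integrable_mult_right integrable_real_indicator)
         (use lmeasurable_cball[of 0 "K + 1"] in \<open>auto simp: fmeasurable_def\<close>)
    show "AE x in lebesgue. norm (fk k x - G n x) powr p \<le> (2 * K) powr p * indicator ?S x" for n
    proof (intro AE_I2)
      fix x
      show "norm (fk k x - G n x) powr p \<le> (2 * K) powr p * indicator ?S x"
      proof (cases "x \<in> ?S")
        case True
        have "norm (fk k x - G n x) \<le> 2 * K"
          using norm_triangle_ineq4[of "fk k x" "G n x"] FK(1)[of x] GK[of n x] by linarith
        then show ?thesis using True p by (simp add: powr_mono2)
      next
        case False
        then show ?thesis using supp[of x n] FK(2)[of x] by simp
      qed
    qed
    show "AE x in lebesgue. (\<lambda>n. fk k x - G n x) \<longlonglongrightarrow> 0"
      using g(2)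
    proof eventually_elim
      case (elim x)
      have "(\<lambda>n. clip (g n x)) \<longlonglongrightarrow> clip (fk k x)"
        by (rule continuous_on_tendsto_compose[OF cc elim]) auto
      then have "(\<lambda>n. G n x) \<longlonglongrightarrow> cut x *\<^sub>R fk k x"
        unfolding G_def clipid[OF FK(1)] by (intro tendsto_intros)
      moreover have "cut x *\<^sub>R fk k x = fk k x"
        using FK(2)[of x] by (cases "norm x \<le> K") (auto simp: cut_def)
      ultimately have "(\<lambda>n. fk k x - G n x) \<longlonglongrightarrow> fk k x - fk k x" by (intro tendsto_intros) simp
      then show ?case by simp
    qed
  qed (use p in auto)
  then have "\<forall>\<^sub>F n in sequentially. Lp_norm p (\<lambda>x. fk k x - G n x) < \<delta> / 2"
    by (rule order_tendstoD) (use \<delta> in simp)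
  then obtain n where n: "Lp_norm p (\<lambda>x. fk k x - G n x) < \<delta> / 2"
    using eventually_happens'[OF sequentially_bot] by blast
  have "fk k \<in> Lp_space p"
    using p by (intro Lp_mono(1)[OF _ fkm f]) (auto simp: fk_def)
  moreover have "G n \<in> Lp_space p"
    using p by (intro continuous_compact_support_Lp[OF cont, where R = "K + 1"]) (auto simp: supp)
  ultimately have "Lp_norm p (\<lambda>x. f x - G n x) < \<delta>"
    using Lp_dist_triangle[OF p f, of "fk k" "G n"] k n by simp
  with cont supp show ?thesis by blast
qed

lemma integral_reflect:
  fixes g :: "'a::euclidean_space \<Rightarrow> 'b::euclidean_space"
  assumes [measurable]: "g \<in> borel_measurable borel"
  shows "(LINT y|lborel. g (x - y)) = (LINT y|lborel. g y)"
proof -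
  have "(LINT y|lborel. g y) = (LINT y|density (distr lborel borel (\<lambda>z. x + (- 1) *\<^sub>R z)) (\<lambda>_. ennreal (\<bar>- 1\<bar> ^ DIM('a))). g y)"
    using lborel_affine[of "- 1" x] by simp
  also have "\<dots> = (LINT y|lborel. g (x - y))"
    by (subst integral_density) (auto simp: integral_distr)
  finally show ?thesis by simp
qed

lemma conv_Lp:
  fixes f :: "'a::euclidean_space \<Rightarrow> 'b::euclidean_space"
  assumes \<rho>: "continuous_on UNIV \<rho>" "\<And>x. 0 \<le> \<rho> x" "(LINT x|lborel. \<rho> x) = 1"
    and R: "\<And>x. R \<le> norm x \<Longrightarrow> \<rho> x = 0" and p: "1 \<le> p" and f: "f \<in> Lp_space p"
  shows "conv \<rho> f \<in> Lp_space p" "Lp_norm p (conv \<rho> f) \<le> Lp_norm p f"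
proof -
  obtain f' where f'm[measurable]: "f' \<in> borel_measurable borel" and ae: "AE x in lebesgue. f x = f' x"
    using borel_representative[OF Lp_space_measurable[OF f]] by blast
  have f'l: "f' \<in> borel_measurable lebesgue" by (simp add: measurable_completion)
  have f': "f' \<in> Lp_space p"
    by (rule Lp_mono(1)[OF _ f'l f]) (use p ae in auto)
  have nf: "Lp_norm p f' = Lp_norm p f"
    by (rule Lp_norm_cong_AE[OF f'l Lp_space_measurable[OF f]]) (use ae in auto)
  have [measurable]: "\<rho> \<in> borel_measurable borel" using \<rho>(1) by (rule borel_measurable_continuous_onI)
  note li = Lp_locally_integrable[OF p f']
  have conv_eq: "conv \<rho> f x = (LINT y|lborel. \<rho> (x - y) *\<^sub>R f' y)" for x
  proof -
    have "conv \<rho> f x = (LINT y|lebesgue. \<rho> (x - y) *\<^sub>R f' y)"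
      unfolding conv_def
      by (rule integral_cong_AE)
         (use ae in \<open>auto intro!: borel_measurable_scaleR continuous_reflect_measurable[OF \<rho>(1)]
            Lp_space_measurable[OF f] f'l\<close>)
    then show ?thesis by (simp add: integral_completion)
  qed
  have int: "integrable lborel (\<lambda>y. \<rho> (x - y) *\<^sub>R f' y)" for x
  proof -
    have "integrable lebesgue (\<lambda>y. \<rho> (x - y) *\<^sub>R f' y)"
      by (rule conv_integrable[OF \<rho>(1) _ li]) (erule R)
    then show ?thesis by (simp add: integrable_completion)
  qed
  obtain B where B: "\<And>x. norm (\<rho> x) \<le> B" "B > 0"
    using continuous_compact_support(2)[OF \<rho>(1) R] by blast
  have intp: "integrable lborel (\<lambda>y. \<rho> (x - y) * norm (f' y) powr p)" for x
  proof (rule Bochner_Integration.integrable_bound)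
    have "integrable lborel (\<lambda>y. norm (f' y) powr p)"
      using Lp_space_integrable[OF f'] by (simp add: integrable_completion)
    then show "integrable lborel (\<lambda>y. B * norm (f' y) powr p)" by simp
    show "AE y in lborel. norm (\<rho> (x - y) * norm (f' y) powr p) \<le> norm (B * norm (f' y) powr p)"
      using B by (intro AE_I2) (simp add: abs_mult mult_right_mono)
  qed measurable
  have \<rho>int: "integrable lborel \<rho>" by (rule continuous_compact_support(1)[OF \<rho>(1) R])
  have \<rho>refl: "integrable lborel (\<lambda>y. \<rho> (x - y))" "(LINT y|lborel. \<rho> (x - y)) = 1" for x
  proof -
    show "(LINT y|lborel. \<rho> (x - y)) = 1" using integral_reflect[of \<rho> x] \<rho>(3) by simp
    then show "integrable lborel (\<lambda>y. \<rho> (x - y))" using not_integrable_integral_eq by fastforce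
  qed
  (* Jensen's inequality for the probability density \<rho> (x - y), by integrating the tangent
     inequality of t powr p at the mean value. *)
  have jensen: "norm (conv \<rho> f x) powr p \<le> (LINT y|lborel. \<rho> (x - y) * norm (f' y) powr p)" for x
  proof -
    define a where "a = (LINT y|lborel. \<rho> (x - y) * norm (f' y))"
    have ia: "integrable lborel (\<lambda>y. \<rho> (x - y) * norm (f' y))"
      using integrable_norm[OF int[of x]] \<rho>(2) by simp
    have "norm (conv \<rho> f x) \<le> a"
      unfolding conv_eq a_def using integral_norm_bound[of lborel "\<lambda>y. \<rho> (x - y) *\<^sub>R f' y"] \<rho>(2) by simp
    moreover have "a powr p \<le> (LINT y|lborel. \<rho> (x - y) * norm (f' y) powr p)"
    proof (cases "a > 0")
      case True
      let ?d = "p * a powr (p - 1)"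
      have "a powr p = (LINT y|lborel. a powr p * \<rho> (x - y) + (?d * (\<rho> (x - y) * norm (f' y)) - ?d * a * \<rho> (x - y)))"
        using \<rho>refl[of x] ia by (simp add: a_def[symmetric])
      also have "\<dots> \<le> (LINT y|lborel. \<rho> (x - y) * norm (f' y) powr p)"
      proof (rule integral_mono[OF _ intp])
        show "integrable lborel (\<lambda>y. a powr p * \<rho> (x - y) + (?d * (\<rho> (x - y) * norm (f' y)) - ?d * a * \<rho> (x - y)))"
          using \<rho>refl(1)[of x] ia by simp
        fix y
        have "\<rho> (x - y) * (a powr p + ?d * (norm (f' y) - a)) \<le> \<rho> (x - y) * norm (f' y) powr p"
          using \<rho>(2) powr_above_tangent[OF p True, of "norm (f' y)"] by (intro mult_left_mono) auto
        then show "a powr p * \<rho> (x - y) + (?d * (\<rho> (x - y) * norm (f' y)) - ?d * a * \<rho> (x - y))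
            \<le> \<rho> (x - y) * norm (f' y) powr p"
          by (simp add: algebra_simps)
      qed
      finally show ?thesis .
    next
      case False
      moreover have "0 \<le> a" unfolding a_def using \<rho>(2) by simp
      ultimately have "a = 0" by simp
      then show ?thesis using \<rho>(2) by simp
    qed
    ultimately show ?thesis
      using p powr_mono2[of p "norm (conv \<rho> f x)" a] by simp
  qed
  have cont: "continuous_on UNIV (conv \<rho> f)"
    by (rule conv_continuous[OF \<rho>(1) _ Lp_locally_integrable[OF p f]]) (erule R)
  have cm: "conv \<rho> f \<in> borel_measurable borel" using cont by (rule borel_measurable_continuous_onI)
  have m1: "(\<lambda>(x, y). ennreal (\<rho> (x - y) * norm (f' y) powr p)) \<in> borel_measurable (lborel \<Otimes>\<^sub>M lborel)"
    by measurable
  have "(\<integral>\<^sup>+x. ennreal (norm (conv \<rho> f x) powr p) \<partial>lborel)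
      \<le> (\<integral>\<^sup>+x. \<integral>\<^sup>+y. ennreal (\<rho> (x - y) * norm (f' y) powr p) \<partial>lborel \<partial>lborel)"
  proof (intro nn_integral_mono)
    fix x
    have "ennreal (norm (conv \<rho> f x) powr p) \<le> ennreal (LINT y|lborel. \<rho> (x - y) * norm (f' y) powr p)"
      by (intro ennreal_leI jensen)
    also have "\<dots> = (\<integral>\<^sup>+y. ennreal (\<rho> (x - y) * norm (f' y) powr p) \<partial>lborel)"
      using \<rho>(2) by (intro nn_integral_eq_integral[symmetric] intp) auto
    finally show "ennreal (norm (conv \<rho> f x) powr p) \<le> (\<integral>\<^sup>+y. ennreal (\<rho> (x - y) * norm (f' y) powr p) \<partial>lborel)" .
  qed
  also have "\<dots> = (\<integral>\<^sup>+y. \<integral>\<^sup>+x. ennreal (\<rho> (x - y) * norm (f' y) powr p) \<partial>lborel \<partial>lborel)"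
    by (rule lborel_pair.Fubini'[OF m1, symmetric])
  also have "\<dots> = (\<integral>\<^sup>+y. ennreal (norm (f' y) powr p) \<partial>lborel)"
  proof (intro nn_integral_cong)
    fix y
    have tr: "(LINT x|lborel. \<rho> (x - y)) = 1"
      using integral_translate[of \<rho> "- y"] \<rho>(3) by simp
    then have ti: "integrable lborel (\<lambda>x. \<rho> (x - y))" using not_integrable_integral_eq by fastforce
    have "(\<integral>\<^sup>+x. ennreal (\<rho> (x - y) * norm (f' y) powr p) \<partial>lborel)
        = ennreal (LINT x|lborel. \<rho> (x - y) * norm (f' y) powr p)"
      using \<rho>(2) by (intro nn_integral_eq_integral integrable_mult_left ti) auto
    also have "\<dots> = ennreal (norm (f' y) powr p)" using tr by simp
    finally show "(\<integral>\<^sup>+x. ennreal (\<rho> (x - y) * norm (f' y) powr p) \<partial>lborel) = ennreal (norm (f' y) powr p)" .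
  qed
  also have "\<dots> = ennreal (Lp_norm p f powr p)"
  proof -
    have "(\<integral>\<^sup>+y. ennreal (norm (f' y) powr p) \<partial>lborel) = (\<integral>\<^sup>+y. ennreal (norm (f' y) powr p) \<partial>lebesgue)"
      by (simp add: nn_integral_completion)
    also have "\<dots> = ennreal (Lp_norm p f' powr p)"
      using Lp_space_integrable[OF f'] p by (subst nn_integral_eq_integral) (auto simp: Lp_norm_powr)
    finally show ?thesis unfolding nf .
  qed
  finally have *: "(\<integral>\<^sup>+x. ennreal (norm (conv \<rho> f x) powr p) \<partial>lebesgue) \<le> ennreal (Lp_norm p f powr p)"
    by (simp add: nn_integral_completion)
  have cm': "conv \<rho> f \<in> borel_measurable lebesgue" using cm by (simp add: measurable_completion)
  have i: "integrable lebesgue (\<lambda>x. norm (conv \<rho> f x) powr p)"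
    using * cm' by (intro integrableI_bounded) (auto simp: order_le_less_trans)
  then show "conv \<rho> f \<in> Lp_space p" using cm' by (simp add: Lp_space_def)
  show "Lp_norm p (conv \<rho> f) \<le> Lp_norm p f"
    using * i p by (intro Lp_norm_leI) (auto simp: nn_integral_eq_integral)
qed

lemma conv_diff_const:
  fixes g :: "'a::euclidean_space \<Rightarrow> 'b::euclidean_space"
  assumes \<rho>: "continuous_on UNIV \<rho>" "\<And>x. 0 \<le> \<rho> x" "(LINT x|lborel. \<rho> x) = 1"
    and R: "\<And>x. e \<le> norm x \<Longrightarrow> \<rho> x = 0" and g: "continuous_on UNIV g"
    and \<omega>: "\<And>y. norm (y - x) < e \<Longrightarrow> norm (g y - g x) \<le> \<omega>" "0 \<le> \<omega>"
  shows "norm (conv \<rho> g x - g x) \<le> \<omega>"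
proof -
  have [measurable]: "\<rho> \<in> borel_measurable borel" "g \<in> borel_measurable borel"
    using \<rho>(1) g by (auto intro: borel_measurable_continuous_onI)
  have \<rho>r: "(LINT y|lborel. \<rho> (x - y)) = 1" using integral_reflect[of \<rho> x] \<rho>(3) by simp
  then have \<rho>i: "integrable lborel (\<lambda>y. \<rho> (x - y))" using not_integrable_integral_eq by fastforce
  have supp: "\<rho> (x - y) = 0" if "norm x + \<bar>e\<bar> \<le> norm y" for y
    using norm_triangle_ineq2[of y x] that by (intro R) (simp add: norm_minus_commute)
  have gi: "integrable lborel (\<lambda>y. \<rho> (x - y) *\<^sub>R g y)"
    by (rule continuous_compact_support(1)[where R = "norm x + \<bar>e\<bar>"])
       (auto intro!: continuous_intros g continuous_on_compose2[OF \<rho>(1)] simp: supp)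
  have "conv \<rho> g x - g x = (LINT y|lborel. \<rho> (x - y) *\<^sub>R g y) - (LINT y|lborel. \<rho> (x - y)) *\<^sub>R g x"
    unfolding \<rho>r conv_def by (simp add: integral_completion)
  also have "\<dots> = (LINT y|lborel. \<rho> (x - y) *\<^sub>R (g y - g x))"
    using gi \<rho>i by (simp add: scaleR_diff_right)
  finally have "norm (conv \<rho> g x - g x) \<le> (LINT y|lborel. norm (\<rho> (x - y) *\<^sub>R (g y - g x)))"
    by (simp only: integral_norm_bound)
  also have "\<dots> \<le> (LINT y|lborel. \<omega> * \<rho> (x - y))"
  proof (rule integral_mono')
    show "integrable lborel (\<lambda>y. \<omega> * \<rho> (x - y))" using \<rho>i by simp
    fix y
    show "norm (\<rho> (x - y) *\<^sub>R (g y - g x)) \<le> \<omega> * \<rho> (x - y)"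
    proof (cases "norm (y - x) < e")
      case True
      then show ?thesis using \<omega>(1)[OF True] \<rho>(2)[of "x - y"] mult_right_mono[of "norm (g y - g x)" \<omega> "\<rho> (x - y)"]
        by (simp add: mult.commute)
    next
      case False
      then show ?thesis using R[of "x - y"] by (simp add: norm_minus_commute)
    qed
    show "0 \<le> \<omega> * \<rho> (x - y)" using \<omega>(2) \<rho>(2) by simp
  qed
  also have "\<dots> = \<omega>" using \<rho>r by simp
  finally show ?thesis .
qed

lemma mollifierD:
  assumes "mollifier e \<rho> D\<rho>"
  shows "C1 \<rho> D\<rho>" "continuous_on UNIV \<rho>" "0 \<le> \<rho> x" "(LINT x|lborel. \<rho> x) = 1"
    "e \<le> norm x \<Longrightarrow> \<rho> x = 0" "test_function (\<lambda>y. \<rho> (x - y))"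
  using assms C1_D(3)[of \<rho> D\<rho>] by (auto simp: mollifier_def)

text \<open>Convolution with a mollifier does not increase the norm, so \<open>f\<close> may be replaced by a continuous
  function of compact support, for which uniform continuity suffices.\<close>

lemma conv_Lp_close:
  fixes f :: "real^'n::finite \<Rightarrow> 'b::euclidean_space"
  assumes p: "1 \<le> p" and f: "f \<in> Lp_space p" and \<delta>: "\<delta> > 0"
  shows "\<exists>e0>0. \<forall>e \<rho> D\<rho>. 0 < e \<longrightarrow> e \<le> e0 \<longrightarrow> mollifier e \<rho> D\<rho> \<longrightarrow> Lp_norm p (\<lambda>x. conv \<rho> f x - f x) < \<delta>"
proof -
  obtain g R where g: "continuous_on UNIV g" and R: "\<And>x. R \<le> norm x \<Longrightarrow> g x = 0"
    and fg: "Lp_norm p (\<lambda>x. f x - g x) < \<delta> / 3"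
    using Lp_dense_continuous[OF p f, of "\<delta> / 3"] \<delta> by auto
  have gL: "g \<in> Lp_space p"
    using p by (intro continuous_compact_support_Lp[OF g, where R = R] R) auto
  let ?S = "cball 0 (\<bar>R\<bar> + 1) :: (real^'n) set"
  let ?V = "measure lebesgue ?S"
  define \<omega> where "\<omega> = (\<delta> / 4) / (?V + 1) powr (1 / p)"
  have V: "?V + 1 > 0" by (simp add: add_nonneg_pos)
  have \<omega>: "\<omega> > 0" using \<delta> V by (simp add: \<omega>_def)
  have "uniformly_continuous_on (cball 0 (\<bar>R\<bar> + 2)) g"
    by (intro compact_uniformly_continuous compact_cball continuous_on_subset[OF g]) auto
  then obtain d where d: "d > 0" "\<And>x y. x \<in> cball 0 (\<bar>R\<bar> + 2) \<Longrightarrow> y \<in> cball 0 (\<bar>R\<bar> + 2) \<Longrightarrow>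
      dist y x < d \<Longrightarrow> dist (g y) (g x) < \<omega>"
    unfolding uniformly_continuous_on_def using \<omega> by metis
  have "Lp_norm p (\<lambda>x. conv \<rho> f x - f x) < \<delta>"
    if e: "0 < e" "e \<le> min d 1" and m: "mollifier e \<rho> D\<rho>" for e \<rho> D\<rho>
  proof -
    note M = mollifierD[OF m]
    have conv_L: "conv \<rho> h \<in> Lp_space p" "Lp_norm p (conv \<rho> h) \<le> Lp_norm p h"
      if "h \<in> Lp_space p" for h :: "real^'n \<Rightarrow> 'b"
      by (rule conv_Lp[OF M(2,3,4) _ p that], erule M(5))+
    have pt: "norm (conv \<rho> g x - g x) \<le> \<omega> * indicator ?S x" for x
    proof (cases "x \<in> ?S")
      case True
      have "norm (conv \<rho> g x - g x) \<le> \<omega>"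
      proof (rule conv_diff_const[OF M(2,3,4) _ g])
        fix y assume y: "norm (y - x) < e"
        then have "norm y \<le> \<bar>R\<bar> + 2"
          using norm_triangle_ineq2[of y x] True e by simp
        then show "norm (g y - g x) \<le> \<omega>"
          using d(2)[of x y] y e True by (simp add: dist_norm)
      qed (use \<omega> M(5) in auto)
      then show ?thesis using True by simp
    next
      case False
      have "norm (conv \<rho> g x - g x) \<le> 0"
      proof (rule conv_diff_const[OF M(2,3,4) _ g])
        fix y assume y: "norm (y - x) < e"
        then have "R \<le> norm y" "R \<le> norm x"
          using norm_triangle_ineq2[of x y] False e by (auto simp: norm_minus_commute)
        then show "norm (g y - g x) \<le> 0" using R by simp
      qed (use M(5) in auto)
      then show ?thesis using False by simp
    qed
    have "Lp_norm p (\<lambda>x. conv \<rho> g x - g x) \<le> \<delta> / 4"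
    proof (rule Lp_norm_leI)
      have "(LINT x|lebesgue. norm (conv \<rho> g x - g x) powr p) \<le> (LINT x|lebesgue. \<omega> powr p * indicator ?S x)"
      proof (rule integral_mono')
        show "integrable lebesgue (\<lambda>x. \<omega> powr p * indicator ?S x)"
          by (intro integrable_mult_right integrable_real_indicator)
             (use lmeasurable_cball[of 0 "\<bar>R\<bar> + 1"] in \<open>auto simp: fmeasurable_def\<close>)
        fix x
        have "norm (conv \<rho> g x - g x) powr p \<le> (\<omega> * indicator ?S x) powr p"
          using p pt by (intro powr_mono2) auto
        then show "norm (conv \<rho> g x - g x) powr p \<le> \<omega> powr p * indicator ?S x"
          using p by (cases "x \<in> ?S") auto
      qed auto
      also have "\<dots> = \<omega> powr p * ?V" by simp
      also have "\<dots> \<le> \<omega> powr p * (?V + 1)" by (intro mult_left_mono) auto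
      also have "\<dots> = (\<omega> * (?V + 1) powr (1 / p)) powr p"
        using p V \<omega> by (simp add: powr_mult powr_powr)
      also have "\<omega> * (?V + 1) powr (1 / p) = \<delta> / 4" using V by (simp add: \<omega>_def)
      finally show "(LINT x|lebesgue. norm (conv \<rho> g x - g x) powr p) \<le> (\<delta> / 4) powr p" .
    qed (use p \<delta> in auto)
    moreover have "Lp_norm p (\<lambda>x. conv \<rho> f x - conv \<rho> g x) \<le> Lp_norm p (\<lambda>x. f x - g x)"
    proof -
      have "conv \<rho> f x - conv \<rho> g x = conv \<rho> (\<lambda>x. f x - g x) x" for x
        by (rule conv_diff[OF M(2) _ Lp_locally_integrable[OF p f] Lp_locally_integrable[OF p gL], symmetric])
           (erule M(5))
      then show ?thesis using conv_L(2)[OF Lp_diff(1)[OF p f gL]] by simp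
    qed
    moreover have "Lp_norm p (\<lambda>x. conv \<rho> f x - f x) \<le> Lp_norm p (\<lambda>x. conv \<rho> f x - conv \<rho> g x)
        + (Lp_norm p (\<lambda>x. conv \<rho> g x - g x) + Lp_norm p (\<lambda>x. g x - f x))"
      using Lp_dist_triangle[OF p conv_L(1)[OF f] conv_L(1)[OF gL] f]
        Lp_dist_triangle[OF p conv_L(1)[OF gL] gL f] by linarith
    ultimately show ?thesis
      using fg Lp_norm_minus_commute[OF p f gL] \<delta> by linarith
  qed
  then show ?thesis using d(1) by (intro exI[of _ "min d 1"]) auto
qed

subsection \<open>Cutting off\<close>

lemma positive_part_sq_derivative:
  "((\<lambda>t::real. (max 0 t)\<^sup>2) has_real_derivative 2 * max 0 t) (at t)"
proof -
  consider "t > 0" | "t < 0" | "t = 0" by linarith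
  then show ?thesis
  proof cases
    case 1
    have "((\<lambda>t. t\<^sup>2) has_real_derivative 2 * max 0 t) (at t)"
      using 1 by (auto intro!: derivative_eq_intros)
    then show ?thesis
      by (rule has_field_derivative_transform_within_open[where S = "{0<..}"]) (use 1 in auto)
  next
    case 2
    have "((\<lambda>t. 0) has_real_derivative 2 * max 0 t) (at t)"
      using 2 by simp
    then show ?thesis
      by (rule has_field_derivative_transform_within_open[where S = "{..<0}"]) (use 2 in auto)
  next
    case 3
    have "((\<lambda>h::real. ((max 0 (0 + h))\<^sup>2 - (max 0 0)\<^sup>2) / h) \<longlongrightarrow> 0) (at 0)"
    proof (rule Lim_null_comparison)
      show "\<forall>\<^sub>F h in at (0::real). norm (((max 0 (0 + h))\<^sup>2 - (max 0 0)\<^sup>2) / h) \<le> norm h"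
        by (intro always_eventually allI) (auto simp: max_def power2_eq_square)
      show "((\<lambda>h::real. norm h) \<longlongrightarrow> 0) (at 0)" by (intro tendsto_norm_zero tendsto_ident_at)
    qed
    then show ?thesis using 3 by (simp add: DERIV_def)
  qed
qed

text \<open>With \<open>q t = (max 0 t)\<^sup>2\<close>, the profile \<open>q (1 - q (t - 1))\<close> is continuously differentiable, equal to
  \<open>1\<close> for \<open>t \<le> 1\<close> and to \<open>0\<close> for \<open>t \<ge> 2\<close>; it is evaluated at \<open>(norm x)\<^sup>2 / R\<^sup>2\<close>.\<close>

lemma cutoff_exists:
  assumes R: "R > 0"
  shows "\<exists>\<theta> D\<theta> :: 'a::euclidean_space \<Rightarrow> 'a. C1 \<theta> D\<theta> \<and> (\<forall>x. 0 \<le> \<theta> x \<and> \<theta> x \<le> 1) \<and>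
    (\<forall>x. norm x \<le> R \<longrightarrow> \<theta> x = 1 \<and> D\<theta> x = 0) \<and> (\<forall>x. 2 * R \<le> norm x \<longrightarrow> \<theta> x = 0 \<and> D\<theta> x = 0) \<and>
    (\<forall>x. norm (D\<theta> x) \<le> 16 / R)"
proof -
  let ?q = "\<lambda>t::real. (max 0 t)\<^sup>2"
  define c where "c t = ?q (1 - ?q (t - 1))" for t
  define c' where "c' t = 2 * max 0 (1 - ?q (t - 1)) * (- (2 * max 0 (t - 1)))" for t :: real
  have dc: "(c has_real_derivative c' t) (at t)" for t
  proof -
    have "((\<lambda>t. ?q (t - 1)) has_real_derivative 2 * max 0 (t - 1) * 1) (at t)"
      by (rule DERIV_chain2[OF positive_part_sq_derivative]) (auto intro!: derivative_eq_intros)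
    from DERIV_diff[OF DERIV_const[of 1] this]
    have "((\<lambda>t. 1 - ?q (t - 1)) has_real_derivative - (2 * max 0 (t - 1))) (at t)" by simp
    from DERIV_chain2[OF positive_part_sq_derivative this]
    show ?thesis unfolding c_def c'_def .
  qed
  have c01: "0 \<le> c t" "c t \<le> 1" for t
  proof -
    have "max 0 (1 - ?q (t - 1)) \<le> 1" by simp
    then show "c t \<le> 1" unfolding c_def by (intro power_le_one) auto
  qed (simp add: c_def)
  have c1: "c t = 1" "c' t = 0" if "t \<le> 1" for t using that by (simp_all add: c_def c'_def)
  have c2: "c t = 0" "c' t = 0" if "t \<ge> 2" for t
  proof -
    have "1 \<le> (t - 1)\<^sup>2" using that by (intro one_le_power) auto
    then have "max 0 (1 - ?q (t - 1)) = 0" using that by (simp add: max_absorb2 max_absorb1)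
    then show "c t = 0" "c' t = 0" by (simp_all only: c_def c'_def) simp_all
  qed
  have c4: "\<bar>c' t\<bar> \<le> 4" for t
  proof (cases "t < 2")
    case True
    have "max 0 (1 - ?q (t - 1)) \<le> 1" "max 0 (t - 1) \<le> 1" using True by auto
    then have "max 0 (1 - ?q (t - 1)) * max 0 (t - 1) \<le> 1 * 1" by (intro mult_mono) auto
    then show ?thesis by (simp add: c'_def abs_mult)
  qed (simp add: c2)
  define \<theta> where "\<theta> x = c ((norm x)\<^sup>2 / R\<^sup>2)" for x :: 'a
  define D\<theta> where "D\<theta> x = (c' ((norm x)\<^sup>2 / R\<^sup>2) * (2 / R\<^sup>2)) *\<^sub>R x" for x :: 'a
  have "C1 \<theta> D\<theta>"
    unfolding C1_def
  proof (intro conjI allI)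
    fix x :: 'a
    have "((\<lambda>x. x \<bullet> x) has_derivative (\<lambda>h. 2 * (x \<bullet> h))) (at x)"
      by (auto intro!: derivative_eq_intros simp: inner_commute)
    from bounded_linear.has_derivative[OF bounded_linear_divide[of "R\<^sup>2"] this]
    have "((\<lambda>x. (norm x)\<^sup>2 / R\<^sup>2) has_derivative (\<lambda>h. 2 * (x \<bullet> h) / R\<^sup>2)) (at x)"
      unfolding power2_norm_eq_inner .
    from has_derivative_compose[OF this dc[of "(norm x)\<^sup>2 / R\<^sup>2", unfolded has_field_derivative_def]]
    show "(\<theta> has_derivative (\<lambda>h. D\<theta> x \<bullet> h)) (at x)"
      unfolding \<theta>_def D\<theta>_def by (simp add: mult.assoc)
  next
    have cc: "continuous_on UNIV c'" unfolding c'_def by (intro continuous_intros)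
    have "continuous_on UNIV (\<lambda>x::'a. c' ((norm x)\<^sup>2 / R\<^sup>2))"
      by (rule continuous_on_compose2[OF cc]) (use R in \<open>auto intro!: continuous_intros\<close>)
    then show "continuous_on UNIV D\<theta>"
      unfolding D\<theta>_def by (intro continuous_intros)
  qed
  moreover have "norm (D\<theta> x) \<le> 16 / R" for x
  proof (cases "norm x \<le> 2 * R")
    case True
    have "norm (D\<theta> x) = \<bar>c' ((norm x)\<^sup>2 / R\<^sup>2)\<bar> * (2 / R\<^sup>2 * norm x)"
      using R by (simp add: D\<theta>_def abs_mult)
    also have "\<dots> \<le> 4 * (2 / R\<^sup>2 * (2 * R))"
      using True R by (intro mult_mono c4 mult_left_mono) auto
    also have "\<dots> = 16 / R" using R by (simp add: power2_eq_square)
    finally show ?thesis .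
  next
    case False
    then have "(2 * R)\<^sup>2 \<le> (norm x)\<^sup>2" using R by (intro power_mono) auto
    then have "2 * R\<^sup>2 \<le> (norm x)\<^sup>2" using zero_le_power2[of R]
      unfolding power_mult_distrib power2_eq_square[of "2::real"] by linarith
    then have "2 \<le> (norm x)\<^sup>2 / R\<^sup>2" using R by (simp add: pos_le_divide_eq)
    then show ?thesis using R by (simp add: D\<theta>_def c2)
  qed
  moreover have "\<theta> x = 1 \<and> D\<theta> x = 0" if "norm x \<le> R" for x
  proof -
    have "(norm x)\<^sup>2 \<le> R\<^sup>2" using that by (intro power_mono) auto
    then have "(norm x)\<^sup>2 / R\<^sup>2 \<le> 1" using R by simp
    then show ?thesis by (simp add: \<theta>_def D\<theta>_def c1)
  qed
  moreover have "\<theta> x = 0 \<and> D\<theta> x = 0" if "2 * R \<le> norm x" for x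
  proof -
    have "(2 * R)\<^sup>2 \<le> (norm x)\<^sup>2" using that R by (intro power_mono) auto
    then have "2 * R\<^sup>2 \<le> (norm x)\<^sup>2" using zero_le_power2[of R]
      unfolding power_mult_distrib power2_eq_square[of "2::real"] by linarith
    then have "2 \<le> (norm x)\<^sup>2 / R\<^sup>2" using R by (simp add: pos_le_divide_eq)
    then show ?thesis by (simp add: \<theta>_def D\<theta>_def c2)
  qed
  ultimately show ?thesis
    using c01 by (intro exI[of _ \<theta>] exI[of _ D\<theta>]) (auto simp: \<theta>_def)
qed

section \<open>The homogeneous Sobolev space as a closure\<close>

lemma Lp_tail:
  fixes f :: "'a::euclidean_space \<Rightarrow> 'b::euclidean_space"
  assumes p: "0 < p" and f: "f \<in> Lp_space p"
  shows "(\<lambda>x. indicator {x. r \<le> norm x} x *\<^sub>R f x) \<in> Lp_space p"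
    and "(\<lambda>k. Lp_norm p (\<lambda>x. indicator {x. real k \<le> norm x} x *\<^sub>R f x)) \<longlonglongrightarrow> 0"
proof -
  note [measurable] = Lp_space_measurable[OF f]
  have "{x::'a. r \<le> norm x} \<in> sets borel" for r
    by (intro borel_closed closed_Collect_le continuous_intros)
  then have [measurable]: "{x::'a. r \<le> norm x} \<in> sets lebesgue" for r
    by (intro sets_completionI_sets) simp
  show "(\<lambda>x. indicator {x. r \<le> norm x} x *\<^sub>R f x) \<in> Lp_space p"
  proof (rule Lp_mono(1)[OF p _ f])
    show "(\<lambda>x. indicator {x. r \<le> norm x} x *\<^sub>R f x) \<in> borel_measurable lebesgue" by measurable
  qed (auto simp: indicator_def)
  show "(\<lambda>k. Lp_norm p (\<lambda>x. indicator {x. real k \<le> norm x} x *\<^sub>R f x)) \<longlonglongrightarrow> 0"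
  proof (rule Lp_norm_tendsto_0[OF p _ Lp_space_integrable[OF f]])
    show "AE x in lebesgue. norm (indicator {x. real k \<le> norm x} x *\<^sub>R f x) powr p \<le> norm (f x) powr p" for k
      using p by (intro AE_I2) (auto simp: indicator_def)
    show "AE x in lebesgue. (\<lambda>k. indicator {x. real k \<le> norm x} x *\<^sub>R f x) \<longlonglongrightarrow> 0"
    proof (intro AE_I2)
      fix x :: 'a
      obtain k0 where k0: "norm x < real k0" using reals_Archimedean2 by blast
      have "\<forall>\<^sub>F k in sequentially. 0 = indicator {x. real k \<le> norm x} x *\<^sub>R f x"
        using eventually_ge_at_top[of k0]
      proof eventually_elim
        case (elim k)
        then have "\<not> real k \<le> norm x" using k0 by linarith
        then show ?case by simp
      qed
      then show "(\<lambda>k. indicator {x. real k \<le> norm x} x *\<^sub>R f x) \<longlonglongrightarrow> 0"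
        by (rule Lim_transform_eventually[OF tendsto_const])
    qed
  qed measurable
qed

lemma C1c_cutoff:
  fixes w :: "real^'n::finite \<Rightarrow> real^'m::finite"
  assumes w: "\<And>\<alpha>. C1 (\<lambda>x. w x $ \<alpha>) (\<lambda>x. Dw x $ \<alpha>)" and \<theta>: "C1 \<theta> D\<theta>"
    and S: "\<And>x. S \<le> norm x \<Longrightarrow> \<theta> x = 0"
  shows "C1c (\<lambda>x. \<theta> x *\<^sub>R w x) (\<lambda>x. \<theta> x *\<^sub>R Dw x + w x \<otimes>\<^sub>v D\<theta> x)"
proof -
  have t: "(w x \<otimes>\<^sub>v D\<theta> x) $ \<alpha> = w x $ \<alpha> *\<^sub>R D\<theta> x" for x \<alpha>
    by (simp add: tensor_def vec_eq_iff)
  have "C1 (\<lambda>x. (\<theta> x *\<^sub>R w x) $ \<alpha>) (\<lambda>x. (\<theta> x *\<^sub>R Dw x + w x \<otimes>\<^sub>v D\<theta> x) $ \<alpha>)" for \<alpha>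
    using C1_mult[OF \<theta> w[of \<alpha>]] by (simp add: t)
  moreover have "\<forall>x. S \<le> norm x \<longrightarrow> \<theta> x *\<^sub>R w x = 0" using S by simp
  ultimately show ?thesis unfolding C1c_def by blast
qed

text \<open>The error of a cutoff at radius \<open>R\<close> is \<open>w \<otimes>\<^sub>v D\<theta>\<close>, of size \<open>\<bar>w\<bar> / R\<close> on a shell. Since
  \<open>(1 / R)\<^sup>n\<close> times the volume of the shell stays bounded, the pointwise estimate by \<open>d / R\<^sup>n\<close> plus a
  multiple of the critical power of \<open>w\<close> makes it small for large \<open>R\<close>. For the exponent \<open>2n/(n-2)\<close>
  the powers of \<open>R\<close> in the second term cancel.\<close>

lemma cutoff_error_bound:
  fixes w :: "real^'n::finite \<Rightarrow> real^'m::finite" and D\<theta> :: "real^'n \<Rightarrow> real^'n"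
  assumes n: "CARD('n) \<ge> 3" and R: "R > 0" and d: "d > 0"
    and wm: "w \<in> borel_measurable borel" and w: "w \<in> Lp_space (sobolev_exponent CARD('n))"
    and \<theta>m: "D\<theta> \<in> borel_measurable borel"
    and \<theta>: "\<And>x. norm x \<le> R \<Longrightarrow> D\<theta> x = 0" "\<And>x. 2 * R \<le> norm x \<Longrightarrow> D\<theta> x = 0" "\<And>x. norm (D\<theta> x) \<le> 16 / R"
  defines "q \<equiv> sobolev_exponent CARD('n)"
  shows "(\<lambda>x. w x \<otimes>\<^sub>v D\<theta> x) \<in> Lp_space 2"
    and "(Lp_norm 2 (\<lambda>x. w x \<otimes>\<^sub>v D\<theta> x))\<^sup>2 \<le> 256 * (d * (unit_ball_vol (real CARD('n)) * 2 ^ CARD('n))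
      + d powr (1 - q / 2) * Lp_norm q (\<lambda>x. indicator {x. R \<le> norm x} x *\<^sub>R w x) powr q)"
proof -
  let ?n = "real CARD('n)"
  let ?T = "\<lambda>x. indicator {x. R \<le> norm x} x *\<^sub>R w x"
  have n3: "?n \<ge> 3" using n by linarith
  have q: "q > 0" "q / 2 \<ge> 1" using n3 by (simp_all add: q_def sobolev_exponent_def field_simps)
  have qn: "- ?n * (1 - q / 2) - 2 * (q / 2) = 0"
  proof -
    have "- r * (1 - (2 * r / (r - 2)) / 2) - 2 * ((2 * r / (r - 2)) / 2) = 0" if "r \<ge> 3" for r :: real
      using that by (simp add: divide_simps)
    from this[OF n3] show ?thesis by (simp add: q_def sobolev_exponent_def)
  qed
  have T: "?T \<in> Lp_space q" using Lp_tail(1)[OF q(1)] w by (simp add: q_def)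
  let ?S = "cball 0 (2 * R) :: (real^'n) set"
  let ?b = "\<lambda>x. 256 * (d * R powr (- ?n) * indicator ?S x + d powr (1 - q / 2) * norm (?T x) powr q)"
  have pt: "(norm (w x \<otimes>\<^sub>v D\<theta> x))\<^sup>2 \<le> ?b x" for x
  proof (cases "R \<le> norm x \<and> norm x \<le> 2 * R")
    case True
    let ?a = "(norm (w x))\<^sup>2 * R powr (-2)"
    have "norm (w x \<otimes>\<^sub>v D\<theta> x) \<le> norm (w x) * (16 / R)"
      unfolding norm_tensor by (intro mult_left_mono \<theta>) auto
    then have "(norm (w x \<otimes>\<^sub>v D\<theta> x))\<^sup>2 \<le> (norm (w x) * (16 / R))\<^sup>2" by (intro power_mono) auto
    also have "\<dots> = 256 * ?a"
      using R by (simp add: powr_minus powr_numeral power_mult_distrib power_divide divide_inverse power_inverse)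
    also have "\<dots> \<le> 256 * (d * R powr (- ?n) + (d * R powr (- ?n)) powr (1 - q / 2) * ?a powr (q / 2))"
      using q d R by (intro mult_left_mono le_add_powr) auto
    also have "(d * R powr (- ?n)) powr (1 - q / 2) * ?a powr (q / 2)
        = d powr (1 - q / 2) * norm (w x) powr q * (R powr (- ?n * (1 - q / 2)) * R powr (-2 * (q / 2)))"
    proof -
      have "((norm (w x))\<^sup>2) powr (q / 2) = norm (w x) powr q"
        using powr_powr[of "norm (w x)" 2 "q / 2"] by (simp add: powr_numeral)
      then show ?thesis using d R by (simp add: powr_mult powr_powr mult_ac)
    qed
    also have "R powr (- ?n * (1 - q / 2)) * R powr (-2 * (q / 2)) = 1"
      unfolding powr_add[symmetric] using qn R by simp
    finally show ?thesis using True by simp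
  next
    case False
    then have "D\<theta> x = 0" using \<theta>(1)[of x] \<theta>(2)[of x] by linarith
    then have "(norm (w x \<otimes>\<^sub>v D\<theta> x))\<^sup>2 = 0" by (simp add: norm_tensor)
    also have "0 \<le> ?b x" using d by simp
    finally show ?thesis .
  qed
  have Sm: "?S \<in> lmeasurable" by (rule lmeasurable_cball)
  have iS: "integrable lebesgue (indicator ?S :: _ \<Rightarrow> real)"
    using Sm by (intro integrable_real_indicator) (auto simp: fmeasurable_def)
  have ib: "integrable lebesgue ?b"
    using Lp_space_integrable[OF T] iS by (intro integrable_mult_right Bochner_Integration.integrable_add) auto
  have m: "(\<lambda>x. w x \<otimes>\<^sub>v D\<theta> x) \<in> borel_measurable lebesgue"
  proof -
    have "continuous_on UNIV (\<lambda>p::(real^'m) \<times> (real^'n). fst p \<otimes>\<^sub>v snd p)"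
      unfolding tensor_def by (intro continuous_intros)
    from borel_measurable_continuous_on[OF this borel_measurable_Pair[OF wm \<theta>m]]
    have "(\<lambda>x. w x \<otimes>\<^sub>v D\<theta> x) \<in> borel_measurable borel" by simp
    then show ?thesis by (simp add: measurable_completion)
  qed
  have i: "integrable lebesgue (\<lambda>x. (norm (w x \<otimes>\<^sub>v D\<theta> x))\<^sup>2)"
  proof (rule Bochner_Integration.integrable_bound[OF ib])
    show "(\<lambda>x. (norm (w x \<otimes>\<^sub>v D\<theta> x))\<^sup>2) \<in> borel_measurable lebesgue" using m by measurable
    have "norm ((norm (w x \<otimes>\<^sub>v D\<theta> x))\<^sup>2) \<le> norm (?b x)" for x
    proof -
      have "norm ((norm (w x \<otimes>\<^sub>v D\<theta> x))\<^sup>2) = (norm (w x \<otimes>\<^sub>v D\<theta> x))\<^sup>2" by simp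
      also have "\<dots> \<le> ?b x" by (rule pt)
      also have "\<dots> \<le> norm (?b x)" by (simp only: real_norm_def abs_ge_self)
      finally show ?thesis .
    qed
    then show "AE x in lebesgue. norm ((norm (w x \<otimes>\<^sub>v D\<theta> x))\<^sup>2) \<le> norm (?b x)" by simp
  qed
  then show "(\<lambda>x. w x \<otimes>\<^sub>v D\<theta> x) \<in> Lp_space 2"
    using m by (simp add: Lp_space_def powr_numeral)
  have "(Lp_norm 2 (\<lambda>x. w x \<otimes>\<^sub>v D\<theta> x))\<^sup>2 \<le> (LINT x|lebesgue. ?b x)"
    unfolding L2_norm_sq by (intro integral_mono i ib pt)
  also have "\<dots> = 256 * (d * R powr (- ?n) * measure lebesgue ?S + d powr (1 - q / 2) * Lp_norm q ?T powr q)"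
    using Lp_space_integrable[OF T] iS q(1)
    by (simp add: Lp_norm_powr del: norm_scaleR)
  also have "d * R powr (- ?n) * measure lebesgue ?S = d * (unit_ball_vol ?n * 2 ^ CARD('n))"
  proof -
    have "measure lebesgue ?S = unit_ball_vol ?n * (2 * R) ^ CARD('n)"
      using R by (simp add: content_cball)
    also have "\<dots> = unit_ball_vol ?n * 2 ^ CARD('n) * R powr ?n"
      using R by (simp add: power_mult_distrib powr_realpow)
    finally show ?thesis using R by (simp add: powr_minus)
  qed
  finally show "(Lp_norm 2 (\<lambda>x. w x \<otimes>\<^sub>v D\<theta> x))\<^sup>2 \<le> 256 * (d * (unit_ball_vol ?n * 2 ^ CARD('n))
      + d powr (1 - q / 2) * Lp_norm q ?T powr q)" .
qed

lemma cutoff_approximation: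
  fixes w :: "real^'n::finite \<Rightarrow> real^'m::finite"
  assumes n: "CARD('n) \<ge> 3" and w: "\<And>\<alpha>. C1 (\<lambda>x. w x $ \<alpha>) (\<lambda>x. Dw x $ \<alpha>)"
    and wm: "w \<in> borel_measurable borel"
    and wL: "w \<in> Lp_space (sobolev_exponent CARD('n))" and DL: "Dw \<in> Lp_space 2" and \<delta>: "\<delta> > 0"
  shows "\<exists>v Dv. C1c v Dv \<and> Lp_norm (sobolev_exponent CARD('n)) (\<lambda>x. v x - w x) < \<delta> \<and>
    Lp_norm 2 (\<lambda>x. Dv x - Dw x) < \<delta>"
proof -
  let ?q = "sobolev_exponent CARD('n)"
  have q: "?q > 0" "?q \<ge> 1" using n by (simp_all add: sobolev_exponent_def field_simps)
  define K where "K = unit_ball_vol (real CARD('n)) * 2 ^ CARD('n)"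
  have K: "K \<ge> 0" by (simp add: K_def)
  (* With this d the first error term is at most \<delta>^2 / 16 for every radius; the radius is then chosen
     large enough for the tail terms. *)
  define d where "d = \<delta>\<^sup>2 / (4096 * (K + 1))"
  have d: "d > 0" using \<delta> K by (simp add: d_def)
  have dK: "256 * (d * K) \<le> \<delta>\<^sup>2 / 16"
  proof -
    have "256 * (d * K) \<le> 256 * (d * (K + 1))" using d by simp
    also have "\<dots> = \<delta>\<^sup>2 / 16" using K by (simp add: d_def divide_simps)
    finally show ?thesis .
  qed
  define T where "T k = Lp_norm ?q (\<lambda>x. indicator {x. real k \<le> norm x} x *\<^sub>R w x)" for k
  define T' where "T' k = Lp_norm 2 (\<lambda>x. indicator {x. real k \<le> norm x} x *\<^sub>R Dw x)" for k
  have T: "T \<longlonglongrightarrow> 0" unfolding T_def[abs_def] by (rule Lp_tail(2)[OF q(1) wL])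
  have T': "T' \<longlonglongrightarrow> 0" unfolding T'_def[abs_def] by (rule Lp_tail(2)[OF _ DL]) simp
  have "(\<lambda>k. 256 * (d powr (1 - ?q / 2) * T k powr ?q)) \<longlonglongrightarrow> 256 * (d powr (1 - ?q / 2) * 0 powr ?q)"
    using q by (intro tendsto_intros tendsto_powr' T) (auto simp: T_def intro!: always_eventually)
  then have "\<forall>\<^sub>F k in sequentially. 256 * (d powr (1 - ?q / 2) * T k powr ?q) < \<delta>\<^sup>2 / 16"
    by (rule order_tendstoD) (use \<delta> in simp)
  then have "\<forall>\<^sub>F k in sequentially. 256 * (d powr (1 - ?q / 2) * T k powr ?q) < \<delta>\<^sup>2 / 16
      \<and> T k < \<delta> \<and> T' k < \<delta> / 2 \<and> k \<ge> 1"
    using order_tendstoD(2)[OF T \<delta>] order_tendstoD(2)[OF T', of "\<delta> / 2"] \<delta> eventually_ge_at_top[of 1]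
    by (auto simp: eventually_conj_iff)
  then obtain k where k: "256 * (d powr (1 - ?q / 2) * T k powr ?q) < \<delta>\<^sup>2 / 16" "T k < \<delta>" "T' k < \<delta> / 2" "k \<ge> 1"
    using eventually_happens'[OF sequentially_bot] by blast
  have R: "real k > 0" using k(4) by simp
  obtain \<theta> D\<theta> where C\<theta>: "C1 \<theta> (D\<theta> :: real^'n \<Rightarrow> real^'n)" and \<theta>: "\<And>x. 0 \<le> \<theta> x" "\<And>x. \<theta> x \<le> 1"
    "\<And>x. norm x \<le> real k \<Longrightarrow> \<theta> x = 1" "\<And>x. norm x \<le> real k \<Longrightarrow> D\<theta> x = 0"
    "\<And>x. 2 * real k \<le> norm x \<Longrightarrow> \<theta> x = 0" "\<And>x. 2 * real k \<le> norm x \<Longrightarrow> D\<theta> x = 0"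
    "\<And>x. norm (D\<theta> x) \<le> 16 / real k"
    using cutoff_exists[OF R, where 'a = "real^'n"] by metis
  let ?v = "\<lambda>x. \<theta> x *\<^sub>R w x" and ?Dv = "\<lambda>x. \<theta> x *\<^sub>R Dw x + w x \<otimes>\<^sub>v D\<theta> x"
  have Cv: "C1c ?v ?Dv" by (rule C1c_cutoff[OF w C\<theta>]) (erule \<theta>(5))
  have tail: "norm (\<theta> x *\<^sub>R z - z) \<le> norm (indicator {x. real k \<le> norm x} x *\<^sub>R z)"
    for x and z :: "'c::real_normed_vector"
  proof (cases "real k \<le> norm x")
    case True
    have "\<theta> x *\<^sub>R z - z = - ((1 - \<theta> x) *\<^sub>R z)" by (simp add: scaleR_diff_left)
    then have "norm (\<theta> x *\<^sub>R z - z) = \<bar>1 - \<theta> x\<bar> * norm z" by simp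
    also have "\<dots> \<le> 1 * norm z" using \<theta>(1,2)[of x] by (intro mult_right_mono) auto
    finally show ?thesis using True by simp
  qed (simp add: \<theta>(3))
  have [measurable]: "\<theta> \<in> borel_measurable lebesgue"
    using C1_measurable(1)[OF C\<theta>] by (simp add: measurable_completion)
  note [measurable] = Lp_space_measurable[OF wL] Lp_space_measurable[OF DL]
  have "Lp_norm ?q (\<lambda>x. ?v x - w x) \<le> T k"
    unfolding T_def by (rule Lp_mono(2)[OF q(1) _ Lp_tail(1)[OF q(1) wL]]) (auto intro!: AE_I2 tail simp del: norm_scaleR)
  then have 1: "Lp_norm ?q (\<lambda>x. ?v x - w x) < \<delta>" using k(2) by simp
  have b1: "(\<lambda>x. \<theta> x *\<^sub>R Dw x - Dw x) \<in> Lp_space 2" "Lp_norm 2 (\<lambda>x. \<theta> x *\<^sub>R Dw x - Dw x) \<le> T' k"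
    unfolding T'_def using Lp_mono[of 2 "\<lambda>x. \<theta> x *\<^sub>R Dw x - Dw x", OF _ _ Lp_tail(1)[OF _ DL, of "real k"]] tail
    by auto
  note err = cutoff_error_bound[OF n R d wm wL C1_measurable(2)[OF C\<theta>] \<theta>(4,6,7)]
  have b2: "(\<lambda>x. w x \<otimes>\<^sub>v D\<theta> x) \<in> Lp_space 2" by (rule err(1))
  have "(Lp_norm 2 (\<lambda>x. w x \<otimes>\<^sub>v D\<theta> x))\<^sup>2 \<le> 256 * (d * K) + 256 * (d powr (1 - ?q / 2) * T k powr ?q)"
    using err(2) unfolding K_def T_def by (simp only: distrib_left)
  also have "\<dots> \<le> (\<delta> / 2)\<^sup>2" 
  proof -
    have "(\<delta> / 2)\<^sup>2 = \<delta>\<^sup>2 / 4" by (simp add: power_divide)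
    then show ?thesis using k(1) dK zero_le_power2[of \<delta>] by linarith
  qed
  finally have b3: "Lp_norm 2 (\<lambda>x. w x \<otimes>\<^sub>v D\<theta> x) \<le> \<delta> / 2"
    by (rule power2_le_imp_le) (use \<delta> in simp)
  have "Lp_norm 2 (\<lambda>x. ?Dv x - Dw x) = Lp_norm 2 (\<lambda>x. (\<theta> x *\<^sub>R Dw x - Dw x) + w x \<otimes>\<^sub>v D\<theta> x)"
    by (simp add: algebra_simps)
  also have "\<dots> \<le> T' k + \<delta> / 2"
    using Lp_triangle[OF _ b1(1) b2] b1(2) b3 by simp
  also have "\<dots> < \<delta>" using k(3) by simp
  finally show ?thesis using Cv 1 by blast
qed

subsection \<open>Weakly differentiable functions are limits of test fields\<close>

lemma locally_integrable_component:
  fixes f :: "'a::euclidean_space \<Rightarrow> ('b::euclidean_space)^'m::finite"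
  assumes "locally_integrable f"
  shows "locally_integrable (\<lambda>x. f x $ \<alpha>)"
  unfolding locally_integrable_def set_integrable_def
proof (intro allI impI)
  fix K :: "'a set" assume "compact K"
  then have "integrable lebesgue (\<lambda>x. indicator K x *\<^sub>R f x)"
    using assms by (simp add: locally_integrable_def set_integrable_def)
  from integrable_bounded_linear[OF bounded_linear_vec_nth this]
  show "integrable lebesgue (\<lambda>x. indicator K x *\<^sub>R f x $ \<alpha>)" by simp
qed

lemma conv_component:
  fixes f :: "'a::euclidean_space \<Rightarrow> ('b::euclidean_space)^'m::finite"
  assumes g: "continuous_on UNIV g" and R: "\<And>x. R \<le> norm x \<Longrightarrow> g x = 0" and f: "locally_integrable f"
  shows "conv g f x $ \<alpha> = conv g (\<lambda>y. f y $ \<alpha>) x"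
proof -
  have "integrable lebesgue (\<lambda>y. g (x - y) *\<^sub>R f y)"
    by (rule conv_integrable[OF g _ f]) (erule R)
  from integral_bounded_linear[OF bounded_linear_vec_nth this]
  show ?thesis by (simp add: conv_def)
qed

text \<open>The derivative of \<open>conv \<rho> u\<close> falls on the kernel, which is a test function of the integration
  variable; the definition of the weak gradient then moves it to \<open>u\<close>.\<close>

lemma mollified_gradient:
  fixes u :: "real^'n::finite \<Rightarrow> real^'m::finite"
  assumes u: "has_weak_gradient u Du" and m: "mollifier e \<rho> D\<rho>"
  shows "C1 (\<lambda>x. conv \<rho> u x $ \<alpha>) (\<lambda>x. conv \<rho> Du x $ \<alpha>)"
proof -
  note M = mollifierD[OF m]
  have lu: "locally_integrable u" and lD: "locally_integrable Du"
    using u by (auto simp: has_weak_gradient_def)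
  note lDa = locally_integrable_component[OF lD, of \<alpha>]
  have "C1 (conv \<rho> (\<lambda>y. u y $ \<alpha>)) (\<lambda>x. \<chi> j. conv (\<lambda>z. D\<rho> z $ j) (\<lambda>y. u y $ \<alpha>) x)"
    by (rule conv_C1[OF M(1) _ locally_integrable_component[OF lu]]) (erule M(5))
  moreover have "conv \<rho> (\<lambda>y. u y $ \<alpha>) = (\<lambda>x. conv \<rho> u x $ \<alpha>)"
    by (rule ext, rule conv_component[OF M(2) _ lu, symmetric], erule M(5))
  moreover have "(\<chi> j. conv (\<lambda>z. D\<rho> z $ j) (\<lambda>y. u y $ \<alpha>) x) = conv \<rho> Du x $ \<alpha>" for x
  proof -
    have "conv (\<lambda>z. D\<rho> z $ j) (\<lambda>y. u y $ \<alpha>) x = conv \<rho> Du x $ \<alpha> $ j" for j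
    proof -
      let ?\<phi> = "\<lambda>y. \<rho> (x - y)"
      have "partial_deriv j ?\<phi> y = - (D\<rho> (x - y) $ j)" for y
      proof -
        have "((\<lambda>y. x - y) has_derivative (\<lambda>h. - h)) (at y)" by (auto intro!: derivative_eq_intros)
        from has_derivative_compose[OF this C1_D(1)[OF M(1), of "x - y"]]
        have "(?\<phi> has_derivative (\<lambda>h. D\<rho> (x - y) \<bullet> (- h))) (at y)" .
        from frechet_derivative_at[OF this, symmetric] show ?thesis
          by (simp add: partial_deriv_def inner_axis)
      qed
      then have "conv (\<lambda>z. D\<rho> z $ j) (\<lambda>y. u y $ \<alpha>) x
          = - (LINT y|lebesgue. u y $ \<alpha> * partial_deriv j ?\<phi> y)"
        by (simp add: conv_def mult.commute)
      also have "\<dots> = (LINT y|lebesgue. Du y $ \<alpha> $ j * ?\<phi> y)"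
        using u M(6) by (simp add: has_weak_gradient_def)
      also have "\<dots> = conv \<rho> (\<lambda>y. Du y $ \<alpha> $ j) x"
        by (simp add: conv_def mult.commute)
      also have "\<dots> = conv \<rho> (\<lambda>y. Du y $ \<alpha>) x $ j"
        by (rule conv_component[OF M(2) _ lDa, symmetric]) (erule M(5))
      also have "conv \<rho> (\<lambda>y. Du y $ \<alpha>) x = conv \<rho> Du x $ \<alpha>"
        by (rule conv_component[OF M(2) _ lD, symmetric]) (erule M(5))
      finally show ?thesis .
    qed
    then show ?thesis by (simp add: vec_eq_iff)
  qed
  ultimately show ?thesis by simp
qed

text \<open>The closure of the compactly supported fields in the norm of the solution space. It consists of
  exactly those functions of the solution space that have the given weak gradient, by
  \<open>weak_gradient_test_limit\<close> and \<open>test_limit_weak_gradient\<close>; as a closure it inherits the Sobolev and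
  ellipticity inequalities, and it is complete.\<close>

definition test_limit :: "(real^'n::finite \<Rightarrow> real^'m::finite) \<Rightarrow> (real^'n \<Rightarrow> real^'n^'m) \<Rightarrow> bool" where
  "test_limit u Du \<longleftrightarrow> u \<in> Lp_space (sobolev_exponent CARD('n)) \<and> Du \<in> Lp_space 2 \<and>
     (\<forall>\<delta>>0. \<exists>v Dv. C1c v Dv \<and> Lp_norm (sobolev_exponent CARD('n)) (\<lambda>x. v x - u x) < \<delta> \<and>
        Lp_norm 2 (\<lambda>x. Dv x - Du x) < \<delta>)"

lemma sobolev_exponent_ge: "n \<ge> 3 \<Longrightarrow> 1 \<le> sobolev_exponent n" "n \<ge> 3 \<Longrightarrow> 0 < sobolev_exponent n"
  by (simp_all add: sobolev_exponent_def field_simps)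

text \<open>Mollification makes \<open>u\<close> continuously differentiable and keeps both norms under control; a cutoff then
  gives compact support.\<close>

lemma weak_gradient_test_limit:
  fixes u :: "real^'n::finite \<Rightarrow> real^'m::finite"
  assumes n: "CARD('n) \<ge> 3" and u: "has_weak_gradient u Du"
    and uL: "u \<in> Lp_space (sobolev_exponent CARD('n))" and DL: "Du \<in> Lp_space 2"
  shows "test_limit u Du"
  unfolding test_limit_def
proof (intro conjI allI impI uL DL)
  let ?q = "sobolev_exponent CARD('n)"
  note q = sobolev_exponent_ge[OF n]
  fix \<delta> :: real assume \<delta>: "\<delta> > 0"
  obtain e1 where e1: "e1 > 0" "\<And>e \<rho> D\<rho>. 0 < e \<Longrightarrow> e \<le> e1 \<Longrightarrow> mollifier e \<rho> D\<rho> \<Longrightarrow>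
      Lp_norm ?q (\<lambda>x. conv \<rho> u x - u x) < \<delta> / 2"
    using conv_Lp_close[OF q(1) uL, of "\<delta> / 2"] \<delta> by auto
  obtain e2 where e2: "e2 > 0" "\<And>e \<rho> D\<rho>. 0 < e \<Longrightarrow> e \<le> e2 \<Longrightarrow> mollifier e \<rho> D\<rho> \<Longrightarrow>
      Lp_norm 2 (\<lambda>x. conv \<rho> Du x - Du x) < \<delta> / 2"
    using conv_Lp_close[OF _ DL, of "\<delta> / 2"] \<delta> by auto
  obtain \<rho> and D\<rho> :: "real^'n \<Rightarrow> real^'n" where m: "mollifier (min e1 e2) \<rho> D\<rho>"
    using mollifier_exists[of "min e1 e2"] e1(1) e2(1) by auto
  note M = mollifierD[OF m]
  let ?w = "conv \<rho> u" and ?Dw = "conv \<rho> Du"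
  have wL: "?w \<in> Lp_space ?q" by (rule conv_Lp(1)[OF M(2,3,4) _ q(1) uL]) (erule M(5))
  have DwL: "?Dw \<in> Lp_space 2" by (rule conv_Lp(1)[OF M(2,3,4) _ _ DL], erule M(5), simp)
  have wm: "?w \<in> borel_measurable borel"
    using u by (intro borel_measurable_continuous_onI, intro conv_continuous[OF M(2), of "min e1 e2"])
      (auto simp: has_weak_gradient_def M(5))
  obtain v Dv where v: "C1c v Dv" "Lp_norm ?q (\<lambda>x. v x - ?w x) < \<delta> / 2" "Lp_norm 2 (\<lambda>x. Dv x - ?Dw x) < \<delta> / 2"
    using cutoff_approximation[OF n mollified_gradient[OF u m] wm wL DwL, of "\<delta> / 2"] \<delta> by auto
  have "Lp_norm ?q (\<lambda>x. v x - u x) < \<delta>"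
    using Lp_dist_triangle[OF q(1) C1c_Lp(1)[OF v(1) q(2)] wL uL] v(2) e1(2)[OF _ _ m] e1(1) e2(1) by simp
  moreover have "Lp_norm 2 (\<lambda>x. Dv x - Du x) < \<delta>"
    using Lp_dist_triangle[OF _ C1c_Lp(2)[OF v(1)] DwL DL] v(3) e2(2)[OF _ _ m] e1(1) e2(1) by simp
  ultimately show "\<exists>v Dv. C1c v Dv \<and> Lp_norm ?q (\<lambda>x. v x - u x) < \<delta> \<and> Lp_norm 2 (\<lambda>x. Dv x - Du x) < \<delta>"
    using v(1) by blast
qed

lemma test_limitD:
  assumes "test_limit u Du"
  shows "u \<in> Lp_space (sobolev_exponent CARD('n))" "Du \<in> Lp_space 2"
    "\<delta> > 0 \<Longrightarrow> \<exists>v Dv. C1c v Dv \<and> Lp_norm (sobolev_exponent CARD('n)) (\<lambda>x. v x - (u :: real^'n::finite \<Rightarrow> real^'m::finite) x) < \<delta> \<and>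
        Lp_norm 2 (\<lambda>x. Dv x - Du x) < \<delta>"
  using assms by (auto simp: test_limit_def)

lemma C1c_test_limit:
  fixes v :: "real^'n::finite \<Rightarrow> real^'m::finite"
  assumes "CARD('n) \<ge> 3" "C1c v Dv"
  shows "test_limit v Dv"
  unfolding test_limit_def
  using C1c_Lp[OF assms(2)] sobolev_exponent_ge[OF assms(1)] assms(2)
  by (auto intro!: exI[of _ v] exI[of _ Dv])

lemma test_limit_weak_gradient:
  fixes u :: "real^'n::finite \<Rightarrow> real^'m::finite"
  assumes n: "CARD('n) \<ge> 3" and u: "test_limit u Du"
  shows "has_weak_gradient u Du"
  unfolding has_weak_gradient_def
proof (intro conjI allI impI)
  let ?q = "sobolev_exponent CARD('n)"
  note q = sobolev_exponent_ge[OF n]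
  note U = test_limitD[OF u]
  show "locally_integrable u" "locally_integrable Du"
    using Lp_locally_integrable[OF q(1) U(1)] Lp_locally_integrable[OF _ U(2)] by auto
  have "\<exists>p. C1c (fst p) (snd p) \<and> Lp_norm ?q (\<lambda>x. fst p x - u x) < 1 / real (Suc k) \<and>
      Lp_norm 2 (\<lambda>x. snd p x - Du x) < 1 / real (Suc k)" for k
    using U(3)[of "1 / real (Suc k)"] by auto
  then have "\<forall>k. \<exists>p. C1c (fst p) (snd p) \<and> Lp_norm ?q (\<lambda>x. fst p x - u x) < 1 / real (Suc k) \<and>
      Lp_norm 2 (\<lambda>x. snd p x - Du x) < 1 / real (Suc k)" by blast
  from choice[OF this] obtain p where p: "\<forall>k. C1c (fst (p k)) (snd (p k)) \<and>
      Lp_norm ?q (\<lambda>x. fst (p k) x - u x) < 1 / real (Suc k) \<and>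
      Lp_norm 2 (\<lambda>x. snd (p k) x - Du x) < 1 / real (Suc k)" by blast
  define v Dv where "v k = fst (p k)" and "Dv k = snd (p k)" for k
  have v: "C1c (v k) (Dv k)" "Lp_norm ?q (\<lambda>x. v k x - u x) < 1 / real (Suc k)"
      "Lp_norm 2 (\<lambda>x. Dv k x - Du x) < 1 / real (Suc k)" for k
    using p unfolding v_def Dv_def by blast+
  have inv: "(\<lambda>k. 1 / real (Suc k)) \<longlonglongrightarrow> 0"
    using LIMSEQ_inverse_real_of_nat by (simp add: inverse_eq_divide)
  fix \<phi> :: "real^'n \<Rightarrow> real" and \<alpha> i
  assume t: "test_function \<phi>"
  note C = test_function_C1(1)[OF t]
  obtain R where R: "\<And>x. R \<le> norm x \<Longrightarrow> \<phi> x = 0" using test_function_C1(2)[OF t] by blast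
  have pd: "partial_deriv i \<phi> x = (\<chi> i. partial_deriv i \<phi> x) $ i" for x by simp
  have cpd: "continuous_on UNIV (partial_deriv i \<phi>)"
  proof -
    have "continuous_on UNIV (\<lambda>x. D x $ i)" if "continuous_on UNIV D" for D :: "real^'n \<Rightarrow> real^'n"
      using that by (intro continuous_intros)
    from this[OF C1_D(2)[OF C]] show ?thesis by simp
  qed
  have R1: "partial_deriv i \<phi> x = 0" if "R + 1 \<le> norm x" for x
  proof -
    have "(\<chi> i. partial_deriv i \<phi> x) = 0"
      by (rule C1_gradient_zero[OF C, of R]) (use R that in auto)
    then show ?thesis unfolding pd by simp
  qed
  obtain B1 where B1: "\<And>x. norm (partial_deriv i \<phi> x) \<le> B1"
    using continuous_compact_support(2)[OF cpd R1] by blast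
  obtain B2 where B2: "\<And>x. norm (\<phi> x) \<le> B2"
    using continuous_compact_support(2)[OF C1_D(3)[OF C] R] by blast
  have comp1: "(\<lambda>x. w x $ \<alpha>) \<in> Lp_space ?q" "Lp_norm ?q (\<lambda>x. w x $ \<alpha>) \<le> Lp_norm ?q w"
    if "w \<in> Lp_space ?q" for w :: "real^'n \<Rightarrow> real^'m"
  proof -
    have "(\<lambda>x. w x $ \<alpha>) \<in> borel_measurable lebesgue"
      using Lp_space_measurable[OF that]
      by (intro borel_measurable_continuous_on[OF linear_continuous_on[OF bounded_linear_vec_nth]])
    then show "(\<lambda>x. w x $ \<alpha>) \<in> Lp_space ?q" "Lp_norm ?q (\<lambda>x. w x $ \<alpha>) \<le> Lp_norm ?q w"
      using Lp_mono[OF q(2) _ that, of "\<lambda>x. w x $ \<alpha>"] by (auto simp: Finite_Cartesian_Product.norm_nth_le[where 'a = real, simplified])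
  qed
  have comp2: "(\<lambda>x. w x $ \<alpha> $ i) \<in> Lp_space 2" "Lp_norm 2 (\<lambda>x. w x $ \<alpha> $ i) \<le> Lp_norm 2 w"
    if "w \<in> Lp_space 2" for w :: "real^'n \<Rightarrow> real^'n^'m"
  proof -
    have "(\<lambda>x. w x $ \<alpha> $ i) \<in> borel_measurable lebesgue"
      using Lp_space_measurable[OF that]
      by (intro borel_measurable_continuous_on[OF linear_continuous_on[OF
          bounded_linear_compose[OF bounded_linear_vec_nth bounded_linear_vec_nth]]])
    moreover have "norm (w x $ \<alpha> $ i) \<le> norm (w x)" for x
      using Finite_Cartesian_Product.norm_nth_le[of "w x $ \<alpha>" i] Finite_Cartesian_Product.norm_nth_le[of "w x" \<alpha>]
      by linarith
    ultimately show "(\<lambda>x. w x $ \<alpha> $ i) \<in> Lp_space 2" "Lp_norm 2 (\<lambda>x. w x $ \<alpha> $ i) \<le> Lp_norm 2 w"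
      using Lp_mono[OF _ _ that, of "\<lambda>x. w x $ \<alpha> $ i"] by auto
  qed
  have vL: "v k \<in> Lp_space ?q" and DvL: "Dv k \<in> Lp_space 2" for k
    using C1c_Lp[OF v(1)] q by auto
  have L1: "(\<lambda>k. LINT x|lebesgue. v k x $ \<alpha> * partial_deriv i \<phi> x) \<longlonglongrightarrow> (LINT x|lebesgue. u x $ \<alpha> * partial_deriv i \<phi> x)"
  proof (rule Lp_pairing_tendsto[OF q(1) comp1(1)[OF vL] comp1(1)[OF U(1)]])
    show "(\<lambda>k. Lp_norm ?q (\<lambda>x. v k x $ \<alpha> - u x $ \<alpha>)) \<longlonglongrightarrow> 0"
    proof (rule Lim_null_comparison[OF _ inv], intro always_eventually allI)
      fix k
      have "Lp_norm ?q (\<lambda>x. v k x $ \<alpha> - u x $ \<alpha>) \<le> Lp_norm ?q (\<lambda>x. v k x - u x)"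
        using comp1(2)[OF Lp_diff(1)[OF q(1) vL U(1)]] by simp
      then show "norm (Lp_norm ?q (\<lambda>x. v k x $ \<alpha> - u x $ \<alpha>)) \<le> 1 / real (Suc k)"
        using v(2)[of k] by simp
    qed
  qed (use cpd B1 R1 in \<open>auto intro: borel_measurable_continuous_onI\<close>)
  have L2: "(\<lambda>k. LINT x|lebesgue. Dv k x $ \<alpha> $ i * \<phi> x) \<longlonglongrightarrow> (LINT x|lebesgue. Du x $ \<alpha> $ i * \<phi> x)"
  proof (rule Lp_pairing_tendsto[OF _ comp2(1)[OF DvL] comp2(1)[OF U(2)]])
    show "(\<lambda>k. Lp_norm 2 (\<lambda>x. Dv k x $ \<alpha> $ i - Du x $ \<alpha> $ i)) \<longlonglongrightarrow> 0"
    proof (rule Lim_null_comparison[OF _ inv], intro always_eventually allI)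
      fix k
      have "Lp_norm 2 (\<lambda>x. Dv k x $ \<alpha> $ i - Du x $ \<alpha> $ i) \<le> Lp_norm 2 (\<lambda>x. Dv k x - Du x)"
        using comp2(2)[OF Lp_diff(1)[OF _ DvL U(2)]] by simp
      then show "norm (Lp_norm 2 (\<lambda>x. Dv k x $ \<alpha> $ i - Du x $ \<alpha> $ i)) \<le> 1 / real (Suc k)"
        using v(3)[of k] by simp
    qed
  qed (use C1_D(3)[OF C] B2 R in \<open>auto intro: borel_measurable_continuous_onI\<close>)
  have eq: "(LINT x|lebesgue. v k x $ \<alpha> * partial_deriv i \<phi> x) = - (LINT x|lebesgue. Dv k x $ \<alpha> $ i * \<phi> x)" for k
    using C1c_has_weak_gradient[OF v(1)[of k]] t by (simp add: has_weak_gradient_def)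
  show "(LINT x|lebesgue. u x $ \<alpha> * partial_deriv i \<phi> x) = - (LINT x|lebesgue. Du x $ \<alpha> $ i * \<phi> x)"
    by (rule LIMSEQ_unique[OF L1[unfolded eq] tendsto_minus[OF L2]])
qed

lemma test_limit_diff:
  fixes u v :: "real^'n::finite \<Rightarrow> real^'m::finite"
  assumes n: "CARD('n) \<ge> 3" and u: "test_limit u Du" and v: "test_limit v Dv"
  shows "test_limit (\<lambda>x. u x - v x) (\<lambda>x. Du x - Dv x)"
  unfolding test_limit_def
proof (intro conjI allI impI)
  let ?q = "sobolev_exponent CARD('n)"
  note q = sobolev_exponent_ge[OF n] and U = test_limitD[OF u] and V = test_limitD[OF v]
  show "(\<lambda>x. u x - v x) \<in> Lp_space ?q" "(\<lambda>x. Du x - Dv x) \<in> Lp_space 2"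
    using U V q by (auto intro!: Lp_diff)
  fix \<delta> :: real assume \<delta>: "\<delta> > 0"
  obtain a Da where a: "C1c a Da" "Lp_norm ?q (\<lambda>x. a x - u x) < \<delta> / 2" "Lp_norm 2 (\<lambda>x. Da x - Du x) < \<delta> / 2"
    using U(3)[of "\<delta> / 2"] \<delta> by auto
  obtain b Db where b: "C1c b Db" "Lp_norm ?q (\<lambda>x. b x - v x) < \<delta> / 2" "Lp_norm 2 (\<lambda>x. Db x - Dv x) < \<delta> / 2"
    using V(3)[of "\<delta> / 2"] \<delta> by auto
  have "Lp_norm ?q (\<lambda>x. (a x - u x) - (b x - v x)) < \<delta>"
    using Lp_diff(2)[OF q(1) Lp_diff(1)[OF q(1) C1c_Lp(1)[OF a(1) q(2)] U(1)] Lp_diff(1)[OF q(1) C1c_Lp(1)[OF b(1) q(2)] V(1)]]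
      a(2) b(2) by simp
  moreover have "Lp_norm 2 (\<lambda>x. (Da x - Du x) - (Db x - Dv x)) < \<delta>"
    using Lp_diff(2)[OF _ Lp_diff(1)[OF _ C1c_Lp(2)[OF a(1)] U(2)] Lp_diff(1)[OF _ C1c_Lp(2)[OF b(1)] V(2)]]
      a(3) b(3) by simp
  moreover have "(a x - u x) - (b x - v x) = (a x - b x) - (u x - v x)"
    "(Da x - Du x) - (Db x - Dv x) = (Da x - Db x) - (Du x - Dv x)" for x by simp_all
  ultimately show "\<exists>w Dw. C1c w Dw \<and> Lp_norm ?q (\<lambda>x. w x - (u x - v x)) < \<delta> \<and>
      Lp_norm 2 (\<lambda>x. Dw x - (Du x - Dv x)) < \<delta>"
    using C1c_diff[OF a(1) b(1)] by (intro exI[of _ "\<lambda>x. a x - b x"] exI[of _ "\<lambda>x. Da x - Db x"]) simp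
qed

lemma test_limit_Sobolev:
  fixes u :: "real^'n::finite \<Rightarrow> real^'m::finite"
  assumes n: "CARD('n) \<ge> 3" and u: "test_limit u Du"
  shows "Lp_norm (sobolev_exponent CARD('n)) u \<le> sobolev_constant CARD('n) CARD('m) * Lp_norm 2 Du"
proof (rule field_le_epsilon)
  let ?q = "sobolev_exponent CARD('n)" and ?S = "sobolev_constant CARD('n) CARD('m)"
  note q = sobolev_exponent_ge[OF n] and U = test_limitD[OF u]
  have S: "?S \<ge> 0" using n by (simp add: sobolev_constant_def)
  fix e :: real assume e: "e > 0"
  define \<delta> where "\<delta> = e / (?S + 1)"
  have \<delta>: "\<delta> > 0" using e S by (simp add: \<delta>_def)
  obtain v Dv where v: "C1c v Dv" "Lp_norm ?q (\<lambda>x. v x - u x) < \<delta>" "Lp_norm 2 (\<lambda>x. Dv x - Du x) < \<delta>"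
    using U(3)[OF \<delta>] by blast
  note vL = C1c_Lp(1)[OF v(1) q(2)] and DvL = C1c_Lp(2)[OF v(1), of 2, simplified]
  have "Lp_norm ?q u \<le> Lp_norm ?q v + \<delta>"
    using Lp_norm_triangle_sub[OF q(1) U(1) vL] v(2) Lp_norm_minus_commute[OF q(1) vL U(1)] by simp
  also have "\<dots> \<le> ?S * Lp_norm 2 Dv + \<delta>" using Sobolev_inequality[OF n v(1)] by simp
  also have "\<dots> \<le> ?S * (Lp_norm 2 Du + \<delta>) + \<delta>"
    using Lp_norm_triangle_sub[OF _ DvL U(2)] v(3) S by (intro add_right_mono mult_left_mono) auto
  also have "\<dots> = ?S * Lp_norm 2 Du + \<delta> * (?S + 1)" by (simp add: algebra_simps)
  also have "\<delta> * (?S + 1) = e" using S by (simp add: \<delta>_def)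
  finally show "Lp_norm ?q u \<le> ?S * Lp_norm 2 Du + e" .
qed

lemma test_limit_elliptic:
  fixes u :: "real^'n::finite \<Rightarrow> real^'m::finite" and A :: "real^'n^'m \<Rightarrow> real^'k::finite"
  assumes A: "linear A" and \<nu>: "0 \<le> \<nu>" "\<And>\<eta> a. \<nu> * norm (\<eta> \<otimes>\<^sub>v a) \<le> norm (A (\<eta> \<otimes>\<^sub>v a))"
    and u: "test_limit u Du"
  shows "\<nu> * Lp_norm 2 Du \<le> Lp_norm 2 (\<lambda>x. A (Du x))"
proof (rule field_le_epsilon)
  note U = test_limitD[OF u]
  have K: "onorm A \<ge> 0" using A by (intro onorm_pos_le) (simp add: linear_conv_bounded_linear)
  fix e :: real assume e: "e > 0"
  define \<delta> where "\<delta> = e / (\<nu> + onorm A + 1)"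
  have \<delta>: "\<delta> > 0" using e K \<nu> by (simp add: \<delta>_def)
  obtain v Dv where v: "C1c v Dv" "Lp_norm 2 (\<lambda>x. Dv x - Du x) < \<delta>" using U(3)[OF \<delta>] by blast
  note DvL = C1c_Lp(2)[OF v(1), of 2, simplified]
  note AD = Lp_linear(1)[OF _ A, of 2, simplified]
  have "Lp_norm 2 Du \<le> Lp_norm 2 Dv + \<delta>"
    using Lp_norm_triangle_sub[OF _ U(2) DvL] v(2) Lp_norm_minus_commute[OF _ DvL U(2)] by simp
  then have "\<nu> * Lp_norm 2 Du \<le> \<nu> * Lp_norm 2 Dv + \<nu> * \<delta>"
    using \<nu>(1) by (metis distrib_left mult_left_mono)
  also have "\<nu> * Lp_norm 2 Dv \<le> Lp_norm 2 (\<lambda>x. A (Dv x))"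
    by (rule elliptic_gradient_bound[OF A \<nu> v(1)])
  also have "\<dots> \<le> Lp_norm 2 (\<lambda>x. A (Du x)) + Lp_norm 2 (\<lambda>x. A (Dv x) - A (Du x))"
    by (rule Lp_norm_triangle_sub[OF _ AD[OF DvL] AD[OF U(2)]]) simp
  also have "Lp_norm 2 (\<lambda>x. A (Dv x) - A (Du x)) \<le> onorm A * \<delta>"
  proof -
    have "Lp_norm 2 (\<lambda>x. A (Dv x - Du x)) \<le> onorm A * Lp_norm 2 (\<lambda>x. Dv x - Du x)"
      using Lp_diff(1)[OF _ DvL U(2)] by (intro Lp_linear(2)[OF _ A]) auto
    also have "\<dots> \<le> onorm A * \<delta>" using v(2) K by (intro mult_left_mono) auto
    finally show ?thesis by (simp add: linear_diff[OF A])
  qed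
  finally have "\<nu> * Lp_norm 2 Du \<le> Lp_norm 2 (\<lambda>x. A (Du x)) + (\<nu> + onorm A) * \<delta>"
    by (simp add: algebra_simps)
  also have "(\<nu> + onorm A) * \<delta> \<le> (\<nu> + onorm A + 1) * \<delta>" using \<delta> by (intro mult_right_mono) auto
  also have "\<dots> = e" using K \<nu> by (simp add: \<delta>_def)
  finally show "\<nu> * Lp_norm 2 Du \<le> Lp_norm 2 (\<lambda>x. A (Du x)) + e" by simp
qed

text \<open>The Sobolev inequality makes the functions themselves a Cauchy sequence as soon as their gradients are
  one.\<close>

lemma test_limit_complete:
  fixes u :: "nat \<Rightarrow> real^'n::finite \<Rightarrow> real^'m::finite"
  assumes n: "CARD('n) \<ge> 3" and u: "\<And>k. test_limit (u k) (Du k)"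
    and cauchy: "\<And>e. e > 0 \<Longrightarrow> \<exists>M. \<forall>m\<ge>M. \<forall>k\<ge>M. Lp_norm 2 (\<lambda>x. Du m x - Du k x) < e"
  shows "\<exists>v G. test_limit v G \<and> (\<lambda>k. Lp_norm 2 (\<lambda>x. Du k x - G x)) \<longlonglongrightarrow> 0"
proof -
  let ?q = "sobolev_exponent CARD('n)" and ?S = "sobolev_constant CARD('n) CARD('m)"
  note q = sobolev_exponent_ge[OF n] and U = test_limitD[OF u]
  have S: "?S \<ge> 0" using n by (simp add: sobolev_constant_def)
  obtain G where G: "G \<in> Lp_space 2" "(\<lambda>k. Lp_norm 2 (\<lambda>x. Du k x - G x)) \<longlonglongrightarrow> 0"
    using Lp_complete[OF _ U(2) cauchy] by auto
  have cauchy_u: "\<exists>M. \<forall>m\<ge>M. \<forall>k\<ge>M. Lp_norm ?q (\<lambda>x. u m x - u k x) < e" if e: "e > 0" for e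
  proof -
    have "e / (?S + 1) > 0" using e S by simp
    from cauchy[OF this] obtain M where M: "\<And>m k. m \<ge> M \<Longrightarrow> k \<ge> M \<Longrightarrow> Lp_norm 2 (\<lambda>x. Du m x - Du k x) < e / (?S + 1)"
      by blast
    have "Lp_norm ?q (\<lambda>x. u m x - u k x) < e" if "m \<ge> M" "k \<ge> M" for m k
    proof -
      have "Lp_norm ?q (\<lambda>x. u m x - u k x) \<le> ?S * Lp_norm 2 (\<lambda>x. Du m x - Du k x)"
        by (rule test_limit_Sobolev[OF n test_limit_diff[OF n u u]])
      also have "\<dots> \<le> ?S * (e / (?S + 1))" using M[OF that] S by (intro mult_left_mono) auto
      also have "\<dots> < e" using S e by (simp add: field_simps)
      finally show ?thesis .
    qed
    then show ?thesis by blast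
  qed
  have "\<exists>v\<in>Lp_space ?q. (\<lambda>k. Lp_norm ?q (\<lambda>x. u k x - v x)) \<longlonglongrightarrow> 0"
    by (rule Lp_complete[OF q(1) U(1)]) (rule cauchy_u)
  then obtain v where v: "v \<in> Lp_space ?q" "(\<lambda>k. Lp_norm ?q (\<lambda>x. u k x - v x)) \<longlonglongrightarrow> 0"
    by blast
  have "test_limit v G"
    unfolding test_limit_def
  proof (intro conjI allI impI v(1) G(1))
    fix \<delta> :: real assume \<delta>: "\<delta> > 0"
    have "\<forall>\<^sub>F k in sequentially. Lp_norm ?q (\<lambda>x. u k x - v x) < \<delta> / 2 \<and> Lp_norm 2 (\<lambda>x. Du k x - G x) < \<delta> / 2"
      using order_tendstoD(2)[OF v(2), of "\<delta> / 2"] order_tendstoD(2)[OF G(2), of "\<delta> / 2"] \<delta>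
      by (auto simp: eventually_conj_iff)
    then obtain k where k: "Lp_norm ?q (\<lambda>x. u k x - v x) < \<delta> / 2" "Lp_norm 2 (\<lambda>x. Du k x - G x) < \<delta> / 2"
      using eventually_happens'[OF sequentially_bot] by blast
    obtain w Dw where w: "C1c w Dw" "Lp_norm ?q (\<lambda>x. w x - u k x) < \<delta> / 2" "Lp_norm 2 (\<lambda>x. Dw x - Du k x) < \<delta> / 2"
      using U(3)[of "\<delta> / 2" k] \<delta> by auto
    have "Lp_norm ?q (\<lambda>x. w x - v x) < \<delta>"
      using Lp_dist_triangle[OF q(1) C1c_Lp(1)[OF w(1) q(2)] U(1)[of k] v(1)] w(2) k(1) by simp
    moreover have "Lp_norm 2 (\<lambda>x. Dw x - G x) < \<delta>"
      using Lp_dist_triangle[OF _ C1c_Lp(2)[OF w(1)] U(2)[of k] G(1)] w(3) k(2) by simp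
    ultimately show "\<exists>w Dw. C1c w Dw \<and> Lp_norm ?q (\<lambda>x. w x - v x) < \<delta> \<and> Lp_norm 2 (\<lambda>x. Dw x - G x) < \<delta>"
      using w(1) by blast
  qed
  with G(2) show ?thesis by blast
qed

section \<open>The linear system\<close>

lemma tensor_add_left: "(\<eta> + \<zeta>) \<otimes>\<^sub>v a = \<eta> \<otimes>\<^sub>v a + \<zeta> \<otimes>\<^sub>v a"
  and tensor_scaleR_left: "(c *\<^sub>R \<eta>) \<otimes>\<^sub>v a = c *\<^sub>R (\<eta> \<otimes>\<^sub>v a)"
  by (simp_all add: tensor_def vec_eq_iff algebra_simps)

text \<open>The transpose of \<open>A\<close> in the two vectors that are paired by \<open>\<eta> \<bullet> A (\<zeta> \<otimes>\<^sub>v a)\<close> for fixed \<open>a\<close>, extended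
  linearly from rank-one matrices; see \<open>transposed_inner\<close>.\<close>

definition transposed :: "(real^'n::finite^'m::finite \<Rightarrow> real^'m) \<Rightarrow> real^'n^'m \<Rightarrow> real^'m" where
  "transposed A P = (\<chi> \<beta>. \<Sum>\<alpha>\<in>UNIV. A (axis \<beta> 1 \<otimes>\<^sub>v (P $ \<alpha>)) $ \<alpha>)"

lemma tensor_linear_right: "linear (\<lambda>a. \<eta> \<otimes>\<^sub>v a)"
  by (rule linearI) (simp_all add: tensor_def vec_eq_iff algebra_simps)

lemma linear_transposed:
  assumes A: "linear A"
  shows "linear (transposed A)"
proof -
  have L: "linear (\<lambda>a. A (axis \<beta> 1 \<otimes>\<^sub>v a))" for \<beta>
    using linear_compose[OF tensor_linear_right A] by (simp add: o_def)
  show ?thesis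
    by (rule linearI)
       (simp_all add: transposed_def vec_eq_iff linear_add[OF L] linear_cmul[OF L] sum.distrib sum_distrib_left)
qed

lemma transposed_inner:
  assumes A: "linear A"
  shows "transposed A (\<eta> \<otimes>\<^sub>v a) \<bullet> \<zeta> = \<eta> \<bullet> A (\<zeta> \<otimes>\<^sub>v a)"
proof -
  have row: "(\<eta> \<otimes>\<^sub>v a) $ \<alpha> = \<eta> $ \<alpha> *\<^sub>R a" for \<alpha>
    by (simp add: tensor_def vec_eq_iff)
  have sc: "A (axis \<beta> 1 \<otimes>\<^sub>v (c *\<^sub>R a)) = c *\<^sub>R A (axis \<beta> 1 \<otimes>\<^sub>v a)" for \<beta> c
    by (simp add: linear_cmul[OF tensor_linear_right] linear_cmul[OF A])
  have "A (\<zeta> \<otimes>\<^sub>v a) = A (\<Sum>\<beta>\<in>UNIV. \<zeta> $ \<beta> *\<^sub>R (axis \<beta> 1 \<otimes>\<^sub>v a))"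
  proof (rule arg_cong[of _ _ A])
    have "(\<Sum>\<beta>\<in>UNIV. \<zeta> $ \<beta> * (axis \<beta> 1 \<otimes>\<^sub>v a) $ i $ j) = (\<Sum>\<beta>\<in>UNIV. if \<beta> = i then \<zeta> $ i * a $ j else 0)" for i j
      by (intro sum.cong) (auto simp: tensor_def axis_def)
    then show "\<zeta> \<otimes>\<^sub>v a = (\<Sum>\<beta>\<in>UNIV. \<zeta> $ \<beta> *\<^sub>R (axis \<beta> 1 \<otimes>\<^sub>v a))"
      by (simp add: vec_eq_iff) (simp add: tensor_def)
  qed
  also have "\<dots> = (\<Sum>\<beta>\<in>UNIV. \<zeta> $ \<beta> *\<^sub>R A (axis \<beta> 1 \<otimes>\<^sub>v a))"
    by (simp add: linear_sum[OF A] linear_cmul[OF A])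
  finally have Az: "A (\<zeta> \<otimes>\<^sub>v a) $ \<alpha> = (\<Sum>\<beta>\<in>UNIV. \<zeta> $ \<beta> * A (axis \<beta> 1 \<otimes>\<^sub>v a) $ \<alpha>)" for \<alpha>
    by simp
  have "transposed A (\<eta> \<otimes>\<^sub>v a) \<bullet> \<zeta>
      = (\<Sum>\<beta>\<in>UNIV. \<Sum>\<alpha>\<in>UNIV. \<eta> $ \<alpha> * (\<zeta> $ \<beta> * A (axis \<beta> 1 \<otimes>\<^sub>v a) $ \<alpha>))"
    by (simp add: transposed_def inner_vec_def row sc sum_distrib_right sum_distrib_left mult_ac)
  also have "\<dots> = (\<Sum>\<alpha>\<in>UNIV. \<Sum>\<beta>\<in>UNIV. \<eta> $ \<alpha> * (\<zeta> $ \<beta> * A (axis \<beta> 1 \<otimes>\<^sub>v a) $ \<alpha>))"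
    by (rule sum.swap)
  also have "\<dots> = \<eta> \<bullet> A (\<zeta> \<otimes>\<^sub>v a)"
    by (simp add: inner_vec_def Az sum_distrib_left)
  finally show ?thesis .
qed

text \<open>For fixed \<open>a\<close> the map \<open>\<lambda>\<zeta>. A (\<zeta> \<otimes>\<^sub>v a)\<close> is given by a square matrix. Its lower bound is a bound for
  the norm of the inverse matrix, which transposition preserves.\<close>

lemma transposed_elliptic:
  fixes A :: "real^'n::finite^'m::finite \<Rightarrow> real^'m"
  assumes A: "linear A" and \<nu>: "0 < \<nu>" "\<And>\<eta> a. \<nu> * norm (\<eta> \<otimes>\<^sub>v a) \<le> norm (A (\<eta> \<otimes>\<^sub>v a))"
  shows "\<nu> * norm (\<eta> \<otimes>\<^sub>v a) \<le> norm (transposed A (\<eta> \<otimes>\<^sub>v a))"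
proof (cases "a = 0 \<or> \<eta> = 0")
  case True
  then have "norm (\<eta> \<otimes>\<^sub>v a) = 0" by (auto simp: norm_tensor)
  then show ?thesis by simp
next
  case False
  let ?L = "\<lambda>\<zeta>. A (\<zeta> \<otimes>\<^sub>v a)"
  have L: "linear ?L"
    by (rule linearI) (simp_all add: tensor_add_left tensor_scaleR_left linear_add[OF A] linear_cmul[OF A])
  have "inj ?L"
    unfolding linear_injective_0[OF L]
  proof (intro allI impI)
    fix \<zeta> assume "?L \<zeta> = 0"
    then have "\<nu> * (norm \<zeta> * norm a) \<le> 0" using \<nu>(2)[of \<zeta> a] by (simp add: norm_tensor)
    then have "norm \<zeta> * norm a \<le> 0" using \<nu>(1) by (simp add: mult_le_0_iff)
    then show "\<zeta> = 0" using False by (simp add: mult_le_0_iff)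
  qed
  then have "surj ?L" by (rule linear_inj_imp_surj[OF L])
  then obtain \<zeta> where "\<eta> = A (\<zeta> \<otimes>\<^sub>v a)" by (rule surjE)
  then have \<zeta>: "A (\<zeta> \<otimes>\<^sub>v a) = \<eta>" by (rule sym)
  have z: "\<nu> * (norm \<zeta> * norm a) \<le> norm \<eta>" using \<nu>(2)[of \<zeta> a] by (simp add: norm_tensor \<zeta>)
  have "norm \<eta> * norm \<eta> = \<eta> \<bullet> A (\<zeta> \<otimes>\<^sub>v a)" by (simp add: \<zeta> power2_norm_eq_inner[symmetric] power2_eq_square)
  also have "\<dots> = transposed A (\<eta> \<otimes>\<^sub>v a) \<bullet> \<zeta>" by (rule transposed_inner[OF A, symmetric])
  also have "\<dots> \<le> norm (transposed A (\<eta> \<otimes>\<^sub>v a)) * norm \<zeta>" by (rule norm_cauchy_schwarz)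
  finally have *: "norm \<eta> * norm \<eta> \<le> norm (transposed A (\<eta> \<otimes>\<^sub>v a)) * norm \<zeta>" .
  have "(\<nu> * norm a * norm \<eta>) * norm \<eta> = (\<nu> * norm a) * (norm \<eta> * norm \<eta>)" by simp
  also have "\<dots> \<le> (\<nu> * norm a) * (norm (transposed A (\<eta> \<otimes>\<^sub>v a)) * norm \<zeta>)"
    using * \<nu>(1) by (intro mult_left_mono) auto
  also have "\<dots> = norm (transposed A (\<eta> \<otimes>\<^sub>v a)) * (\<nu> * (norm \<zeta> * norm a))" by simp
  also have "\<dots> \<le> norm (transposed A (\<eta> \<otimes>\<^sub>v a)) * norm \<eta>" by (intro mult_left_mono z) auto
  finally have "\<nu> * norm a * norm \<eta> \<le> norm (transposed A (\<eta> \<otimes>\<^sub>v a))"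
    by (rule mult_right_le_imp_le) (use False in simp)
  then show ?thesis by (simp add: norm_tensor mult_ac)
qed

subsection \<open>The range is dense\<close>

text \<open>Orthogonality to the gradients of the kernels \<open>\<rho> (x - y)\<close>, placed in each coordinate direction,
  states that the mollification of \<open>r\<close> solves the homogeneous transposed system at \<open>x\<close>.\<close>

lemma orthogonal_mollified:
  fixes A :: "real^'n::finite^'m::finite \<Rightarrow> real^'m"
  assumes A: "linear A" and r: "r \<in> Lp_space 2"
    and orth: "\<And>\<phi> D\<phi>. C1c \<phi> D\<phi> \<Longrightarrow> (LINT x|lebesgue. r x \<bullet> A (D\<phi> x)) = 0"
    and m: "mollifier e \<rho> D\<rho>"
  defines "P \<equiv> \<lambda>x. \<chi> \<alpha> j. conv (\<lambda>z. D\<rho> z $ j) (\<lambda>y. r y $ \<alpha>) x"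
  shows "C1 (\<lambda>x. conv \<rho> r x $ \<alpha>) (\<lambda>x. P x $ \<alpha>)" and "transposed A (P x) = 0"
proof -
  note M = mollifierD[OF m]
  have lr: "locally_integrable r" using Lp_locally_integrable[OF _ r] by simp
  note lra = locally_integrable_component[OF lr]
  have "C1 (conv \<rho> (\<lambda>y. r y $ \<alpha>)) (\<lambda>x. \<chi> j. conv (\<lambda>z. D\<rho> z $ j) (\<lambda>y. r y $ \<alpha>) x)"
    by (rule conv_C1[OF M(1) _ lra]) (erule M(5))
  moreover have "conv \<rho> (\<lambda>y. r y $ \<alpha>) = (\<lambda>x. conv \<rho> r x $ \<alpha>)"
    by (rule ext, rule conv_component[OF M(2) _ lr, symmetric], erule M(5))
  ultimately show "C1 (\<lambda>x. conv \<rho> r x $ \<alpha>) (\<lambda>x. P x $ \<alpha>)"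
    by (simp add: P_def)
  have cj: "continuous_on UNIV (\<lambda>z. D\<rho> z $ j)" for j
    by (intro continuous_intros C1_D[OF M(1)])
  have Sj: "D\<rho> z $ j = 0" if "e + 1 \<le> norm z" for z j
  proof -
    have "D\<rho> z = 0" by (rule C1_gradient_zero[OF M(1), of e]) (use M(5) that in auto)
    then show ?thesis by simp
  qed
  have int: "integrable lebesgue (\<lambda>y. D\<rho> (x - y) $ j * r y $ \<alpha>)" for j \<alpha>
  proof -
    have "integrable lebesgue (\<lambda>y. D\<rho> (x - y) $ j *\<^sub>R r y $ \<alpha>)"
      by (rule conv_integrable[OF cj _ lra]) (erule Sj)
    then show ?thesis by simp
  qed
  have expand: "A (axis \<beta> 1 \<otimes>\<^sub>v a) = (\<Sum>j\<in>UNIV. a $ j *\<^sub>R A (axis \<beta> 1 \<otimes>\<^sub>v axis j 1))" for \<beta> a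
  proof -
    have "a = (\<Sum>j\<in>UNIV. a $ j *\<^sub>R axis j 1)"
      using basis_expansion[of a] by (simp add: scalar_mult_eq_scaleR)
    then have "A (axis \<beta> 1 \<otimes>\<^sub>v a) = A (axis \<beta> 1 \<otimes>\<^sub>v (\<Sum>j\<in>UNIV. a $ j *\<^sub>R axis j 1))" by simp
    also have "\<dots> = (\<Sum>j\<in>UNIV. a $ j *\<^sub>R A (axis \<beta> 1 \<otimes>\<^sub>v axis j 1))"
      by (simp only: linear_sum[OF tensor_linear_right] linear_cmul[OF tensor_linear_right] linear_sum[OF A] linear_cmul[OF A])
    finally show ?thesis .
  qed
  have "transposed A (P x) $ \<beta> = 0" for \<beta>
  proof -
    let ?\<phi> = "\<lambda>y. \<rho> (x - y) *\<^sub>R axis \<beta> 1 :: real^'m"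
    let ?D\<phi> = "\<lambda>y. axis \<beta> 1 \<otimes>\<^sub>v (- D\<rho> (x - y))"
    have "C1c ?\<phi> ?D\<phi>"
      unfolding C1c_def
    proof (intro conjI allI)
      fix \<alpha>
      have "C1 (\<lambda>y. \<rho> (x - y)) (\<lambda>y. - D\<rho> (x - y))"
        unfolding C1_def
      proof (intro conjI allI)
        fix y
        have "((\<lambda>y. x - y) has_derivative (\<lambda>h. - h)) (at y)" by (auto intro!: derivative_eq_intros)
        from has_derivative_compose[OF this C1_D(1)[OF M(1), of "x - y"]]
        show "((\<lambda>y. \<rho> (x - y)) has_derivative (\<lambda>h. - D\<rho> (x - y) \<bullet> h)) (at y)" by simp
        show "continuous_on UNIV (\<lambda>y. - D\<rho> (x - y))"
          by (intro continuous_intros continuous_on_compose2[OF C1_D(2)[OF M(1)]]) auto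
      qed
      from C1_cmult[OF this, of "axis \<beta> 1 $ \<alpha>"]
      show "C1 (\<lambda>y. ?\<phi> y $ \<alpha>) (\<lambda>y. ?D\<phi> y $ \<alpha>)"
        by (simp add: tensor_def mult.commute scaleR_vec_def)
    next
      have "?\<phi> y = 0" if "norm x + \<bar>e\<bar> \<le> norm y" for y
        using norm_triangle_ineq2[of y x] that M(5)[of "x - y"] by (simp add: norm_minus_commute)
      then show "\<exists>R. \<forall>y. R \<le> norm y \<longrightarrow> ?\<phi> y = 0" by blast
    qed
    then have o: "(LINT y|lebesgue. r y \<bullet> A (?D\<phi> y)) = 0" by (rule orth)
    have eq: "r y \<bullet> A (?D\<phi> y)
        = - (\<Sum>\<alpha>\<in>UNIV. \<Sum>j\<in>UNIV. (D\<rho> (x - y) $ j * r y $ \<alpha>) * A (axis \<beta> 1 \<otimes>\<^sub>v axis j 1) $ \<alpha>)" for y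
      unfolding expand[of \<beta> "- D\<rho> (x - y)"]
      by (simp add: inner_vec_def sum_negf sum_distrib_left mult_ac)
    have "(\<Sum>\<alpha>\<in>UNIV. \<Sum>j\<in>UNIV. (LINT y|lebesgue. D\<rho> (x - y) $ j * r y $ \<alpha>) * A (axis \<beta> 1 \<otimes>\<^sub>v axis j 1) $ \<alpha>) = 0"
      using o unfolding eq by (simp add: int)
    then show ?thesis
      unfolding transposed_def P_def
      by (simp add: expand[of \<beta> "\<chi> j. _ j"] conv_def)
  qed
  then show "transposed A (P x) = 0" by (simp add: vec_eq_iff)
qed

text \<open>The mollification \<open>g\<close> of \<open>r\<close> solves the homogeneous transposed system. Cutting it off at radius \<open>R\<close>
  leaves only the error \<open>g \<otimes>\<^sub>v D\<theta>\<close>, whose \<open>L\<^sup>2\<close> norm is of order \<open>1 / R\<close>; by ellipticity of the transposed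
  map and the Sobolev inequality the critical norm of the cutoff is of order \<open>1 / R\<close> as well. Hence
  \<open>g\<close> vanishes, and so does \<open>r\<close>, the limit of its mollifications.\<close>

lemma orthogonal_to_range_eq_0:
  fixes A :: "real^'n::finite^'m::finite \<Rightarrow> real^'m"
  assumes n: "CARD('n) \<ge> 3" and A: "linear A"
    and \<nu>: "0 < \<nu>" "\<And>\<eta> a. \<nu> * norm (\<eta> \<otimes>\<^sub>v a) \<le> norm (A (\<eta> \<otimes>\<^sub>v a))"
    and r: "r \<in> Lp_space 2"
    and orth: "\<And>\<phi> D\<phi>. C1c \<phi> D\<phi> \<Longrightarrow> (LINT x|lebesgue. r x \<bullet> A (D\<phi> x)) = 0"
  shows "AE x in lebesgue. r x = 0"
proof -
  let ?q = "sobolev_exponent CARD('n)" and ?S = "sobolev_constant CARD('n) CARD('m)"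
  note q = sobolev_exponent_ge[OF n]
  have S: "?S \<ge> 0" using n by (simp add: sobolev_constant_def)
  let ?At = "transposed A"
  have At: "linear ?At" by (rule linear_transposed[OF A])
  have K: "onorm ?At \<ge> 0" using At by (intro onorm_pos_le) (simp add: linear_conv_bounded_linear)
  have zero: "AE x in lebesgue. conv \<rho> r x = 0" if m: "mollifier e \<rho> D\<rho>" for e \<rho> D\<rho>
  proof -
    note M = mollifierD[OF m]
    define g where "g = conv \<rho> r"
    define P where "P = (\<lambda>x. \<chi> \<alpha> j. conv (\<lambda>z. D\<rho> z $ j) (\<lambda>y. r y $ \<alpha>) x)"
    have P: "C1 (\<lambda>x. g x $ \<alpha>) (\<lambda>x. P x $ \<alpha>)" "?At (P x) = 0" for \<alpha> x
      unfolding g_def P_def by (rule orthogonal_mollified[OF A r orth m], assumption)+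
    have gL: "g \<in> Lp_space 2" unfolding g_def by (rule conv_Lp(1)[OF M(2,3,4) _ _ r], erule M(5), simp)
    define C where "C = ?S * (onorm ?At * (16 * Lp_norm 2 g) / \<nu>)"
    have C: "C \<ge> 0" using S K \<nu>(1) by (simp add: C_def)
    have "\<exists>v. v \<in> Lp_space ?q \<and> Lp_norm ?q v \<le> C / real (Suc k) \<and> (\<forall>x. norm x \<le> real (Suc k) \<longrightarrow> v x = g x)" for k
    proof -
      let ?R = "real (Suc k)"
      obtain \<theta> D\<theta> where C\<theta>: "C1 \<theta> (D\<theta> :: real^'n \<Rightarrow> real^'n)"
        and \<theta>: "\<And>x. norm x \<le> ?R \<Longrightarrow> \<theta> x = 1" "\<And>x. 2 * ?R \<le> norm x \<Longrightarrow> \<theta> x = 0"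
        "\<And>x. norm (D\<theta> x) \<le> 16 / ?R"
        using cutoff_exists[of ?R, where 'a = "real^'n"] by (metis of_nat_0_less_iff zero_less_Suc)
      let ?v = "\<lambda>x. \<theta> x *\<^sub>R g x" and ?Dv = "\<lambda>x. \<theta> x *\<^sub>R P x + g x \<otimes>\<^sub>v D\<theta> x"
      have v: "C1c ?v ?Dv" by (rule C1c_cutoff[OF P(1) C\<theta>]) (erule \<theta>(2))
      have Av: "?At (?Dv x) = ?At (g x \<otimes>\<^sub>v D\<theta> x)" for x
        by (simp add: linear_add[OF At] linear_cmul[OF At] P(2))
      have "\<nu> * Lp_norm 2 ?Dv \<le> Lp_norm 2 (\<lambda>x. ?At (?Dv x))"
        using \<nu>(1) by (intro elliptic_gradient_bound[OF At _ transposed_elliptic[OF A \<nu>] v]) simp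
      also have "\<dots> \<le> onorm ?At * (16 / ?R) * Lp_norm 2 g"
      proof (rule Lp_bound(2)[OF _ _ gL])
        have "?Dv \<in> Lp_space 2" by (rule C1c_Lp(2)[OF v]) simp
        then show "(\<lambda>x. ?At (?Dv x)) \<in> borel_measurable lebesgue"
          by (intro Lp_space_measurable[of _ 2] Lp_linear(1)[OF _ At]) simp_all
        have "norm (?At (?Dv x)) \<le> onorm ?At * (16 / ?R) * norm (g x)" for x
        proof -
          have "norm (?At (?Dv x)) \<le> onorm ?At * norm (g x \<otimes>\<^sub>v D\<theta> x)"
            unfolding Av using At by (intro onorm) (simp add: linear_conv_bounded_linear)
          also have "\<dots> \<le> onorm ?At * (norm (g x) * (16 / ?R))"
            unfolding norm_tensor by (intro mult_left_mono \<theta>(3) K) auto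
          finally show ?thesis by (simp only: mult_ac)
        qed
        then show "AE x in lebesgue. norm (?At (?Dv x)) \<le> onorm ?At * (16 / ?R) * norm (g x)" by simp
      qed (use K in auto)
      finally have h: "\<nu> * Lp_norm 2 ?Dv \<le> onorm ?At * (16 / ?R) * Lp_norm 2 g" .
      have "Lp_norm 2 ?Dv = \<nu> * Lp_norm 2 ?Dv / \<nu>" using \<nu>(1) by simp
      also have "\<dots> \<le> (onorm ?At * (16 / ?R) * Lp_norm 2 g) / \<nu>"
        by (rule divide_right_mono[OF h]) (use \<nu>(1) in simp)
      finally have "Lp_norm 2 ?Dv \<le> (onorm ?At * (16 / ?R) * Lp_norm 2 g) / \<nu>" .
      then have "?S * Lp_norm 2 ?Dv \<le> ?S * ((onorm ?At * (16 / ?R) * Lp_norm 2 g) / \<nu>)"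
        by (intro mult_left_mono S)
      also have "\<dots> = C / ?R" by (simp add: C_def mult_ac)
      finally have "Lp_norm ?q ?v \<le> C / ?R" using Sobolev_inequality[OF n v] by linarith
      moreover have "?v \<in> Lp_space ?q" by (rule C1c_Lp(1)[OF v q(2)])
      ultimately show ?thesis using \<theta>(1) by (intro exI[of _ ?v]) auto
    qed
    then obtain v where v: "\<And>k. v k \<in> Lp_space ?q" "\<And>k. Lp_norm ?q (v k) \<le> C / real (Suc k)"
      "\<And>k x. norm x \<le> real (Suc k) \<Longrightarrow> v k x = g x" by metis
    have lim: "(\<lambda>k. v (k + j) x) \<longlonglongrightarrow> g x" for x j
    proof -
      obtain k0 where k0: "norm x \<le> real k0" using real_arch_simple by blast
      have "\<forall>\<^sub>F k in sequentially. g x = v (k + j) x"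
        using eventually_ge_at_top[of k0]
      proof eventually_elim
        case (elim k)
        then show ?case using k0 v(3)[of x "k + j"] by simp
      qed
      then show ?thesis by (rule Lim_transform_eventually[OF tendsto_const])
    qed
    have gq: "g \<in> Lp_space ?q \<and> Lp_norm ?q g \<le> C / real (Suc j)" for j
    proof -
      have "Lp_norm ?q (v (k + j)) \<le> C / real (Suc j)" for k
        by (rule order_trans[OF v(2)]) (auto intro!: divide_left_mono C)
      then show ?thesis
        using Lp_fatou[of ?q "\<lambda>k. v (k + j)" "C / real (Suc j)" g] q(2) v(1) C lim Lp_space_measurable[OF gL]
        by simp
    qed
    have "(\<lambda>j. C / real (Suc j)) \<longlonglongrightarrow> 0"
      using tendsto_mult[OF tendsto_const[of C] LIMSEQ_inverse_real_of_nat] by (simp add: divide_inverse)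
    then have "Lp_norm ?q g \<le> 0" using gq by (intro LIMSEQ_le_const) auto
    then have "Lp_norm ?q g = 0" using Lp_norm_nonneg[of ?q g] by linarith
    then show ?thesis using Lp_norm_eq_0D[OF q(2), of g] gq unfolding g_def by blast
  qed
  have "Lp_norm 2 r \<le> 0 + \<delta>" if \<delta>: "\<delta> > 0" for \<delta>
  proof -
    obtain e where e: "e > 0" "\<And>e' \<rho> D\<rho>. 0 < e' \<Longrightarrow> e' \<le> e \<Longrightarrow> mollifier e' \<rho> D\<rho> \<Longrightarrow>
        Lp_norm 2 (\<lambda>x. conv \<rho> r x - r x) < \<delta>"
      using conv_Lp_close[OF _ r \<delta>] by auto
    obtain \<rho> and D\<rho> :: "real^'n \<Rightarrow> real^'n" where m: "mollifier e \<rho> D\<rho>"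
      using mollifier_exists[OF e(1)] by blast
    note M = mollifierD[OF m]
    have cL: "conv \<rho> r \<in> Lp_space 2" by (rule conv_Lp(1)[OF M(2,3,4) _ _ r], erule M(5), simp)
    have "Lp_norm 2 r = Lp_norm 2 (\<lambda>x. conv \<rho> r x - r x)"
    proof (rule Lp_norm_cong_AE)
      show "r \<in> borel_measurable lebesgue" by (rule Lp_space_measurable[OF r])
      show "(\<lambda>x. conv \<rho> r x - r x) \<in> borel_measurable lebesgue"
        by (rule Lp_space_measurable[OF Lp_diff(1)[OF _ cL r]]) simp
      show "AE x in lebesgue. norm (r x) = norm (conv \<rho> r x - r x)"
        using zero[OF m] by eventually_elim simp
    qed
    then show ?thesis using e(2)[OF e(1) _ m] by simp
  qed
  then have "Lp_norm 2 r \<le> 0" by (rule field_le_epsilon)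
  then have "Lp_norm 2 r = 0" using Lp_norm_nonneg[of 2 r] by linarith
  then show ?thesis using Lp_norm_eq_0D[OF _ r] by simp
qed

subsection \<open>Least squares\<close>

lemma L2_parallelogram:
  fixes f g :: "'a::euclidean_space \<Rightarrow> 'b::euclidean_space"
  assumes f: "f \<in> Lp_space 2" and g: "g \<in> Lp_space 2"
  shows "(Lp_norm 2 (\<lambda>x. f x - g x))\<^sup>2 + (Lp_norm 2 (\<lambda>x. f x + g x))\<^sup>2 = 2 * (Lp_norm 2 f)\<^sup>2 + 2 * (Lp_norm 2 g)\<^sup>2"
  using L2_norm_add_sq[OF f g, of 1] L2_norm_add_sq[OF f g, of "-1"] by simp

text \<open>The residual is minimised over compactly supported fields. By the parallelogram law and ellipticity the
  gradients of a minimising sequence form a Cauchy sequence, and the residual of the limit is orthogonal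
  to the range of \<open>A\<close> on gradients.\<close>

theorem linear_system_solvable:
  fixes A :: "real^'n::finite^'m::finite \<Rightarrow> real^'m"
  assumes n: "CARD('n) \<ge> 3" and A: "linear A"
    and \<nu>: "0 < \<nu>" "\<And>\<eta> a. \<nu> * norm (\<eta> \<otimes>\<^sub>v a) \<le> norm (A (\<eta> \<otimes>\<^sub>v a))"
    and f: "f \<in> Lp_space 2"
  shows "\<exists>u G. test_limit u G \<and> (AE x in lebesgue. A (G x) = f x)"
proof -
  have AL: "(\<lambda>x. A (G x)) \<in> Lp_space 2" if "G \<in> Lp_space 2" for G :: "real^'n \<Rightarrow> real^'n^'m"
    using that by (intro Lp_linear(1)[OF _ A]) auto
  have K: "onorm A \<ge> 0" using A by (intro onorm_pos_le) (simp add: linear_conv_bounded_linear)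
  define E where "E G = Lp_norm 2 (\<lambda>x. f x - A (G x))" for G :: "real^'n \<Rightarrow> real^'n^'m"
  let ?V = "{G. \<exists>v. C1c v G} :: (real^'n \<Rightarrow> real^'n^'m) set"
  have V0: "?V \<noteq> {}" using C1c_zero by blast
  have VL: "G \<in> Lp_space 2" if "G \<in> ?V" for G using that C1c_Lp(2) by fastforce
  define d where "d = (INF G\<in>?V. E G)"
  have bdd: "bdd_below (E ` ?V)" by (rule bdd_belowI[of _ 0]) (auto simp: E_def)
  have dle: "d \<le> E G" if "G \<in> ?V" for G unfolding d_def by (rule cINF_lower[OF bdd that])
  have d0: "0 \<le> d" unfolding d_def using V0 by (intro cINF_greatest) (auto simp: E_def)
  have "\<exists>G\<in>?V. E G < sqrt (d\<^sup>2 + 1 / real (Suc k))" for k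
  proof -
    have "d < sqrt (d\<^sup>2 + 1 / real (Suc k))" using d0 by (intro real_less_rsqrt) simp
    then show ?thesis unfolding d_def using cINF_less_iff[OF V0 bdd] by (simp add: d_def)
  qed
  then obtain G where G: "\<And>k. G k \<in> ?V" "\<And>k. E (G k) < sqrt (d\<^sup>2 + 1 / real (Suc k))" by metis
  obtain v where v: "\<And>k. C1c (v k) (G k)" using G(1) by (simp, metis)
  note GL = VL[OF G(1)]
  have res: "(\<lambda>x. f x - A (H x)) \<in> Lp_space 2" if "H \<in> Lp_space 2" for H
    by (intro Lp_diff f AL that) simp
  have Esq: "(E (G k))\<^sup>2 < d\<^sup>2 + 1 / real (Suc k)" for k
  proof -
    have "(E (G k))\<^sup>2 < (sqrt (d\<^sup>2 + 1 / real (Suc k)))\<^sup>2"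
      using G(2)[of k] by (intro power_strict_mono) (auto simp: E_def)
    then show ?thesis by simp
  qed
  have close: "(\<nu> * Lp_norm 2 (\<lambda>x. G k x - G l x))\<^sup>2 \<le> 2 / real (Suc k) + 2 / real (Suc l)" for k l
  proof -
    have "C1c (\<lambda>x. (1/2) *\<^sub>R (v k x + v l x)) (\<lambda>x. (1/2) *\<^sub>R (G k x + G l x))"
      using C1c_add_scale[OF C1c_zero C1c_add_scale[OF v[of k] v[of l], of 1], of "1/2"] by simp
    then have mid: "(\<lambda>x. (1/2) *\<^sub>R (G k x + G l x)) \<in> ?V" by blast
    have "\<nu> * Lp_norm 2 (\<lambda>x. G k x - G l x) \<le> Lp_norm 2 (\<lambda>x. A (G k x - G l x))"
      using \<nu>(1) by (intro elliptic_gradient_bound[OF A _ \<nu>(2) C1c_diff[OF v v]]) simp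
    also have "\<dots> = Lp_norm 2 (\<lambda>x. (f x - A (G l x)) - (f x - A (G k x)))"
      by (simp add: linear_diff[OF A])
    finally have "(\<nu> * Lp_norm 2 (\<lambda>x. G k x - G l x))\<^sup>2 \<le> (Lp_norm 2 (\<lambda>x. (f x - A (G l x)) - (f x - A (G k x))))\<^sup>2"
      using \<nu>(1) by (intro power_mono) auto
    also have "\<dots> = 2 * (E (G l))\<^sup>2 + 2 * (E (G k))\<^sup>2
        - (Lp_norm 2 (\<lambda>x. (f x - A (G l x)) + (f x - A (G k x))))\<^sup>2"
      using L2_parallelogram[OF res[OF GL[of l]] res[OF GL[of k]]] by (simp add: E_def)
    also have "(\<lambda>x. (f x - A (G l x)) + (f x - A (G k x))) = (\<lambda>x. 2 *\<^sub>R (f x - A ((1/2) *\<^sub>R (G k x + G l x))))"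
      by (simp add: fun_eq_iff linear_add[OF A] linear_cmul[OF A] algebra_simps scaleR_2)
    also have "(Lp_norm 2 (\<lambda>x. 2 *\<^sub>R (f x - A ((1/2) *\<^sub>R (G k x + G l x)))))\<^sup>2
        = 4 * (E (\<lambda>x. (1/2) *\<^sub>R (G k x + G l x)))\<^sup>2"
      unfolding L2_norm_sq E_def by (simp add: power_mult_distrib)
    also have "2 * (E (G l))\<^sup>2 + 2 * (E (G k))\<^sup>2 - 4 * (E (\<lambda>x. (1/2) *\<^sub>R (G k x + G l x)))\<^sup>2
        \<le> 2 * (d\<^sup>2 + 1 / real (Suc l)) + 2 * (d\<^sup>2 + 1 / real (Suc k)) - 4 * d\<^sup>2"
    proof -
      have "d\<^sup>2 \<le> (E (\<lambda>x. (1/2) *\<^sub>R (G k x + G l x)))\<^sup>2" using dle[OF mid] d0 by (intro power_mono) auto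
      moreover have "2 * y + 2 * x - 4 * z \<le> 2 * (D + b) + 2 * (D + a) - 4 * D"
        if "D \<le> z" "x < D + a" "y < D + b" for x y z D a b :: real
        using that by simp
      ultimately show ?thesis using Esq[of k] Esq[of l] by blast
    qed
    also have "\<dots> = 2 / real (Suc k) + 2 / real (Suc l)" by simp
    finally show ?thesis .
  qed
  have cauchy: "\<exists>M. \<forall>m\<ge>M. \<forall>k\<ge>M. Lp_norm 2 (\<lambda>x. G m x - G k x) < e" if e: "e > 0" for e
  proof -
    have "(\<nu> * e)\<^sup>2 / 4 > 0" using e \<nu>(1) by simp
    then obtain M where M: "1 / real (Suc M) < (\<nu> * e)\<^sup>2 / 4" using nat_approx_posE by blast
    have "Lp_norm 2 (\<lambda>x. G m x - G k x) < e" if mk: "m \<ge> M" "k \<ge> M" for m k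
    proof -
      have "1 / real (Suc j) \<le> 1 / real (Suc M)" if "j \<ge> M" for j
        using that by (intro divide_left_mono) auto
      from this[OF mk(1)] this[OF mk(2)]
      have "(\<nu> * Lp_norm 2 (\<lambda>x. G m x - G k x))\<^sup>2 < (\<nu> * e)\<^sup>2"
        using close[of m k] M by simp
      then have "\<nu> * Lp_norm 2 (\<lambda>x. G m x - G k x) < \<nu> * e"
        by (rule power_less_imp_less_base) (use e \<nu>(1) in simp)
      then show ?thesis using \<nu>(1) by simp
    qed
    then show ?thesis by blast
  qed
  obtain u G' where u: "test_limit u G'" and lim: "(\<lambda>k. Lp_norm 2 (\<lambda>x. G k x - G' x)) \<longlonglongrightarrow> 0"
    using test_limit_complete[OF n C1c_test_limit[OF n v] cauchy] by blast
  have G'L: "G' \<in> Lp_space 2" by (rule test_limitD(2)[OF u])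
  define r where "r x = f x - A (G' x)" for x
  have rL: "r \<in> Lp_space 2" unfolding r_def[abs_def] by (rule res[OF G'L])
  have Alim: "Lp_norm 2 (\<lambda>x. A (G k x) - A (G' x)) \<le> onorm A * Lp_norm 2 (\<lambda>x. G k x - G' x)" for k
    using Lp_linear(2)[OF _ A Lp_diff(1)[OF _ GL[of k] G'L]] by (simp add: linear_diff[OF A])
  have Klim: "(\<lambda>k. onorm A * Lp_norm 2 (\<lambda>x. G k x - G' x)) \<longlonglongrightarrow> 0"
    using tendsto_mult[OF tendsto_const[of "onorm A"] lim] by simp
  have rd: "Lp_norm 2 r \<le> d"
  proof -
    have "(\<lambda>k. sqrt (d\<^sup>2 + 1 / real (Suc k)) + onorm A * Lp_norm 2 (\<lambda>x. G k x - G' x)) \<longlonglongrightarrow> sqrt (d\<^sup>2 + 0) + 0"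
      using LIMSEQ_inverse_real_of_nat by (intro tendsto_intros Klim) (simp add: inverse_eq_divide)
    moreover have "Lp_norm 2 r \<le> sqrt (d\<^sup>2 + 1 / real (Suc k)) + onorm A * Lp_norm 2 (\<lambda>x. G k x - G' x)" for k
    proof -
      have "Lp_norm 2 r \<le> Lp_norm 2 (\<lambda>x. f x - A (G k x)) + Lp_norm 2 (\<lambda>x. r x - (f x - A (G k x)))"
        by (rule Lp_norm_triangle_sub[OF _ rL res[OF GL]]) simp
      also have "(\<lambda>x. r x - (f x - A (G k x))) = (\<lambda>x. A (G k x) - A (G' x))" by (simp add: r_def)
      finally show ?thesis using Alim[of k] G(2)[of k] by (simp add: E_def)
    qed
    ultimately have "Lp_norm 2 r \<le> sqrt (d\<^sup>2 + 0) + 0" by (intro LIMSEQ_le_const) auto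
    then show ?thesis using d0 by simp
  qed
  have orth: "(LINT x|lebesgue. r x \<bullet> A (D\<phi> x)) = 0" if \<phi>: "C1c \<phi> D\<phi>" for \<phi> D\<phi>
  proof -
    have \<phi>L: "D\<phi> \<in> Lp_space 2" by (rule C1c_Lp(2)[OF \<phi>]) simp
    let ?c = "LINT x|lebesgue. r x \<bullet> A (D\<phi> x)" and ?b = "Lp_norm 2 (\<lambda>x. A (D\<phi> x))"
    have tL: "(\<lambda>x. t *\<^sub>R A (D\<phi> x)) \<in> Lp_space 2" for t by (intro Lp_scaleR AL \<phi>L)
    have dt: "d \<le> Lp_norm 2 (\<lambda>x. r x + t *\<^sub>R A (D\<phi> x))" for t
    proof -
      have "d - onorm A * Lp_norm 2 (\<lambda>x. G k x - G' x) \<le> Lp_norm 2 (\<lambda>x. r x + t *\<^sub>R A (D\<phi> x))" for k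
      proof -
        have "(\<lambda>x. G k x + (- t) *\<^sub>R D\<phi> x) \<in> ?V" using C1c_add_scale[OF v[of k] \<phi>, of "- t"] by blast
        from dle[OF this] have "d \<le> Lp_norm 2 (\<lambda>x. f x - A (G k x + (- t) *\<^sub>R D\<phi> x))" by (simp only: E_def)
        also have "(\<lambda>x. f x - A (G k x + (- t) *\<^sub>R D\<phi> x))
            = (\<lambda>x. (r x + t *\<^sub>R A (D\<phi> x)) - (A (G k x) - A (G' x)))"
          by (simp add: fun_eq_iff r_def linear_diff[OF A] linear_cmul[OF A])
        also have "Lp_norm 2 \<dots> \<le> Lp_norm 2 (\<lambda>x. r x + t *\<^sub>R A (D\<phi> x)) + Lp_norm 2 (\<lambda>x. A (G k x) - A (G' x))"
          by (intro Lp_diff(2) Lp_add(1) rL tL Lp_diff(1) AL GL G'L) simp_all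
        finally show ?thesis using Alim[of k] by linarith
      qed
      moreover have "(\<lambda>k. d - onorm A * Lp_norm 2 (\<lambda>x. G k x - G' x)) \<longlonglongrightarrow> d - 0"
        by (intro tendsto_intros Klim)
      ultimately have "d - 0 \<le> Lp_norm 2 (\<lambda>x. r x + t *\<^sub>R A (D\<phi> x))"
        by (intro LIMSEQ_le_const2) auto
      then show ?thesis by simp
    qed
    have ineq: "0 \<le> 2 * t * ?c + t\<^sup>2 * ?b\<^sup>2" for t
    proof -
      have "d\<^sup>2 \<le> (Lp_norm 2 (\<lambda>x. r x + t *\<^sub>R A (D\<phi> x)))\<^sup>2" using dt d0 by (intro power_mono) auto
      also have "\<dots> = (Lp_norm 2 r)\<^sup>2 + 2 * t * ?c + t\<^sup>2 * ?b\<^sup>2"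
        by (rule L2_norm_add_sq[OF rL AL[OF \<phi>L]])
      also have "(Lp_norm 2 r)\<^sup>2 \<le> d\<^sup>2" using rd by (intro power_mono) auto
      finally show ?thesis by simp
    qed
    show "?c = 0"
    proof (rule ccontr)
      assume c: "?c \<noteq> 0"
      (* The choice t = - c / (b^2 + 1) makes the quadratic in t negative; the summand 1 covers b = 0. *)
      let ?B = "?b\<^sup>2 + 1"
      have B: "?B > 0" by (simp add: add_nonneg_pos)
      have "2 * (- ?c / ?B) * ?c + (- ?c / ?B)\<^sup>2 * ?b\<^sup>2 = - (?c\<^sup>2 / ?B) * (2 - ?b\<^sup>2 / ?B)"
        using B by (simp add: power2_eq_square divide_simps) (simp add: algebra_simps)
      moreover have "?b\<^sup>2 / ?B < 1" using B by simp
      moreover have "?c\<^sup>2 / ?B > 0" using c B by simp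
      moreover have "0 < x * (2 - y)" if "0 < x" "y < 1" for x y :: real
        using that by (intro mult_pos_pos) auto
      ultimately have "0 < ?c\<^sup>2 / ?B * (2 - ?b\<^sup>2 / ?B)"
        and "2 * (- ?c / ?B) * ?c + (- ?c / ?B)\<^sup>2 * ?b\<^sup>2 = - (?c\<^sup>2 / ?B * (2 - ?b\<^sup>2 / ?B))"
        unfolding mult_minus_left by blast+
      then have "2 * (- ?c / ?B) * ?c + (- ?c / ?B)\<^sup>2 * ?b\<^sup>2 < 0" by linarith
      then show False using ineq[of "- ?c / ?B"] by linarith
    qed
  qed
  have "AE x in lebesgue. r x = 0"
    by (rule orthogonal_to_range_eq_0[OF n A \<nu> rL orth])
  then have "AE x in lebesgue. A (G' x) = f x" by eventually_elim (simp add: r_def)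
  with u show ?thesis by blast
qed

section \<open>The nonlinear system\<close>

text \<open>If \<open>G\<close> is simple, the composition is pieced together from countably many of the functions
  \<open>\<lambda>x. F x P\<close>; continuity in the second argument passes to the limit, almost everywhere.\<close>

lemma caratheodory_composition_measurable:
  fixes F :: "real^'n::finite \<Rightarrow> real^'n^'m::finite \<Rightarrow> real^'m"
  assumes F: "caratheodory F" and G: "G \<in> borel_measurable lebesgue"
  shows "(\<lambda>x. F x (G x)) \<in> borel_measurable lebesgue"
proof -
  obtain s where s: "\<And>i. simple_function lebesgue (s i)" "\<And>x. (\<lambda>i. s i x) \<longlonglongrightarrow> G x"
    using borel_measurable_implies_sequence_metric[OF G, of 0] by auto
  have m: "(\<lambda>x. F x (s i x)) \<in> borel_measurable lebesgue" for i
  proof (rule measurable_compose_countable'[where I = "s i ` space lebesgue" and f = "\<lambda>P x. F x P"])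
    show "(\<lambda>x. F x P) \<in> borel_measurable lebesgue" for P
      using F by (simp add: caratheodory_def)
    show "countable (s i ` space lebesgue)"
      using simple_functionD(1)[OF s(1)] by (rule countable_finite)
    show "s i \<in> lebesgue \<rightarrow>\<^sub>M count_space (s i ` space lebesgue)"
      using simple_functionD[OF s(1)[of i]]
      by (subst measurable_count_space_eq_countable) (auto intro: countable_finite)
  qed
  define L where "L x = lim (\<lambda>i. F x (s i x))" for x
  have Lm: "L \<in> borel_measurable lebesgue"
    unfolding L_def by (intro borel_measurable_lim_metric m)
  have "AE x in lebesgue. continuous_on UNIV (F x)"
    using F by (simp add: caratheodory_def)
  then have "AE x in lebesgue. L x = F x (G x)"
  proof eventually_elim
    case (elim x)
    then have "(\<lambda>i. F x (s i x)) \<longlonglongrightarrow> F x (G x)"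
      by (rule continuous_on_tendsto_compose[OF _ s(2)]) auto
    then show ?case by (simp add: L_def limI)
  qed
  show ?thesis
  proof (rule measurableI)
    fix B :: "(real^'m) set" assume B: "B \<in> sets borel"
    have "L -` B \<inter> space lebesgue \<in> sets lebesgue" using Lm B by (rule measurable_sets)
    moreover have "AE x in lebesgue. x \<in> L -` B \<inter> space lebesgue \<longleftrightarrow> x \<in> (\<lambda>x. F x (G x)) -` B \<inter> space lebesgue"
      using \<open>AE x in lebesgue. L x = F x (G x)\<close> by eventually_elim simp
    ultimately show "(\<lambda>x. F x (G x)) -` B \<inter> space lebesgue \<in> sets lebesgue"
      using completion.in_sets_AE[where M = lborel] by blast
  qed simp
qed

text \<open>The number \<open>\<kappa>\<close> is the essential supremum. It is nonnegative because every deviation is and the whole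
  space has positive measure; thus the strict inequality also yields \<open>0 < \<nu>\<close>.\<close>

lemma strictly_elliptic_nearness:
  fixes F :: "real^'n::finite \<Rightarrow> real^'n^'m::finite \<Rightarrow> real^'m"
  assumes F: "strictly_elliptic F"
  shows "\<exists>A \<nu> \<kappa>. linear A \<and> 0 < \<nu> \<and> (\<forall>\<eta> a. \<nu> * norm (\<eta> \<otimes>\<^sub>v a) \<le> norm (A (\<eta> \<otimes>\<^sub>v a))) \<and>
    0 \<le> \<kappa> \<and> \<kappa> < \<nu> \<and>
    (AE x in lebesgue. \<forall>P Q. norm (F x P - F x Q - A (P - Q)) \<le> \<kappa> * norm (P - Q))"
proof -
  obtain A where A: "linear A" and less: "esssup lebesgue (deviation F A) < ereal (ellipticity_constant A)"
    using F by (auto simp: strictly_elliptic_def)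
  let ?\<nu> = "ellipticity_constant A" and ?e = "esssup lebesgue (deviation F A)"
  have ae: "AE x in lebesgue. deviation F A x \<le> ?e" by (rule esssup_AE)
  have dev0: "0 \<le> deviation F A x" for x
  proof -
    have "axis undefined (axis undefined 1) \<noteq> (0 :: real^'n^'m)" by (simp add: axis_eq_0_iff)
    then have "ereal (norm ((F x (0 + axis undefined (axis undefined 1)) - F x 0 - A (axis undefined (axis undefined 1)))
        /\<^sub>R norm (axis undefined (axis undefined 1) :: real^'n^'m))) \<le> deviation F A x"
      unfolding deviation_def by (intro SUP_upper2[of 0] SUP_upper) auto
    moreover have "(0::ereal) \<le> ereal (norm ((F x (0 + axis undefined (axis undefined 1)) - F x 0 - A (axis undefined (axis undefined 1)))
        /\<^sub>R norm (axis undefined (axis undefined 1) :: real^'n^'m)))" by simp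
    ultimately show ?thesis by (rule order_trans[rotated])
  qed
  have "AE x in (lebesgue :: (real^'n) measure). 0 \<le> ?e"
    using ae by eventually_elim (rule order_trans[OF dev0])
  then have e0: "0 \<le> ?e" by (simp add: eventually_const_iff ae_filter_eq_bot_iff)
  define \<kappa> where "\<kappa> = real_of_ereal ?e"
  have \<kappa>: "?e = ereal \<kappa>"
    unfolding \<kappa>_def using e0 less by (cases ?e) auto
  have \<kappa>0: "0 \<le> \<kappa>" "\<kappa> < ?\<nu>" using e0 less unfolding \<kappa> by auto
  obtain \<eta>0 a0 where min: "?\<nu> = norm (A (\<eta>0 \<otimes>\<^sub>v a0))"
      "\<And>\<eta>' a'. norm \<eta>' = 1 \<Longrightarrow> norm a' = 1 \<Longrightarrow> norm (A (\<eta>0 \<otimes>\<^sub>v a0)) \<le> norm (A (\<eta>' \<otimes>\<^sub>v a'))"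
    using ellipticity_constant_attained[OF A] by metis
  have ell: "?\<nu> * norm (\<eta> \<otimes>\<^sub>v a) \<le> norm (A (\<eta> \<otimes>\<^sub>v a))" for \<eta> a
  proof (cases "\<eta> = 0 \<or> a = 0")
    case True
    then have "norm (\<eta> \<otimes>\<^sub>v a) = 0" by (auto simp: norm_tensor)
    then show ?thesis by simp
  next
    case False
    have t: "\<eta> \<otimes>\<^sub>v a = (norm \<eta> * norm a) *\<^sub>R (sgn \<eta> \<otimes>\<^sub>v sgn a)"
    proof -
      have "sgn \<eta> \<otimes>\<^sub>v sgn a = (inverse (norm \<eta>) * inverse (norm a)) *\<^sub>R (\<eta> \<otimes>\<^sub>v a)"
        by (simp add: sgn_div_norm tensor_scaleR_left linear_cmul[OF tensor_linear_right])
      moreover have "norm \<eta> * norm a * (inverse (norm \<eta>) * inverse (norm a)) = 1"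
        using False by (auto simp: field_simps)
      ultimately show ?thesis by (simp only: scaleR_scaleR scaleR_one)
    qed
    have "?\<nu> \<le> norm (A (sgn \<eta> \<otimes>\<^sub>v sgn a))"
      unfolding min(1) using False by (intro min(2)) (simp_all add: norm_sgn)
    then have "(norm \<eta> * norm a) * ?\<nu> \<le> (norm \<eta> * norm a) * norm (A (sgn \<eta> \<otimes>\<^sub>v sgn a))"
      by (intro mult_left_mono) auto
    also have "\<dots> = norm (A (\<eta> \<otimes>\<^sub>v a))"
      unfolding t by (simp add: linear_cmul[OF A] abs_mult)
    finally show ?thesis by (simp add: norm_tensor mult.commute)
  qed
  have near: "AE x in lebesgue. \<forall>P Q. norm (F x P - F x Q - A (P - Q)) \<le> \<kappa> * norm (P - Q)"
    using ae
  proof (eventually_elim, intro allI)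
    fix x P Q assume x: "deviation F A x \<le> ?e"
    show "norm (F x P - F x Q - A (P - Q)) \<le> \<kappa> * norm (P - Q)"
    proof (cases "P = Q")
      case True
      then show ?thesis by (simp add: linear_0[OF A])
    next
      case False
      then have nz: "P - Q \<noteq> 0" by simp
      have "ereal (norm ((F x (Q + (P - Q)) - F x Q - A (P - Q)) /\<^sub>R norm (P - Q))) \<le> deviation F A x"
        unfolding deviation_def using nz by (intro SUP_upper2[of Q] SUP_upper) auto
      also have "\<dots> \<le> ereal \<kappa>" using x \<kappa> by simp
      finally have "norm (F x P - F x Q - A (P - Q)) / norm (P - Q) \<le> \<kappa>" by (simp add: divide_inverse mult.commute)
      then show ?thesis using nz by (simp add: divide_le_eq)
    qed
  qed
  have "0 < ?\<nu>" using \<kappa>0 by linarith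
  with A ell \<kappa>0 near show ?thesis by blast
qed

subsection \<open>Contraction\<close>

lemma Lp_bound_two:
  fixes d :: "'a::euclidean_space \<Rightarrow> 'b::euclidean_space" and g :: "'a \<Rightarrow> 'c::euclidean_space"
    and h :: "'a \<Rightarrow> 'e::euclidean_space"
  assumes p: "1 \<le> p" and d: "d \<in> borel_measurable lebesgue" and g: "g \<in> Lp_space p" and h: "h \<in> Lp_space p"
    and ab: "0 \<le> a" "0 \<le> b" and le: "AE x in lebesgue. norm (d x) \<le> a * norm (g x) + b * norm (h x)"
  shows "d \<in> Lp_space p" "Lp_norm p d \<le> a * Lp_norm p g + b * Lp_norm p h"
proof -
  have scaled: "(\<lambda>x. c * norm (k x)) \<in> Lp_space p" "Lp_norm p (\<lambda>x. c * norm (k x)) \<le> c * Lp_norm p k"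
    if "k \<in> Lp_space p" "0 \<le> c" for c and k :: "'a \<Rightarrow> 'z::euclidean_space"
    using Lp_bound[of p "\<lambda>x. c * norm (k x)" k c] p that Lp_space_measurable[OF that(1)] by (auto simp: abs_mult)
  let ?s = "\<lambda>x. a * norm (g x) + b * norm (h x)"
  have s: "?s \<in> Lp_space p" by (rule Lp_add(1)[OF p scaled(1)[OF g ab(1)] scaled(1)[OF h ab(2)]])
  have le': "AE x in lebesgue. norm (d x) \<le> norm (?s x)" using le by eventually_elim simp
  have p0: "0 < p" using p by simp
  show "d \<in> Lp_space p" by (rule Lp_mono(1)[OF p0 d s le'])
  have "Lp_norm p d \<le> Lp_norm p ?s" by (rule Lp_mono(2)[OF p0 d s le'])
  also have "\<dots> \<le> Lp_norm p (\<lambda>x. a * norm (g x)) + Lp_norm p (\<lambda>x. b * norm (h x))"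
    by (rule Lp_triangle[OF p scaled(1)[OF g ab(1)] scaled(1)[OF h ab(2)]])
  also have "\<dots> \<le> a * Lp_norm p g + b * Lp_norm p h"
    by (intro add_mono scaled(2) g h ab)
  finally show "Lp_norm p d \<le> a * Lp_norm p g + b * Lp_norm p h" .
qed

lemma geometric_Cauchy:
  fixes p :: "nat \<Rightarrow> 'a::euclidean_space \<Rightarrow> 'b::euclidean_space"
  assumes p: "\<And>k. p k \<in> Lp_space 2" and c: "0 \<le> c" "c < 1"
    and step: "\<And>k. Lp_norm 2 (\<lambda>x. p (Suc (Suc k)) x - p (Suc k) x) \<le> c * Lp_norm 2 (\<lambda>x. p (Suc k) x - p k x)"
    and e: "e > 0"
  shows "\<exists>M. \<forall>m\<ge>M. \<forall>k\<ge>M. Lp_norm 2 (\<lambda>x. p m x - p k x) < e"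
proof -
  define D where "D = Lp_norm 2 (\<lambda>x. p 1 x - p 0 x)"
  have D: "D \<ge> 0" by (simp add: D_def)
  have one: "Lp_norm 2 (\<lambda>x. p (Suc k) x - p k x) \<le> D * c ^ k" for k
  proof (induction k)
    case (Suc k)
    have "Lp_norm 2 (\<lambda>x. p (Suc (Suc k)) x - p (Suc k) x) \<le> c * (D * c ^ k)"
      using step[of k] mult_left_mono[OF Suc c(1)] by linarith
    then show ?case by (simp add: mult_ac)
  qed (simp add: D_def)
  have many: "Lp_norm 2 (\<lambda>x. p (k + j) x - p k x) * (1 - c) \<le> D * c ^ k * (1 - c ^ j)" for k j
  proof (induction j)
    case (Suc j)
    have "Lp_norm 2 (\<lambda>x. p (k + Suc j) x - p k x)
        \<le> Lp_norm 2 (\<lambda>x. p (Suc (k + j)) x - p (k + j) x) + Lp_norm 2 (\<lambda>x. p (k + j) x - p k x)"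
      using Lp_dist_triangle[OF _ p[of "Suc (k + j)"] p[of "k + j"] p[of k]] by simp
    also have "\<dots> \<le> D * c ^ (k + j) + Lp_norm 2 (\<lambda>x. p (k + j) x - p k x)" using one by simp
    finally have "Lp_norm 2 (\<lambda>x. p (k + Suc j) x - p k x) * (1 - c)
        \<le> (D * c ^ (k + j) + Lp_norm 2 (\<lambda>x. p (k + j) x - p k x)) * (1 - c)"
      using c by (intro mult_right_mono) auto
    also have "\<dots> \<le> D * c ^ (k + j) * (1 - c) + D * c ^ k * (1 - c ^ j)"
      using Suc by (simp add: distrib_right)
    also have "\<dots> = D * c ^ k * (1 - c ^ Suc j)" by (simp add: power_add algebra_simps)
    finally show ?case .
  qed simp
  have "(\<lambda>k. D * c ^ k) \<longlonglongrightarrow> D * 0" using c by (intro tendsto_intros LIMSEQ_realpow_zero) auto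
  then have "\<forall>\<^sub>F k in sequentially. D * c ^ k < e * (1 - c)"
    by (rule order_tendstoD) (use c e in simp)
  then obtain M where M: "\<And>k. k \<ge> M \<Longrightarrow> D * c ^ k < e * (1 - c)" by (auto simp: eventually_sequentially)
  have near: "Lp_norm 2 (\<lambda>x. p m x - p k x) < e" if "k \<ge> M" "m \<ge> k" for m k
  proof -
    have "k + (m - k) = m" using that by simp
    then have "Lp_norm 2 (\<lambda>x. p m x - p k x) * (1 - c) \<le> D * c ^ k * (1 - c ^ (m - k))"
      using many[of k "m - k"] by simp
    also have "\<dots> \<le> D * c ^ k * 1" using c D by (intro mult_left_mono) auto
    also have "\<dots> < e * (1 - c)" using M that by simp
    finally show ?thesis using c by simp
  qed
  have "Lp_norm 2 (\<lambda>x. p m x - p k x) < e" if "m \<ge> M" "k \<ge> M" for m k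
  proof (cases "k \<le> m")
    case True
    then show ?thesis using near that by simp
  next
    case False
    then show ?thesis using near[of m k] that Lp_norm_minus_commute[OF _ p p, of m k] by simp
  qed
  then show ?thesis by blast
qed

text \<open>The equation is rewritten as \<open>A G = f - (F x G - A G)\<close>. Solving the linear system for the right-hand
  side given by an old \<open>G\<close> produces a new one; by nearness and ellipticity this step contracts distances
  in \<open>L\<^sup>2\<close> by the factor \<open>\<kappa> / \<nu> < 1\<close>, without loss of constants.\<close>

theorem near_linear_system_solvable:
  fixes F :: "real^'n::finite \<Rightarrow> real^'n^'m::finite \<Rightarrow> real^'m"
  assumes n: "CARD('n) \<ge> 3" and F: "caratheodory F" and F0: "AE x in lebesgue. F x 0 = 0"
    and A: "linear A" and \<nu>: "0 < \<nu>" "\<And>\<eta> a. \<nu> * norm (\<eta> \<otimes>\<^sub>v a) \<le> norm (A (\<eta> \<otimes>\<^sub>v a))"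
    and \<kappa>: "0 \<le> \<kappa>" "\<kappa> < \<nu>"
    and near: "AE x in lebesgue. \<forall>P Q. norm (F x P - F x Q - A (P - Q)) \<le> \<kappa> * norm (P - Q)"
    and f: "f \<in> Lp_space 2"
  shows "\<exists>u G. test_limit u G \<and> (AE x in lebesgue. F x (G x) = f x)"
proof -
  have AL: "(\<lambda>x. A (G x)) \<in> Lp_space 2" if "G \<in> Lp_space 2" for G :: "real^'n \<Rightarrow> real^'n^'m"
    using that by (intro Lp_linear(1)[OF _ A]) auto
  have Fm: "(\<lambda>x. F x (G x)) \<in> borel_measurable lebesgue" if "G \<in> Lp_space 2" for G
    by (rule caratheodory_composition_measurable[OF F Lp_space_measurable[OF that]])
  have Am: "(\<lambda>x. A (G x)) \<in> borel_measurable lebesgue" if "G \<in> Lp_space 2" for G :: "real^'n \<Rightarrow> real^'n^'m"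
    by (rule Lp_space_measurable[OF AL[OF that]])
  have rhs: "(\<lambda>x. f x - (F x (G x) - A (G x))) \<in> Lp_space 2" if G: "G \<in> Lp_space 2" for G
  proof (rule Lp_bound_two(1)[of 2 _ f G 1 \<kappa>])
    note [measurable] = Fm[OF G] Am[OF G] Lp_space_measurable[OF f]
    show "(\<lambda>x. f x - (F x (G x) - A (G x))) \<in> borel_measurable lebesgue" by measurable
    show "AE x in lebesgue. norm (f x - (F x (G x) - A (G x))) \<le> 1 * norm (f x) + \<kappa> * norm (G x)"
      using F0 near
    proof eventually_elim
      case (elim x)
      have "norm (F x (G x) - F x 0 - A (G x - 0)) \<le> \<kappa> * norm (G x - 0)" using elim(2) by blast
      then have "norm (F x (G x) - A (G x)) \<le> \<kappa> * norm (G x)" using elim(1) by simp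
      then show ?case using norm_triangle_ineq4[of "f x" "F x (G x) - A (G x)"] by simp
    qed
  qed (use f G \<kappa> in auto)
  define sol where "sol H = (SOME p. test_limit (fst p) (snd p) \<and>
      (AE x in lebesgue. A (snd p x) = f x - (F x (H x) - A (H x))))" for H
  have sol: "test_limit (fst (sol H)) (snd (sol H))"
    "AE x in lebesgue. A (snd (sol H) x) = f x - (F x (H x) - A (H x))" if H: "H \<in> Lp_space 2" for H
  proof -
    have "\<exists>p. test_limit (fst p) (snd p) \<and> (AE x in lebesgue. A (snd p x) = f x - (F x (H x) - A (H x)))"
      using linear_system_solvable[OF n A \<nu> rhs[OF H]] by simp
    from someI_ex[OF this] show "test_limit (fst (sol H)) (snd (sol H))"
      "AE x in lebesgue. A (snd (sol H) x) = f x - (F x (H x) - A (H x))"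
      unfolding sol_def by blast+
  qed
  define S where "S = rec_nat (sol (\<lambda>x. 0)) (\<lambda>_ p. sol (snd p))"
  have S0: "S 0 = sol (\<lambda>x. 0)" and SS: "S (Suc k) = sol (snd (S k))" for k by (simp_all add: S_def)
  define p where "p k = snd (S k)" for k
  have tl: "test_limit (fst (S k)) (p k)" for k
  proof (induction k)
    case 0
    show ?case unfolding p_def S0 by (rule sol(1)) simp
  next
    case (Suc k)
    have "p k \<in> Lp_space 2" by (rule test_limitD(2)[OF Suc])
    then show ?case unfolding p_def SS by (rule sol(1))
  qed
  have pL: "p k \<in> Lp_space 2" for k by (rule test_limitD(2)[OF tl])
  have eq: "AE x in lebesgue. A (p (Suc k) x) = f x - (F x (p k x) - A (p k x))" for k
    using sol(2)[OF pL[of k]] unfolding p_def SS .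
  have step: "Lp_norm 2 (\<lambda>x. p (Suc (Suc k)) x - p (Suc k) x) \<le> \<kappa> / \<nu> * Lp_norm 2 (\<lambda>x. p (Suc k) x - p k x)" for k
  proof -
    have "\<nu> * Lp_norm 2 (\<lambda>x. p (Suc (Suc k)) x - p (Suc k) x) \<le> Lp_norm 2 (\<lambda>x. A (p (Suc (Suc k)) x - p (Suc k) x))"
      using \<nu>(1) by (intro test_limit_elliptic[OF A _ \<nu>(2) test_limit_diff[OF n tl tl]]) simp
    also have "\<dots> \<le> \<kappa> * Lp_norm 2 (\<lambda>x. p (Suc k) x - p k x)"
    proof (rule Lp_bound(2)[OF _ _ Lp_diff(1)[OF _ pL pL] \<kappa>(1)])
      show "(\<lambda>x. A (p (Suc (Suc k)) x - p (Suc k) x)) \<in> borel_measurable lebesgue"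
        by (intro Am Lp_diff(1) pL) simp
      show "AE x in lebesgue. norm (A (p (Suc (Suc k)) x - p (Suc k) x)) \<le> \<kappa> * norm (p (Suc k) x - p k x)"
        using eq[of k] eq[of "Suc k"] near
      proof eventually_elim
        case (elim x)
        have "A (p (Suc (Suc k)) x - p (Suc k) x) = - (F x (p (Suc k) x) - F x (p k x) - A (p (Suc k) x - p k x))"
          using elim(1,2) by (simp add: linear_diff[OF A])
        then have "norm (A (p (Suc (Suc k)) x - p (Suc k) x)) = norm (F x (p (Suc k) x) - F x (p k x) - A (p (Suc k) x - p k x))"
          by (metis norm_minus_cancel)
        also have "\<dots> \<le> \<kappa> * norm (p (Suc k) x - p k x)" using elim(3) by blast
        finally show ?case .
      qed
    qed simp_all
    finally show ?thesis using \<nu>(1) by (simp add: pos_le_divide_eq mult.commute)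
  qed
  have "0 \<le> \<kappa> / \<nu>" "\<kappa> / \<nu> < 1" using \<kappa> \<nu>(1) by simp_all
  note cauchy = geometric_Cauchy[of p "\<kappa> / \<nu>", OF pL this step]
  obtain u G where u: "test_limit u G" and lim: "(\<lambda>k. Lp_norm 2 (\<lambda>x. p k x - G x)) \<longlonglongrightarrow> 0"
    using test_limit_complete[OF n tl cauchy] by blast
  have GL: "G \<in> Lp_space 2" by (rule test_limitD(2)[OF u])
  let ?d = "\<lambda>x. f x - F x (G x)"
  let ?K = "onorm A"
  have A': "bounded_linear A" using A by (simp add: linear_conv_bounded_linear)
  have K: "?K \<ge> 0" by (rule onorm_pos_le[OF A'])
  have dm: "?d \<in> borel_measurable lebesgue"
    using Fm[OF GL] Lp_space_measurable[OF f] by measurable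
  have d: "?d \<in> Lp_space 2 \<and> Lp_norm 2 ?d \<le> ?K * Lp_norm 2 (\<lambda>x. p (Suc k) x - G x) + \<kappa> * Lp_norm 2 (\<lambda>x. p k x - G x)" for k
  proof -
    have ae: "AE x in lebesgue. norm (?d x) \<le> ?K * norm (p (Suc k) x - G x) + \<kappa> * norm (p k x - G x)"
      using eq[of k] near
    proof eventually_elim
      case (elim x)
      have "?d x = A (p (Suc k) x - G x) + (F x (p k x) - F x (G x) - A (p k x - G x))"
        using elim(1) by (simp add: linear_diff[OF A])
      then have "norm (?d x) \<le> norm (A (p (Suc k) x - G x)) + norm (F x (p k x) - F x (G x) - A (p k x - G x))"
        by (metis norm_triangle_ineq)
      also have "\<dots> \<le> ?K * norm (p (Suc k) x - G x) + \<kappa> * norm (p k x - G x)"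
        using elim(2) by (intro add_mono onorm[OF A']) blast
      finally show ?case .
    qed
    show ?thesis
      using Lp_bound_two[OF _ dm Lp_diff(1)[OF _ pL GL] Lp_diff(1)[OF _ pL GL] K \<kappa>(1) ae] by simp
  qed
  have "(\<lambda>k. ?K * Lp_norm 2 (\<lambda>x. p (Suc k) x - G x) + \<kappa> * Lp_norm 2 (\<lambda>x. p k x - G x)) \<longlonglongrightarrow> ?K * 0 + \<kappa> * 0"
    by (intro tendsto_intros lim LIMSEQ_Suc[OF lim])
  then have "Lp_norm 2 ?d \<le> ?K * 0 + \<kappa> * 0" by (rule LIMSEQ_le_const) (use d in blast)
  then have "Lp_norm 2 ?d = 0" using Lp_norm_nonneg[of 2 ?d] by linarith
  then have "AE x in lebesgue. ?d x = 0" using Lp_norm_eq_0D[of 2 ?d] d by simp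
  then have "AE x in lebesgue. F x (G x) = f x" by eventually_elim simp
  with u show ?thesis by blast
qed

theorem theorem9:
  fixes F :: "real^'n::finite \<Rightarrow> real^'n^'m::finite \<Rightarrow> real^'m"
  assumes "CARD('n) \<ge> 3" and "CARD('m) \<ge> 2"
    and "caratheodory F"
    and "AE x in lebesgue. F x 0 = 0"
    and "strictly_elliptic F"
  shows "\<exists>C>0. \<forall>f \<in> Lp_space 2.
           (\<exists>u Du. solves F f u Du) \<and>
           (\<forall>u Du v Dv. solves F f u Du \<longrightarrow> solves F f v Dv \<longrightarrow> (AE x in lebesgue. u x = v x)) \<and>
           (\<forall>u Du. solves F f u Du \<longrightarrow>
              Lp_norm (sobolev_exponent CARD('n)) u + Lp_norm 2 Du \<le> C * Lp_norm 2 f)"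
proof -
  note n = assms(1) and F = assms(3) and F0 = assms(4)
  obtain A \<nu> \<kappa> where A: "linear A" and \<nu>: "0 < \<nu>" "\<And>\<eta> a. \<nu> * norm (\<eta> \<otimes>\<^sub>v a) \<le> norm (A (\<eta> \<otimes>\<^sub>v a))"
    and \<kappa>: "0 \<le> \<kappa>" "\<kappa> < \<nu>"
    and near: "AE x in lebesgue. \<forall>P Q. norm (F x P - F x Q - A (P - Q)) \<le> \<kappa> * norm (P - Q)"
    using strictly_elliptic_nearness[OF assms(5)] by blast
  let ?q = "sobolev_exponent CARD('n)" and ?S = "sobolev_constant CARD('n) CARD('m)"
  note q = sobolev_exponent_ge[OF n]
  have S: "?S \<ge> 0" using n by (simp add: sobolev_constant_def)
  have tl: "test_limit u Du" if "solves F f u Du" for f u Du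
    using that by (intro weak_gradient_test_limit[OF n]) (auto simp: solves_def W_space_def)
  have Am: "(\<lambda>x. A (G x)) \<in> borel_measurable lebesgue" if "G \<in> Lp_space 2" for G :: "real^'n \<Rightarrow> real^'n^'m"
    using Lp_space_measurable[OF Lp_linear(1)[OF _ A that]] by simp
  define C where "C = (?S + 1) / (\<nu> - \<kappa>)"
  have C: "C > 0" using S \<kappa> by (simp add: C_def)
  have existence: "\<exists>u Du. solves F f u Du" if f: "f \<in> Lp_space 2" for f
  proof -
    obtain u G where u: "test_limit u G" "AE x in lebesgue. F x (G x) = f x"
      using near_linear_system_solvable[OF n F F0 A \<nu> \<kappa> near f] by blast
    have "solves F f u G"
      using test_limitD(1,2)[OF u(1)] test_limit_weak_gradient[OF n u(1)] u(2)
      by (auto simp: solves_def W_space_def)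
    then show ?thesis by blast
  qed
  have uniqueness: "AE x in lebesgue. u x = v x" if u: "solves F f u Du" and v: "solves F f v Dv" for f u Du v Dv
  proof -
    note d = test_limit_diff[OF n tl[OF u] tl[OF v]]
    note dL = test_limitD(1,2)[OF d]
    have "\<nu> * Lp_norm 2 (\<lambda>x. Du x - Dv x) \<le> Lp_norm 2 (\<lambda>x. A (Du x - Dv x))"
      using \<nu>(1) by (intro test_limit_elliptic[OF A _ \<nu>(2) d]) simp
    also have "\<dots> \<le> \<kappa> * Lp_norm 2 (\<lambda>x. Du x - Dv x)"
    proof (rule Lp_bound(2)[OF _ Am[OF dL(2)] dL(2) \<kappa>(1)])
      have "AE x in lebesgue. F x (Du x) = f x" "AE x in lebesgue. F x (Dv x) = f x"
        using u v by (simp_all add: solves_def)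
      then show "AE x in lebesgue. norm (A (Du x - Dv x)) \<le> \<kappa> * norm (Du x - Dv x)"
        using near
      proof eventually_elim
        case (elim x)
        have "norm (F x (Du x) - F x (Dv x) - A (Du x - Dv x)) \<le> \<kappa> * norm (Du x - Dv x)" using elim(3) by blast
        then show ?case using elim(1,2) by simp
      qed
    qed simp
    finally have "(\<nu> - \<kappa>) * Lp_norm 2 (\<lambda>x. Du x - Dv x) \<le> 0" by (simp add: left_diff_distrib)
    then have "Lp_norm 2 (\<lambda>x. Du x - Dv x) \<le> 0" using \<kappa>(2) by (simp add: mult_le_0_iff)
    then have "Lp_norm 2 (\<lambda>x. Du x - Dv x) = 0"
      using Lp_norm_nonneg[of 2 "\<lambda>x. Du x - Dv x"] by linarith
    then have "Lp_norm ?q (\<lambda>x. u x - v x) \<le> 0"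
      using test_limit_Sobolev[OF n d] by simp
    then have "Lp_norm ?q (\<lambda>x. u x - v x) = 0"
      using Lp_norm_nonneg[of ?q "\<lambda>x. u x - v x"] by linarith
    then have "AE x in lebesgue. u x - v x = 0"
      by (rule Lp_norm_eq_0D[OF q(2) dL(1)])
    then show ?thesis by eventually_elim simp
  qed
  have estimate: "Lp_norm ?q u + Lp_norm 2 Du \<le> C * Lp_norm 2 f"
    if f: "f \<in> Lp_space 2" and u: "solves F f u Du" for f u Du
  proof -
    have DL: "Du \<in> Lp_space 2" using u by (simp add: solves_def)
    have "\<nu> * Lp_norm 2 Du \<le> Lp_norm 2 (\<lambda>x. A (Du x))"
      using \<nu>(1) by (intro test_limit_elliptic[OF A _ \<nu>(2) tl[OF u]]) simp
    also have "\<dots> \<le> 1 * Lp_norm 2 f + \<kappa> * Lp_norm 2 Du"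
    proof (rule Lp_bound_two(2)[OF _ Am[OF DL] f DL _ \<kappa>(1)])
      have "AE x in lebesgue. F x (Du x) = f x" using u by (simp add: solves_def)
      then show "AE x in lebesgue. norm (A (Du x)) \<le> 1 * norm (f x) + \<kappa> * norm (Du x)"
        using F0 near
      proof eventually_elim
        case (elim x)
        have "norm (F x (Du x) - F x 0 - A (Du x - 0)) \<le> \<kappa> * norm (Du x - 0)" using elim(3) by blast
        then have "norm (f x - A (Du x)) \<le> \<kappa> * norm (Du x)" using elim(1,2) by simp
        then show ?case using norm_triangle_sub[of "A (Du x)" "f x"] by (simp add: norm_minus_commute)
      qed
    qed simp_all
    finally have *: "(\<nu> - \<kappa>) * Lp_norm 2 Du \<le> Lp_norm 2 f" by (simp add: left_diff_distrib)
    have "Lp_norm ?q u + Lp_norm 2 Du \<le> (?S + 1) * Lp_norm 2 Du"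
      using test_limit_Sobolev[OF n tl[OF u]] by (simp add: distrib_right)
    also have "\<dots> = C * ((\<nu> - \<kappa>) * Lp_norm 2 Du)" using \<kappa>(2) by (simp add: C_def)
    also have "\<dots> \<le> C * Lp_norm 2 f" using * C by (intro mult_left_mono) auto
    finally show ?thesis .
  qed
  show ?thesis
    using C existence uniqueness estimate by (intro exI[of _ C] conjI ballI allI impI) blast+
qed

end
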